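(* Let $k\in\{3,4,5\}$ and $\epsilon\in(0,1)$. Assume that the phase field crystal problem $$\partial_t\Phi=\Delta\mu,\qquad \mu=\Phi^3-\epsilon\Phi+(1+\Delta)^2\Phi,$$ with periodic boundary conditions on $\Omega$, has a solution $\Phi\in C^{k+1}[0,T]$ (regularity in time), and write $\Phi^n=\Phi(t_n)$. Let $\phi^n$ be the solution of the BDF-$k$ implicit scheme $$D_k\phi^n=\Delta\mu^n,\qquad \mu^n=(1+\Delta)^2\phi^n+(\phi^n)^3-\epsilon\phi^n,\qquad k\le n\le N.$$ Assume that the starting values preserve the volume, $\langle\phi^\ell,1\rangle=\langle\phi^0,1\rangle$ for $1\le\ell\le k-1$; that $\tau\le\frac{2}{3\epsilon}\min\{b_0^{(k)},\sigma_{Lk}\}$; and that $\mathcal{E}_k[\vec\phi^{k-1}]\le c_0$ for a constant $c_0$ independent of $\tau$. If moreover $\tau\le 1/(2c_4)$, then the numerical solution is convergent in the $L^2$ norm: $$\|\Phi^n-\phi^n\|\le\frac{7\rho_k}{7-k}\exp(2c_4t_{n-k+1})\Big(c_{\mathrm{I},k}\sum_{\ell=0}^{k-1}\|\Phi^\ell-\phi^\ell\|+C_\phi\,t_{n-k+1}\,\tau^k\Big),\qquad k\le n\le N,$$ where $C_\phi$ is a positive constant that may depend on the given data and the solution but is independent of the time step $\tau$ (and of $n$).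
   Context: Setting: $\Omega\subset\mathbb{R}^2$ is a bounded periodic cell with measure $|\Omega|$; all functions are real-valued and $\Omega$-periodic. $\langle f,g\rangle=\int_\Omega fg\,d\mathbf{x}$, $\|f\|=\sqrt{\langle f,f\rangle}$, $\|v\|_{L^\infty}=\max_{\mathbf{x}\in\Omega}|v|$. For mean-zero $v,w$, $\langle v,w\rangle_{-1}:=\langle(-\Delta)^{-1}v,w\rangle$, $\|v\|_{-1}:=\sqrt{\langle v,v\rangle_{-1}}$. Only time is discretized: $t_n=n\tau$, $\tau=T/N$; $\phi^0,\dots,\phi^{k-1}$ are given. BDF formula: $\nabla_\tau v^n:=v^n-v^{n-1}$; $D_kv^n:=\frac1\tau\sum_{j=1}^nb_{n-j}^{(k)}\nabla_\tau v^j$ for $n\ge k$, where $\sum_{\ell=1}^{k}\frac1\ell(1-\zeta)^{\ell-1}=\sum_{\ell=0}^{k-1}b_\ell^{(k)}\zeta^\ell$ and $b_j^{(k)}:=0$ for $j\ge k$; in particular $b_0^{(3)}=\frac{11}6$, $b_0^{(4)}=\frac{25}{12}$, $b_0^{(5)}=\frac{137}{60}$. DOC-$k$ kernels: $\theta_0^{(k)}:=1/b_0^{(k)}$ and $\theta_{n-j}^{(k)}:=-\frac1{b_0^{(k)}}\sum_{\ell=j+1}^n\theta_{n-\ell}^{(k)}b_{\ell-j}^{(k)}$ for $j=n-1,\dots,k$; equivalently $\sum_{\ell=j}^n\theta_{n-\ell}^{(k)}b_{\ell-j}^{(k)}=\delta_{nj}$ (Kronecker delta) for $k\le j\le n$.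 Energy: $\sigma_{L3}=\frac{95}{48}$, $\sigma_{L4}=\frac{4919}{3072}$, $\sigma_{L5}=\frac{646631}{1920000}$. With $\delta_1v_n:=v_n-v_{n-1}$ and $\vec v_n:=(v_n,v_{n-1},\dots)$: $\mathcal{G}_3[\vec v_n]=\frac16v_n^2+\frac16(\frac74v_n-v_{n-1})^2$; $\mathcal{G}_4[\vec v_n]=\frac{13627}{43008}v_n^2+\frac7{24}(\frac{65}{56}v_n-v_{n-1})^2+\frac18(\frac32\delta_1v_n+v_{n-2})^2$; $\mathcal{G}_5[\vec v_n]=\frac{1198850903}{1678080000}v_n^2+\frac{437}{900}(\frac{4931}{6992}v_n-v_{n-1})^2+\frac9{40}(\frac{23}{18}\delta_1v_n+v_{n-2})^2+\frac1{10}(2\delta_1v_n+2v_{n-2}-v_{n-3})^2$. $\langle\mathcal{G}_k[\nabla_\tau\vec\phi^n],1\rangle_{-1}$ is obtained from $\mathcal{G}_k[\vec v_n]$ by substituting $v_m=\nabla_\tau\phi^m$ and replacing each square $(\cdot)^2$ by $\|\cdot\|_{-1}^2$. $E[\phi^n]:=\frac12\|(1+\Delta)\phi^n\|^2+\frac14\|(\phi^n)^2-\epsilon\|^2-\frac14\|\epsilon\|^2$ and $\mathcal{E}_k[\vec\phi^n]:=E[\phi^n]+\frac1\tau\langle\mathcal{G}_k[\nabla_\tau\vec\phi^n],1\rangle_{-1}$ for $n\ge k-1$. Constants: - $\rho_3=10/3$, $\rho_4=6$, $\rho_5=96/5$. - $\mathfrak{m}_{13}=95/48$, $\mathfrak{m}_{14}=1.628$,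 $\mathfrak{m}_{15}=0.3711$; these satisfy $2\sum_{\ell=k}^nw_\ell\sum_{j=k}^\ell b_{\ell-j}^{(k)}w_j\ge\mathfrak{m}_{1k}\sum_{\ell=k}^nw_\ell^2$ for all real sequences and $n\ge k$. - $\mathfrak{m}_{2k}>0$ is a constant such that, for every order $m\ge1$, the lower triangular Toeplitz matrix $B_{k,l}=(b_{i-j}^{(k)})_{1\le j\le i\le m}$ satisfies $\lambda_{\max}(B_{k,l}^TB_{k,l})\le\mathfrak{m}_{2k}$. - $\mathfrak{m}_{3k}:=\frac{7\rho_k}{2(7-k)}$, which bounds $\lambda_{\max}(\Theta_{k,l}+\Theta_{k,l}^T)$ for the lower triangular Toeplitz matrix $\Theta_{k,l}=(\theta_{i-j}^{(k)})_{1\le j\le i\le m}$ of every order $m$. - $c_{\mathrm{I},k}>1$ is a constant such that, for every sequence $\{v^\ell\}$, the quantities $v_{\mathrm{I}}^{(k,j)}:=\sum_{\ell=1}^{k-1}\nabla_\tau v^\ell\sum_{i=k}^{j}\theta_{j-i}^{(k)}b_{i-\ell}^{(k)}$ satisfy $|v_{\mathrm{I}}^{(k,j)}|\le\frac{c_{\mathrm{I},k}\rho_k}{8}\left(\frac k7\right)^{j-k}\sum_{\ell=1}^{k-1}|\nabla_\tau v^\ell|$ for all $j\ge k$. - $c_\Omega$ depends only on $\Omega$ and satisfies $\|v\|_{L^\infty}\le c_\Omega(\|v\|+\|\Delta v\|)$ for periodic $v$; $c_1:=c_\Omega\sqrt{8c_0+2(2+\epsilon)^2|\Omega|}$. - $c_2$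 is a constant depending on $\Omega$ and the initial data $\Phi(t_0)$, but not on $t_n$, such that $\|\Phi^n\|_{L^\infty}\le c_2$ for $1\le n\le N$. - $c_3:=c_2^2+c_1c_2+c_1^2+\epsilon$ and $c_4:=250\,\mathfrak{m}_{2k}^2/\mathfrak{m}_{1k}^5+2c_3^2\,\mathfrak{m}_{2k}\mathfrak{m}_{3k}/\mathfrak{m}_{1k}^2$. *)

theory Defs
  imports
    "HOL-Analysis.Analysis"
    "HOL-Computational_Algebra.Polynomial"
    "Jordan_Normal_Form.Char_Poly"
begin

section \<open>Periodic functions on a planar cell\<close>

text \<open>
  The cell is the half-open parallelogram spanned by two linearly independent periods
  \<open>p\<close>, \<open>q\<close>. Periodic functions are functions on the whole plane, so that derivatives
  on the boundary of the cell need no separate treatment.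
\<close>

definition cell :: "real^2 \<Rightarrow> real^2 \<Rightarrow> (real^2) set" where
  "cell p q = {s *\<^sub>R p + t *\<^sub>R q | s t. s \<in> {0..<1} \<and> t \<in> {0..<1}}"

definition cell_area :: "real^2 \<Rightarrow> real^2 \<Rightarrow> real" where
  "cell_area p q = measure lborel (cell p q)"

definition periodic :: "real^2 \<Rightarrow> real^2 \<Rightarrow> (real^2 \<Rightarrow> real) \<Rightarrow> bool" where
  "periodic p q f \<longleftrightarrow> (\<forall>x. f (x + p) = f x \<and> f (x + q) = f x)"

definition partial_deriv :: "2 \<Rightarrow> (real^2 \<Rightarrow> real) \<Rightarrow> real^2 \<Rightarrow> real" where
  "partial_deriv i f x = deriv (\<lambda>h. f (x + h *\<^sub>R axis i 1)) 0"

definition laplacian :: "(real^2 \<Rightarrow> real) \<Rightarrow> real^2 \<Rightarrow> real" where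
  "laplacian f x = (\<Sum>i\<in>UNIV. partial_deriv i (partial_deriv i f) x)"

primrec C_space :: "nat \<Rightarrow> (real^2 \<Rightarrow> real) \<Rightarrow> bool" where
  "C_space 0 f \<longleftrightarrow> continuous_on UNIV f"
| "C_space (Suc m) f \<longleftrightarrow>
     f differentiable_on UNIV \<and> (\<forall>i. C_space m (partial_deriv i f))"

definition ip :: "real^2 \<Rightarrow> real^2 \<Rightarrow> (real^2 \<Rightarrow> real) \<Rightarrow> (real^2 \<Rightarrow> real) \<Rightarrow> real" where
  "ip p q f g = (LINT x:cell p q|lborel. f x * g x)"

definition L2norm :: "real^2 \<Rightarrow> real^2 \<Rightarrow> (real^2 \<Rightarrow> real) \<Rightarrow> real" where
  "L2norm p q f = sqrt (ip p q f f)"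

definition Linfnorm :: "real^2 \<Rightarrow> real^2 \<Rightarrow> (real^2 \<Rightarrow> real) \<Rightarrow> real" where
  "Linfnorm p q f = (SUP x\<in>cell p q. \<bar>f x\<bar>)"

text \<open>The value is meaningful for \<open>v\<close> periodic, twice continuously differentiable and of mean zero.\<close>

definition inv_neg_laplacian ::
    "real^2 \<Rightarrow> real^2 \<Rightarrow> (real^2 \<Rightarrow> real) \<Rightarrow> real^2 \<Rightarrow> real" where
  "inv_neg_laplacian p q v =
     (THE w. periodic p q w \<and> C_space 2 w \<and> ip p q w (\<lambda>_. 1) = 0 \<and>
             (\<forall>x. - laplacian w x = v x))"

definition ip_neg1 :: "real^2 \<Rightarrow> real^2 \<Rightarrow> (real^2 \<Rightarrow> real) \<Rightarrow> (real^2 \<Rightarrow> real) \<Rightarrow> real" where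
  "ip_neg1 p q v w = ip p q (inv_neg_laplacian p q v) w"

definition norm_neg1 :: "real^2 \<Rightarrow> real^2 \<Rightarrow> (real^2 \<Rightarrow> real) \<Rightarrow> real" where
  "norm_neg1 p q v = sqrt (ip_neg1 p q v v)"


section \<open>Regularity in time\<close>

text \<open>One-sided at the end points of \<open>[0,T]\<close>.\<close>

definition time_deriv :: "real \<Rightarrow> (real \<Rightarrow> real^2 \<Rightarrow> real) \<Rightarrow> real \<Rightarrow> real^2 \<Rightarrow> real" where
  "time_deriv T u t x = vector_derivative (\<lambda>s. u s x) (at t within {0..T})"

text \<open>
  For functions that are periodic in space, this is \<open>C\<^sup>m\<close> regularity of the curve
  \<open>t \<mapsto> u t\<close> on \<open>[0,T]\<close> with values in the continuous periodic functions (maximum norm).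
\<close>

primrec C_time :: "nat \<Rightarrow> real \<Rightarrow> (real \<Rightarrow> real^2 \<Rightarrow> real) \<Rightarrow> bool" where
  "C_time 0 T u \<longleftrightarrow> continuous_on ({0..T} \<times> UNIV) (\<lambda>(t, x). u t x)"
| "C_time (Suc m) T u \<longleftrightarrow>
     continuous_on ({0..T} \<times> UNIV) (\<lambda>(t, x). u t x) \<and>
     (\<forall>x. (\<lambda>t. u t x) differentiable_on {0..T}) \<and>
     C_time m T (time_deriv T u)"


section \<open>The phase field crystal problem\<close>

definition one_plus_laplacian :: "(real^2 \<Rightarrow> real) \<Rightarrow> real^2 \<Rightarrow> real" where
  "one_plus_laplacian u x = u x + laplacian u x"

definition chem_pot :: "real \<Rightarrow> (real^2 \<Rightarrow> real) \<Rightarrow> real^2 \<Rightarrow> real" where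
  "chem_pot \<epsilon> u x =
     one_plus_laplacian (one_plus_laplacian u) x + (u x)^3 - \<epsilon> * u x"

text \<open>
  Classical solutions. Evaluating the equation takes six derivatives in space; neither these
  nor the equation itself are required at the initial time.
\<close>

definition pfc_solution ::
    "real^2 \<Rightarrow> real^2 \<Rightarrow> real \<Rightarrow> real \<Rightarrow> (real \<Rightarrow> real^2 \<Rightarrow> real) \<Rightarrow> bool" where
  "pfc_solution p q \<epsilon> T \<Phi> \<longleftrightarrow>
     (\<forall>t\<in>{0..T}. periodic p q (\<Phi> t)) \<and>
     (\<forall>t\<in>{0<..T}. C_space 6 (\<Phi> t) \<and>
        (\<forall>x. time_deriv T \<Phi> t x = laplacian (chem_pot \<epsilon> (\<Phi> t)) x))"

definition pfc_energy :: "real^2 \<Rightarrow> real^2 \<Rightarrow> real \<Rightarrow> (real^2 \<Rightarrow> real) \<Rightarrow> real" where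
  "pfc_energy p q \<epsilon> u =
     1/2 * (L2norm p q (one_plus_laplacian u))\<^sup>2
     + 1/4 * (L2norm p q (\<lambda>x. (u x)\<^sup>2 - \<epsilon>))\<^sup>2
     - 1/4 * (L2norm p q (\<lambda>_. \<epsilon>))\<^sup>2"


section \<open>BDF and DOC kernels\<close>

definition bdf_poly :: "nat \<Rightarrow> real poly" where
  "bdf_poly k = (\<Sum>l=1..k. Polynomial.smult (1 / real l) ([:1, -1:] ^ (l - 1)))"

text \<open>As \<open>bdf_poly k\<close> has degree below \<open>k\<close>, the kernels vanish for \<open>j \<ge> k\<close>.\<close>

definition bdf_b :: "nat \<Rightarrow> nat \<Rightarrow> real" where
  "bdf_b k j = Polynomial.coeff (bdf_poly k) j"

lemma bdf_b_3: "map (bdf_b 3) [0..<4] = [11/6, -7/6, 1/3, 0]"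
  by (simp add: bdf_b_def bdf_poly_def numeral_eq_Suc)

lemma bdf_b_4: "map (bdf_b 4) [0..<5] = [25/12, -23/12, 13/12, -1/4, 0]"
  by (simp add: bdf_b_def bdf_poly_def numeral_eq_Suc)

lemma bdf_b_5: "map (bdf_b 5) [0..<6] = [137/60, -163/60, 137/60, -21/20, 1/5, 0]"
  by (simp add: bdf_b_def bdf_poly_def numeral_eq_Suc)

definition bdiff :: "(nat \<Rightarrow> real) \<Rightarrow> nat \<Rightarrow> real" where
  "bdiff v n = v n - v (n - 1)"

definition bdf_D :: "nat \<Rightarrow> real \<Rightarrow> (nat \<Rightarrow> real) \<Rightarrow> nat \<Rightarrow> real" where
  "bdf_D k \<tau> v n = 1 / \<tau> * (\<Sum>j=1..n. bdf_b k (n - j) * bdiff v j)"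

text \<open>
  The recursion depends on \<open>n\<close> and \<open>j\<close> only through \<open>m = n - j\<close>; the summation index is
  \<open>i = n - l\<close>.
\<close>

fun doc :: "nat \<Rightarrow> nat \<Rightarrow> real" where
  "doc k m = (if m = 0 then 1 / bdf_b k 0
              else - 1 / bdf_b k 0 * (\<Sum>i<m. doc k i * bdf_b k (m - i)))"

declare doc.simps [simp del]

definition v_init :: "nat \<Rightarrow> (nat \<Rightarrow> real) \<Rightarrow> nat \<Rightarrow> real" where
  "v_init k v j =
     (\<Sum>l=1..k-1. bdiff v l * (\<Sum>i=k..j. doc k (j - i) * bdf_b k (i - l)))"

definition bdf_matrix :: "nat \<Rightarrow> nat \<Rightarrow> real mat" where
  "bdf_matrix k m = mat m m (\<lambda>(i, j). if j \<le> i then bdf_b k (i - j) else 0)"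

definition lambda_max :: "real mat \<Rightarrow> real" where
  "lambda_max A = Max {e. eigenvalue A e}"


section \<open>The discrete energy\<close>

definition sigma_L :: "nat \<Rightarrow> real" where
  "sigma_L k = (if k = 3 then 95/48 else if k = 4 then 4919/3072 else 646631/1920000)"

text \<open>
  \<open>G_neg1\<close> takes the sequence \<open>v\<close> of differences and evaluates, for \<open>k = 3, 4, 5\<close>, the quadratic
  form with every square replaced by the squared \<open>H\<^sup>-\<^sup>1\<close> norm.
\<close>

definition G_neg1 ::
    "real^2 \<Rightarrow> real^2 \<Rightarrow> nat \<Rightarrow> (nat \<Rightarrow> real^2 \<Rightarrow> real) \<Rightarrow> nat \<Rightarrow> real" where
  "G_neg1 p q k v n =
    (if k = 3 then
       1/6 * (norm_neg1 p q (v n))\<^sup>2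
       + 1/6 * (norm_neg1 p q (\<lambda>x. 7/4 * v n x - v (n-1) x))\<^sup>2
     else if k = 4 then
       13627/43008 * (norm_neg1 p q (v n))\<^sup>2
       + 7/24 * (norm_neg1 p q (\<lambda>x. 65/56 * v n x - v (n-1) x))\<^sup>2
       + 1/8 * (norm_neg1 p q (\<lambda>x. 3/2 * (v n x - v (n-1) x) + v (n-2) x))\<^sup>2
     else
       1198850903/1678080000 * (norm_neg1 p q (v n))\<^sup>2
       + 437/900 * (norm_neg1 p q (\<lambda>x. 4931/6992 * v n x - v (n-1) x))\<^sup>2
       + 9/40 * (norm_neg1 p q (\<lambda>x. 23/18 * (v n x - v (n-1) x) + v (n-2) x))\<^sup>2
       + 1/10 * (norm_neg1 p q (\<lambda>x. 2 * (v n x - v (n-1) x) + 2 * v (n-2) x - v (n-3) x))\<^sup>2)"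

definition discrete_energy ::
    "real^2 \<Rightarrow> real^2 \<Rightarrow> real \<Rightarrow> nat \<Rightarrow> real \<Rightarrow> (nat \<Rightarrow> real^2 \<Rightarrow> real) \<Rightarrow> nat \<Rightarrow> real" where
  "discrete_energy p q \<epsilon> k \<tau> \<phi> n =
     pfc_energy p q \<epsilon> (\<phi> n)
     + 1 / \<tau> * G_neg1 p q k (\<lambda>m x. bdiff (\<lambda>i. \<phi> i x) m) n"


section \<open>The scheme\<close>

text \<open>
  The starting values only have to be regular enough for the discrete energy to be defined;
  the computed values need the six derivatives occurring in the scheme.
\<close>

definition bdf_scheme ::
    "real^2 \<Rightarrow> real^2 \<Rightarrow> real \<Rightarrow> nat \<Rightarrow> real \<Rightarrow> nat \<Rightarrow> (nat \<Rightarrow> real^2 \<Rightarrow> real) \<Rightarrow> bool" where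
  "bdf_scheme p q \<epsilon> k \<tau> N \<phi> \<longleftrightarrow>
     (\<forall>l<k. periodic p q (\<phi> l) \<and> C_space 2 (\<phi> l)) \<and>
     (\<forall>n\<in>{k..N}. periodic p q (\<phi> n) \<and> C_space 6 (\<phi> n) \<and>
        (\<forall>x. bdf_D k \<tau> (\<lambda>m. \<phi> m x) n = laplacian (chem_pot \<epsilon> (\<phi> n)) x))"


section \<open>Constants\<close>

definition rho_bdf :: "nat \<Rightarrow> real" where
  "rho_bdf k = (if k = 3 then 10/3 else if k = 4 then 6 else 96/5)"

definition m1_bdf :: "nat \<Rightarrow> real" where
  "m1_bdf k = (if k = 3 then 95/48 else if k = 4 then 1.628 else 0.3711)"

definition m3_bdf :: "nat \<Rightarrow> real" where
  "m3_bdf k = 7 * rho_bdf k / (2 * (7 - real k))"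

definition const_m2 :: "nat \<Rightarrow> real \<Rightarrow> bool" where
  "const_m2 k m2 \<longleftrightarrow>
     0 < m2 \<and> (\<forall>m\<ge>1. lambda_max (transpose_mat (bdf_matrix k m) * bdf_matrix k m) \<le> m2)"

definition const_cI :: "nat \<Rightarrow> real \<Rightarrow> bool" where
  "const_cI k cI \<longleftrightarrow>
     1 < cI \<and>
     (\<forall>v. \<forall>j\<ge>k. \<bar>v_init k v j\<bar>
        \<le> cI * rho_bdf k / 8 * (real k / 7) ^ (j - k) * (\<Sum>l=1..k-1. \<bar>bdiff v l\<bar>))"

definition const_cOmega :: "real^2 \<Rightarrow> real^2 \<Rightarrow> real \<Rightarrow> bool" where
  "const_cOmega p q c\<Omega> \<longleftrightarrow>
     (\<forall>v. periodic p q v \<and> C_space 2 v \<longrightarrow>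
        Linfnorm p q v \<le> c\<Omega> * (L2norm p q v + L2norm p q (laplacian v)))"

definition const_c1 :: "real^2 \<Rightarrow> real^2 \<Rightarrow> real \<Rightarrow> real \<Rightarrow> real \<Rightarrow> real" where
  "const_c1 p q \<epsilon> c\<Omega> c0 = c\<Omega> * sqrt (8 * c0 + 2 * (2 + \<epsilon>)\<^sup>2 * cell_area p q)"

definition const_c3 :: "real \<Rightarrow> real \<Rightarrow> real \<Rightarrow> real" where
  "const_c3 \<epsilon> c1 c2 = c2\<^sup>2 + c1 * c2 + c1\<^sup>2 + \<epsilon>"

definition const_c4 :: "nat \<Rightarrow> real \<Rightarrow> real \<Rightarrow> real" where
  "const_c4 k m2 c3 =
     250 * m2\<^sup>2 / (m1_bdf k) ^ 5 + 2 * c3\<^sup>2 * m2 * m3_bdf k / (m1_bdf k)\<^sup>2"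

end

theory Submission
  imports Defs
begin

text \<open>
  Write \<open>e\<^sup>n = \<Phi>\<^sup>n - \<phi>\<^sup>n\<close>, \<open>\<nabla>e\<^sup>n = e\<^sup>n - e\<^sup>n\<^sup>-\<^sup>1\<close> for the backward difference, and \<open>L = 1 + \<Delta>\<close>.
  The proof combines a bound for the numerical solution, which makes the nonlinearity Lipschitz,
  with an energy argument for the error equation in which the BDF formula has been inverted.

  For the bound, testing the scheme with \<open>(-\<Delta>)\<^sup>-\<^sup>1\<nabla>\<phi>\<^sup>n\<close> turns its right-hand side into
  \<open>-\<langle>\<mu>\<^sup>n, \<nabla>\<phi>\<^sup>n\<rangle>\<close>, and \<open>\<langle>\<mu>\<^sup>n, \<nabla>\<phi>\<^sup>n\<rangle>\<close> dominates the increment of the energy plus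
  \<open>\<parallel>L\<nabla>\<phi>\<^sup>n\<parallel>\<^sup>2 / 2\<close> minus \<open>\<epsilon>/2 \<parallel>\<nabla>\<phi>\<^sup>n\<parallel>\<^sup>2\<close> (\<open>chem_pot_energy\<close>). On the left, an explicit sum of squares
  (\<open>bdf_energy_inequality\<close>) extracts the increment of \<open>G\<close> and \<open>\<sigma>/2\<close> times the squared \<open>H\<^sup>-\<^sup>1\<close> norm of \<open>\<nabla>\<phi>\<^sup>n\<close>.
  The restriction on \<open>\<tau>\<close> lets this norm, together with \<open>\<parallel>L\<nabla>\<phi>\<^sup>n\<parallel>\<^sup>2\<close>, absorb the negative term
  (\<open>stabilization\<close>). So the modified energy does not increase
  (\<open>energy_dissipation\<close>), and the embedding constant gives \<open>\<bar>\<phi>\<^sup>n\<bar> \<le> c\<^sub>1\<close> (\<open>energy_imp_bound\<close>).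

  The negative norm is defined by means of the classical solution of the Poisson equation on the
  torus, so this solution has to be shown to exist for \<open>C\<^sup>2\<close> data \<open>v\<close> of mean zero. Bessel's inequality
  for \<open>\<Delta>v\<close> makes the Fourier coefficients of \<open>v\<close> absolutely summable in two dimensions, because
  \<open>\<Sum> \<bar>\<kappa>\<bar>\<^sup>-\<^sup>4\<close> over the nonzero frequencies is finite; dividing the coefficients by \<open>\<bar>\<kappa>\<bar>\<^sup>2\<close> gives a
  series that may be differentiated twice term by term. Its negative Laplacian is the Fourier series of \<open>v\<close>, and
  this series represents \<open>v\<close> because trigonometric polynomials are dense (\<open>poisson_solvable\<close>).

  In the error equation, convolution with the DOC kernels inverts the BDF formula:
  \<open>\<nabla>e\<^sup>n = \<tau> (\<theta> * D\<^sub>ke)\<^sup>n - v_init\<close>, where \<open>v_init\<close> collects the starting errors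
  (\<open>doc_recover_difference\<close>). Taking the inner product with \<open>2e\<^sup>n\<close> and summing, four facts are used.
  The form \<open>\<Sum> f\<^sup>l (\<theta> * f)\<^sup>l\<close> is coercive, since its inverse, the BDF form, is bounded and, by telescoping the
  sum of squares above, coercive; applied to \<open>f = \<partial>\<^sub>i L e\<close> it makes the linear term dissipative.
  The convolution is bounded on square-summable sequences, so that the nonlinear term costs a multiple of
  \<open>\<parallel>e\<parallel>\<^sup>2\<close> and a multiple of \<open>\<parallel>\<Delta>e\<parallel>\<^sup>2\<close> that the dissipation controls (\<open>diffusion_estimate\<close>).
  The same bound turns a pointwise truncation error of size \<open>\<tau>\<^sup>k\<close> into a contribution \<open>t \<tau>\<^sup>k\<close>
  (\<open>truncation_term_bound\<close>). The starting errors are summed by the geometric decay in the definition of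
  \<open>c\<^sub>I\<close> (\<open>initial_term_bound\<close>). A discrete Gronwall inequality (\<open>gronwall_quadratic\<close>) concludes.

  Sequence inequalities are proved for real numbers and applied pointwise in space before
  integrating. The coercivity of the BDF form enters with the constant \<open>\<sigma>\<^sub>L\<close> of the sum of squares, and its
  boundedness with the \<open>\<ell>\<^sup>1\<close> norm of the kernels. That the resulting constant is at most \<open>c\<^sub>4\<close> is a
  numerical comparison, based on \<open>m\<^sub>2 \<ge> b\<^sub>0\<^sup>2\<close> (\<open>const_m2_lower\<close>, \<open>doc_estimates\<close>).
\<close>

section \<open>Periodic functions of class \<open>C\<^sup>m\<close>\<close>

lemma partial_deriv_eq:
  assumes "(f has_derivative f') (at x)"
  shows "partial_deriv i f x = f' (axis i 1)"
proof -
  interpret bounded_linear f' using assms by (rule has_derivative_bounded_linear)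
  have "((\<lambda>h::real. x + h *\<^sub>R axis i 1) has_derivative (\<lambda>h. h *\<^sub>R axis i 1)) (at 0)"
    by (auto intro!: derivative_eq_intros)
  from has_derivative_compose[OF this, of f f'] assms
  have "((\<lambda>h::real. f (x + h *\<^sub>R axis i 1)) has_derivative (\<lambda>h. f' (h *\<^sub>R axis i 1))) (at 0)"
    by simp
  then have "((\<lambda>h::real. f (x + h *\<^sub>R axis i 1)) has_field_derivative f' (axis i 1)) (at 0)"
    by (rule has_derivative_imp_has_field_derivative) (simp add: scaleR)
  then show ?thesis unfolding partial_deriv_def by (rule DERIV_imp_deriv)
qed

text \<open>
  Differentiability of \<open>f\<close> makes the partial derivatives, which are defined by one-dimensional limits,
  the coordinates of the total derivative; all rules of calculus below are read off from this.
\<close>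

lemma has_derivative_partial_deriv:
  assumes "f differentiable_on UNIV"
  shows "(f has_derivative (\<lambda>h. \<Sum>i\<in>UNIV. partial_deriv i f x * h $ i)) (at x)"
proof -
  from assms obtain f' where f': "(f has_derivative f') (at x)"
    by (auto simp: differentiable_on_def differentiable_def)
  interpret bounded_linear f' using f' by (rule has_derivative_bounded_linear)
  have "f' h = (\<Sum>i\<in>UNIV. partial_deriv i f x * h $ i)" for h
  proof -
    have "f' h = f' (\<Sum>i\<in>UNIV. h $ i *\<^sub>R axis i 1)"
      by (subst basis_expansion[of h, symmetric]) (simp add: scalar_mult_eq_scaleR)
    also have "\<dots> = (\<Sum>i\<in>UNIV. h $ i *\<^sub>R f' (axis i 1))"
      by (simp add: sum scaleR)
    finally show ?thesis by (simp add: partial_deriv_eq[OF f'] mult.commute)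
  qed
  then have "f' = (\<lambda>h. \<Sum>i\<in>UNIV. partial_deriv i f x * h $ i)" by auto
  then show ?thesis using f' by simp
qed

lemma partial_deriv_eqI:
  assumes "(f has_derivative (\<lambda>h. \<Sum>i\<in>UNIV. g i * h $ i)) (at x)"
  shows "partial_deriv i f x = g i"
  using partial_deriv_eq[OF assms, of i] by (simp add: axis_def if_distrib cong: if_cong)

lemma partial_deriv_const [simp]: "partial_deriv i (\<lambda>_. c) = (\<lambda>_. 0)"
  by (simp add: partial_deriv_def fun_eq_iff)

lemma
  assumes "f differentiable_on UNIV" "g differentiable_on UNIV"
  shows partial_deriv_add: "partial_deriv i (\<lambda>x. f x + g x) = (\<lambda>x. partial_deriv i f x + partial_deriv i g x)"
    and partial_deriv_mult: "partial_deriv i (\<lambda>x. f x * g x) =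
           (\<lambda>x. f x * partial_deriv i g x + partial_deriv i f x * g x)"
proof -
  note D = has_derivative_partial_deriv[OF assms(1)] has_derivative_partial_deriv[OF assms(2)]
  show "partial_deriv i (\<lambda>x. f x + g x) = (\<lambda>x. partial_deriv i f x + partial_deriv i g x)"
    by (rule ext, rule partial_deriv_eqI, rule has_derivative_eq_rhs[OF has_derivative_add[OF D]])
       (simp add: fun_eq_iff sum.distrib[symmetric] algebra_simps)
  show "partial_deriv i (\<lambda>x. f x * g x) =
           (\<lambda>x. f x * partial_deriv i g x + partial_deriv i f x * g x)"
    by (rule ext, rule partial_deriv_eqI, rule has_derivative_eq_rhs[OF has_derivative_mult[OF D]])
       (simp add: fun_eq_iff sum.distrib[symmetric] sum_distrib_left sum_distrib_right algebra_simps)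
qed

lemma C_space_SucD: "C_space (Suc m) f \<Longrightarrow> C_space m f"
  by (induction m arbitrary: f) (auto intro: differentiable_imp_continuous_on)

lemma C_space_mono: "C_space m f \<Longrightarrow> l \<le> m \<Longrightarrow> C_space l f"
  by (induction m) (auto simp: le_Suc_eq simp del: C_space.simps dest: C_space_SucD)

lemma C_space_continuous: "C_space m f \<Longrightarrow> continuous_on UNIV f"
  using C_space_mono[of m f 0] by simp

lemma C_space_const: "C_space m (\<lambda>_. c)"
  by (induction m arbitrary: c) (auto simp: differentiable_on_def)

lemma C_space_add: "C_space m f \<Longrightarrow> C_space m g \<Longrightarrow> C_space m (\<lambda>x. f x + g x)"
  by (induction m arbitrary: f g) (auto simp: partial_deriv_add intro: continuous_intros)

lemma C_space_mult: "C_space m f \<Longrightarrow> C_space m g \<Longrightarrow> C_space m (\<lambda>x. f x * g x)"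
proof (induction m arbitrary: f g)
  case (Suc m)
  then show ?case
    using C_space_SucD[OF Suc.prems(1)] C_space_SucD[OF Suc.prems(2)]
    by (auto simp: partial_deriv_mult intro!: C_space_add Suc.IH)
qed (auto intro: continuous_intros)

lemma C_space_cmult: "C_space m f \<Longrightarrow> C_space m (\<lambda>x. c * f x)"
  by (intro C_space_mult C_space_const)

lemma C_space_diff: "C_space m f \<Longrightarrow> C_space m g \<Longrightarrow> C_space m (\<lambda>x. f x - g x)"
  using C_space_add[of m f "\<lambda>x. -1 * g x"] C_space_cmult[of m g "-1"] by simp

lemma C_space_minus: "C_space m f \<Longrightarrow> C_space m (\<lambda>x. - f x)"
  using C_space_cmult[of m f "-1"] by simp

lemma C_space_power: "C_space m f \<Longrightarrow> C_space m (\<lambda>x. f x ^ l)"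
  by (induction l) (auto intro: C_space_mult C_space_const)

lemma C_space_sum: "(\<And>j. j \<in> A \<Longrightarrow> C_space m (f j)) \<Longrightarrow> C_space m (\<lambda>x. \<Sum>j\<in>A. f j x)"
  by (induction A rule: infinite_finite_induct) (auto intro: C_space_add C_space_const)

lemmas C_space_intros =
  C_space_const C_space_add C_space_diff C_space_minus C_space_mult C_space_power C_space_sum

lemma partial_deriv_cmult:
  "f differentiable_on UNIV \<Longrightarrow> partial_deriv i (\<lambda>x. c * f x) = (\<lambda>x. c * partial_deriv i f x)"
  by (subst partial_deriv_mult) (auto simp: differentiable_on_def)

lemma laplacian_const [simp]: "laplacian (\<lambda>_. c) = (\<lambda>_. 0)"
  by (simp add: laplacian_def fun_eq_iff)

lemma laplacian_add:
  "C_space 2 f \<Longrightarrow> C_space 2 g \<Longrightarrow> laplacian (\<lambda>x. f x + g x) = (\<lambda>x. laplacian f x + laplacian g x)"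
  by (simp add: laplacian_def[abs_def] numeral_2_eq_2 partial_deriv_add sum.distrib)

lemma laplacian_cmult:
  "C_space 2 f \<Longrightarrow> laplacian (\<lambda>x. c * f x) = (\<lambda>x. c * laplacian f x)"
  by (simp add: laplacian_def[abs_def] numeral_2_eq_2 partial_deriv_cmult sum_distrib_left)

lemma laplacian_diff:
  assumes "C_space 2 f" "C_space 2 g"
  shows "laplacian (\<lambda>x. f x - g x) = (\<lambda>x. laplacian f x - laplacian g x)"
  using laplacian_add[OF assms(1) C_space_cmult[OF assms(2)], of "-1"] laplacian_cmult[OF assms(2), of "-1"]
  by simp

text \<open>
  The functions that may be integrated and differentiated over the cell: every integral below is taken
  of such a function, so that integrability and the absence of boundary terms come for free.
\<close>

definition Cper :: "real^2 \<Rightarrow> real^2 \<Rightarrow> nat \<Rightarrow> (real^2 \<Rightarrow> real) \<Rightarrow> bool" where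
  "Cper p q m f \<longleftrightarrow> C_space m f \<and> periodic p q f"

lemma periodic_partial_deriv: "periodic p q f \<Longrightarrow> periodic p q (partial_deriv i f)"
proof -
  assume *: "periodic p q f"
  have "f (x + p + h) = f (x + h)" "f (x + q + h) = f (x + h)" for x h :: "real^2"
    using *[unfolded periodic_def, rule_format, of "x + h"] by (simp_all add: algebra_simps)
  then show ?thesis by (simp add: periodic_def partial_deriv_def)
qed

lemma Cper_const: "Cper p q m (\<lambda>_. c)"
  by (simp add: Cper_def C_space_const periodic_def)

lemma Cper_add: "Cper p q m f \<Longrightarrow> Cper p q m g \<Longrightarrow> Cper p q m (\<lambda>x. f x + g x)"
  by (simp add: Cper_def C_space_add periodic_def)

lemma Cper_diff: "Cper p q m f \<Longrightarrow> Cper p q m g \<Longrightarrow> Cper p q m (\<lambda>x. f x - g x)"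
  by (simp add: Cper_def C_space_diff periodic_def)

lemma Cper_minus: "Cper p q m f \<Longrightarrow> Cper p q m (\<lambda>x. - f x)"
  by (simp add: Cper_def C_space_minus periodic_def)

lemma Cper_mult: "Cper p q m f \<Longrightarrow> Cper p q m g \<Longrightarrow> Cper p q m (\<lambda>x. f x * g x)"
  by (simp add: Cper_def C_space_mult periodic_def)

lemma Cper_power: "Cper p q m f \<Longrightarrow> Cper p q m (\<lambda>x. f x ^ l)"
  by (simp add: Cper_def C_space_power periodic_def)

lemma Cper_sum: "(\<And>j. j \<in> A \<Longrightarrow> Cper p q m (f j)) \<Longrightarrow> Cper p q m (\<lambda>x. \<Sum>j\<in>A. f j x)"
  by (simp add: Cper_def C_space_sum periodic_def)

lemma Cper_partial_deriv: "Cper p q (Suc m) f \<Longrightarrow> Cper p q m (partial_deriv i f)"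
  by (simp add: Cper_def periodic_partial_deriv)

lemma Cper_laplacian: "Cper p q (Suc (Suc m)) f \<Longrightarrow> Cper p q m (laplacian f)"
  unfolding laplacian_def[abs_def] by (intro Cper_sum Cper_partial_deriv)

lemma Cper_mono: "Cper p q m f \<Longrightarrow> l \<le> m \<Longrightarrow> Cper p q l f"
  using C_space_mono by (auto simp: Cper_def)

lemma Cper_cmult: "Cper p q m f \<Longrightarrow> Cper p q m (\<lambda>x. c * f x)"
  by (intro Cper_mult Cper_const)

lemma Cper_continuous: "Cper p q m f \<Longrightarrow> continuous_on A f"
  unfolding Cper_def using C_space_continuous continuous_on_subset by blast

lemma Cper_differentiable: "Cper p q (Suc m) f \<Longrightarrow> f differentiable_on UNIV"
  by (simp add: Cper_def)

section \<open>Integration over the period cell\<close>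

text \<open>
  \<open>P\<close>, \<open>Q\<close> is the basis dual to the periods: \<open>P \<bullet> x\<close> and \<open>Q \<bullet> x\<close> are the coordinates of \<open>x\<close> with respect
  to \<open>p\<close>, \<open>q\<close>. In these terms the cell is defined by inequalities, and its frequencies are
  the integer combinations of \<open>2\<pi>P\<close> and \<open>2\<pi>Q\<close>.
\<close>

locale lattice =
  fixes p q P Q :: "real^2"
  assumes Pp: "P \<bullet> p = 1" and Pq: "P \<bullet> q = 0" and Qp: "Q \<bullet> p = 0" and Qq: "Q \<bullet> q = 1"
    and coords: "(P \<bullet> x) *\<^sub>R p + (Q \<bullet> x) *\<^sub>R q = x"

text \<open>
  Cramer's rule: independence of the periods says that their determinant does not vanish.
\<close>

lemma lattice_exists:
  fixes p q :: "real^2"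
  assumes "p \<noteq> q" "independent {p, q}"
  obtains P Q where "lattice p q P Q"
proof -
  define D where "D = p $ 1 * q $ 2 - p $ 2 * q $ 1"
  have D: "D \<noteq> 0"
  proof
    assume D0: "D = 0"
    have ns: "p \<notin> span {q}" and q0: "q \<noteq> 0"
      using assms by (auto simp: independent_insert dependent_zero)
    define c where "c = (if q $ 1 \<noteq> 0 then p $ 1 / q $ 1 else p $ 2 / q $ 2)"
    have "q $ 1 \<noteq> 0 \<or> q $ 2 \<noteq> 0"
    proof (rule ccontr)
      assume *: "\<not> ?thesis"
      have "q $ i = 0" for i using * exhaust_2[of i] by auto
      with q0 show False by (simp add: Finite_Cartesian_Product.vec_eq_iff)
    qed
    then have "p $ 1 = c * q $ 1" "p $ 2 = c * q $ 2"
      using D0 by (auto simp: c_def D_def field_simps)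
    then have "p = c *\<^sub>R q" by (simp add: Finite_Cartesian_Product.vec_eq_iff forall_2)
    then have "p \<in> span {q}" unfolding span_singleton by (rule range_eqI)
    with ns show False by simp
  qed
  define P :: "real^2" where "P = vector [q $ 2 / D, - q $ 1 / D]"
  define Q :: "real^2" where "Q = vector [- p $ 2 / D, p $ 1 / D]"
  have PX: "P \<bullet> x = (q $ 2 * x $ 1 - q $ 1 * x $ 2) / D" and QX: "Q \<bullet> x = (p $ 1 * x $ 2 - p $ 2 * x $ 1) / D" for x
    by (simp_all add: P_def Q_def inner_vec_def sum_2 diff_divide_distrib)
  have "lattice p q P Q"
  proof
    show "P \<bullet> p = 1" "P \<bullet> q = 0" "Q \<bullet> p = 0" "Q \<bullet> q = 1"
      using D unfolding PX QX by (simp_all add: D_def mult.commute)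
    fix x :: "real^2"
    have "((P \<bullet> x) *\<^sub>R p + (Q \<bullet> x) *\<^sub>R q) $ j = x $ j" for j
    proof -
      have "(q $ 2 * x $ 1 - q $ 1 * x $ 2) * p $ j + (p $ 1 * x $ 2 - p $ 2 * x $ 1) * q $ j = D * x $ j"
        using exhaust_2[of j] by (auto simp: D_def algebra_simps)
      moreover have "((P \<bullet> x) *\<^sub>R p + (Q \<bullet> x) *\<^sub>R q) $ j =
          ((q $ 2 * x $ 1 - q $ 1 * x $ 2) * p $ j + (p $ 1 * x $ 2 - p $ 2 * x $ 1) * q $ j) / D"
        by (simp add: PX QX add_divide_distrib)
      ultimately show ?thesis using D by simp
    qed
    then show "(P \<bullet> x) *\<^sub>R p + (Q \<bullet> x) *\<^sub>R q = x" by (simp add: Finite_Cartesian_Product.vec_eq_iff)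
  qed
  then show ?thesis by (rule that)
qed

definition cell_integral :: "real^2 \<Rightarrow> real^2 \<Rightarrow> (real^2 \<Rightarrow> real) \<Rightarrow> real" where
  "cell_integral p q f = (LINT x:cell p q|lborel. f x)"

lemma ip_eq_cell_integral: "ip p q f g = cell_integral p q (\<lambda>x. f x * g x)"
  by (simp add: ip_def cell_integral_def)

lemma lborel_integral_shift:
  fixes g :: "real^2 \<Rightarrow> real"
  assumes [measurable]: "g \<in> borel_measurable borel"
  shows "(\<integral>x. g (c + x) \<partial>lborel) = (\<integral>x. g x \<partial>lborel)"
proof -
  have "(\<integral>x. g x \<partial>lborel) = (\<integral>x. g x \<partial>distr lborel borel ((+) c))"
    by (simp add: lborel_distr_plus)
  also have "\<dots> = (\<integral>x. g (c + x) \<partial>lborel)"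
    by (subst integral_distr) auto
  finally show ?thesis by simp
qed

context lattice
begin

lemma lattice_flip: "lattice q p Q P"
  using Pp Pq Qp Qq coords by unfold_locales (auto simp: add.commute)

lemma cell_eq: "cell p q = {x. 0 \<le> P \<bullet> x \<and> P \<bullet> x < 1 \<and> 0 \<le> Q \<bullet> x \<and> Q \<bullet> x < 1}" (is "_ = ?R")
proof (intro equalityI subsetI)
  fix x assume "x \<in> ?R"
  then show "x \<in> cell p q"
    unfolding cell_def mem_Collect_eq
    by (intro exI[of _ "P \<bullet> x"] exI[of _ "Q \<bullet> x"]) (simp add: coords)
qed (auto simp: cell_def inner_add_right Pp Pq Qp Qq)

lemma cell_borel [measurable]: "cell p q \<in> sets borel"
  unfolding cell_eq by measurable

lemma cell_subset_cball: "cell p q \<subseteq> cball 0 (norm p + norm q)"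
proof
  fix x assume "x \<in> cell p q"
  then have b: "\<bar>P \<bullet> x\<bar> \<le> 1" "\<bar>Q \<bullet> x\<bar> \<le> 1" by (auto simp: cell_eq)
  have "norm ((P \<bullet> x) *\<^sub>R p + (Q \<bullet> x) *\<^sub>R q) \<le> \<bar>P \<bullet> x\<bar> * norm p + \<bar>Q \<bullet> x\<bar> * norm q"
    by (rule norm_triangle_le) simp
  also have "\<dots> \<le> 1 * norm p + 1 * norm q"
    using b by (intro add_mono mult_right_mono) auto
  finally show "x \<in> cball 0 (norm p + norm q)" by (simp add: coords)
qed

lemma periodic_int:
  assumes "periodic p q f"
  shows "f (x + of_int m *\<^sub>R p + of_int n *\<^sub>R q) = f x"
proof -
  have up: "f (x + real k *\<^sub>R a) = f x" if "\<forall>x. f (x + a) = f x" for x k and a :: "real^2"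
  proof (induction k)
    case (Suc k)
    have "f (x + real (Suc k) *\<^sub>R a) = f ((x + real k *\<^sub>R a) + a)" by (simp add: algebra_simps)
    with Suc that show ?case by simp
  qed simp
  have int: "f (x + of_int m *\<^sub>R a) = f x" if "\<forall>x. f (x + a) = f x" for x m and a :: "real^2"
  proof (cases "m \<ge> 0")
    case True then show ?thesis using up[OF that, of x "nat m"] by simp
  next
    case False
    then show ?thesis using up[OF that, of "x + of_int m *\<^sub>R a" "nat (-m)"] by simp
  qed
  show ?thesis using assms by (simp add: int periodic_def)
qed

lemma periodic_rep:
  obtains y where "y \<in> cell p q" "\<And>f. periodic p q f \<Longrightarrow> f y = f x"
proof -
  define y where "y = x + of_int (-\<lfloor>P \<bullet> x\<rfloor>) *\<^sub>R p + of_int (-\<lfloor>Q \<bullet> x\<rfloor>) *\<^sub>R q"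
  have "y \<in> cell p q"
    by (simp add: y_def cell_eq inner_diff_right inner_add_right Pp Pq Qp Qq) linarith
  then show ?thesis using that periodic_int unfolding y_def by blast
qed

lemma Cper_bounded:
  assumes "Cper p q m f"
  obtains B where "\<And>x. \<bar>f x\<bar> \<le> B"
proof -
  have "bounded (f ` cball 0 (norm p + norm q))"
    by (intro compact_imp_bounded compact_continuous_image Cper_continuous[OF assms] compact_cball)
  then obtain B where "\<forall>y\<in>f ` cball 0 (norm p + norm q). norm y \<le> B"
    unfolding bounded_iff by blast
  then have B: "\<bar>f x\<bar> \<le> B" if "x \<in> cball 0 (norm p + norm q)" for x
    using bspec[OF \<open>\<forall>y\<in>f ` cball 0 (norm p + norm q). norm y \<le> B\<close> imageI[OF that]] by simp
  have "\<bar>f x\<bar> \<le> B" for x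
  proof -
    obtain y where "y \<in> cell p q" "f y = f x"
      using periodic_rep[of x] assms unfolding Cper_def by metis
    then show ?thesis using B[of y] cell_subset_cball by auto
  qed
  then show ?thesis by (rule that)
qed

lemma Linfnorm_bound:
  assumes "Cper p q m f"
  shows "\<bar>f x\<bar> \<le> Linfnorm p q f"
proof -
  obtain B where B: "\<And>x. \<bar>f x\<bar> \<le> B" using Cper_bounded[OF assms] by blast
  obtain y where y: "y \<in> cell p q" "f y = f x"
    using periodic_rep[of x] assms unfolding Cper_def by metis
  have "\<bar>f y\<bar> \<le> (SUP x\<in>cell p q. \<bar>f x\<bar>)"
    using y B by (intro cSUP_upper) (auto simp: bdd_above_def)
  with y show ?thesis by (simp add: Linfnorm_def)
qed

lemma Cper_integrable: "Cper p q m f \<Longrightarrow> set_integrable lborel (cell p q) f"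
  by (rule set_integrable_subset[of _ "cball 0 (norm p + norm q)"])
     (use cell_subset_cball borel_integrable_compact[of "cball 0 (norm p + norm q)" f] Cper_continuous in
      \<open>auto simp: set_integrable_def\<close>)

abbreviation cint :: "(real^2 \<Rightarrow> real) \<Rightarrow> real" where
  "cint \<equiv> cell_integral p q"

lemma cint_add: "Cper p q m f \<Longrightarrow> Cper p q n g \<Longrightarrow> cint (\<lambda>x. f x + g x) = cint f + cint g"
  unfolding cell_integral_def by (intro set_integral_add Cper_integrable)

lemma cint_diff: "Cper p q m f \<Longrightarrow> Cper p q n g \<Longrightarrow> cint (\<lambda>x. f x - g x) = cint f - cint g"
  unfolding cell_integral_def by (intro set_integral_diff Cper_integrable)

lemma cint_cmult: "cint (\<lambda>x. c * f x) = c * cint f"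
  unfolding cell_integral_def by simp

lemma cint_minus: "cint (\<lambda>x. - f x) = - cint f"
  using cint_cmult[of "-1" f] by simp

lemma cint_sum: "(\<And>j. j \<in> A \<Longrightarrow> Cper p q m (f j)) \<Longrightarrow> cint (\<lambda>x. \<Sum>j\<in>A. f j x) = (\<Sum>j\<in>A. cint (f j))"
proof (induction A rule: infinite_finite_induct)
  case (insert a A)
  then show ?case using cint_add[of m "f a" m "\<lambda>x. \<Sum>j\<in>A. f j x"] by (simp add: Cper_sum)
qed (simp_all add: cell_integral_def)

lemma cint_mono:
  assumes "Cper p q m f" "Cper p q n g" "\<And>x. f x \<le> g x"
  shows "cint f \<le> cint g"
  unfolding cell_integral_def by (intro set_integral_mono Cper_integrable[OF assms(1)] Cper_integrable[OF assms(2)] assms(3))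

lemma cint_nonneg: "(\<And>x. 0 \<le> f x) \<Longrightarrow> 0 \<le> cint f"
  unfolding cell_integral_def set_lebesgue_integral_def by (intro integral_nonneg_AE) auto

lemmas cint_add0 = cint_add[where m=0 and n=0]
  and cint_diff0 = cint_diff[where m=0 and n=0]
  and cint_sum0 = cint_sum[where m=0]
  and cint_mono0 = cint_mono[where m=0 and n=0]

text \<open>
  Translating the cell by \<open>s p\<close> removes the strip \<open>P \<bullet> x < s\<close> and adds its translate by \<open>p\<close>, on which a
  periodic function takes the same values.
\<close>

lemma cint_shift:
  assumes f: "Cper p q m f" and s: "0 \<le> s" "s \<le> 1"
  shows "cint (\<lambda>x. f (x + s *\<^sub>R p)) = cint f"
proof -
  define A where "A = {x \<in> cell p q. P \<bullet> x < s}"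
  define B where "B = {x \<in> cell p q. s \<le> P \<bullet> x}"
  have [measurable]: "A \<in> sets borel" "B \<in> sets borel" unfolding A_def B_def by measurable
  have [measurable]: "f \<in> borel_measurable borel"
    using Cper_continuous[OF f, of UNIV] by (rule borel_measurable_continuous_onI)
  have fp: "f (x + p) = f x" for x using f by (simp add: Cper_def periodic_def)
  \<comment> \<open>\<open>B\<close> is the part kept by the translation, and \<open>A\<close> reappears on the other side, shifted by \<open>p\<close>.\<close>
  have split: "indicator (cell p q) (x - s *\<^sub>R p) = indicator B x + (indicator A (x - p) :: real)" for x
  proof -
    have "P \<bullet> (x - s *\<^sub>R p) = P \<bullet> x - s" "Q \<bullet> (x - s *\<^sub>R p) = Q \<bullet> x"
         "P \<bullet> (x - p) = P \<bullet> x - 1" "Q \<bullet> (x - p) = Q \<bullet> x"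
      by (simp_all add: inner_diff_right Pp Qp)
    then show ?thesis using s by (auto simp: indicator_def A_def B_def cell_eq)
  qed
  have iA: "integrable lborel (\<lambda>x. indicator A x *\<^sub>R f x)" and iB: "integrable lborel (\<lambda>x. indicator B x *\<^sub>R f x)"
    using set_integrable_subset[OF Cper_integrable[OF f], of A] set_integrable_subset[OF Cper_integrable[OF f], of B]
    by (auto simp: set_integrable_def A_def B_def)
  have iA': "integrable lborel (\<lambda>x. indicator A (x - p) *\<^sub>R f x)"
  proof -
    have "integrable (distr lborel borel ((+) p)) (\<lambda>x. indicator A (x - p) *\<^sub>R f x)"
      by (subst integrable_distr_eq) (use iA fp in \<open>auto simp: add.commute\<close>)
    then show ?thesis by (simp add: lborel_distr_plus)
  qed
  have "cint (\<lambda>x. f (x + s *\<^sub>R p)) = (\<integral>x. (\<lambda>y. indicator (cell p q) (y - s *\<^sub>R p) *\<^sub>R f y) (s *\<^sub>R p + x) \<partial>lborel)"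
    by (simp add: cell_integral_def set_lebesgue_integral_def add.commute)
  also have "\<dots> = (\<integral>y. indicator (cell p q) (y - s *\<^sub>R p) *\<^sub>R f y \<partial>lborel)"
    by (rule lborel_integral_shift) measurable
  also have "\<dots> = (\<integral>y. indicator B y *\<^sub>R f y + indicator A (y - p) *\<^sub>R f y \<partial>lborel)"
    by (simp add: split scaleR_add_left[symmetric] del: real_scaleR_def)
  also have "\<dots> = (\<integral>y. indicator B y *\<^sub>R f y \<partial>lborel) + (\<integral>y. indicator A (y - p) *\<^sub>R f y \<partial>lborel)"
    by (rule Bochner_Integration.integral_add[OF iB iA'])
  also have "(\<integral>y. indicator A (y - p) *\<^sub>R f y \<partial>lborel) = (\<integral>x. (\<lambda>y. indicator A (y - p) *\<^sub>R f y) (p + x) \<partial>lborel)"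
    by (rule lborel_integral_shift[symmetric]) measurable
  also have "\<dots> = (\<integral>x. indicator A x *\<^sub>R f x \<partial>lborel)"
    by (simp add: fp add.commute[of p])
  also have "(\<integral>y. indicator B y *\<^sub>R f y \<partial>lborel) + \<dots> = (\<integral>y. indicator B y *\<^sub>R f y + indicator A y *\<^sub>R f y \<partial>lborel)"
    by (rule Bochner_Integration.integral_add[OF iB iA, symmetric])
  also have "\<dots> = cint f"
    unfolding cell_integral_def set_lebesgue_integral_def
    by (intro Bochner_Integration.integral_cong) (auto simp: indicator_def A_def B_def)
  finally show ?thesis .
qed

text \<open>
  The difference quotients in direction \<open>p\<close> have integral zero by translation invariance, and they
  converge boundedly to the derivative.
\<close>

lemma cint_derivative_along:
  assumes f: "Cper p q 1 f"
  shows "cint (\<lambda>x. \<Sum>i\<in>UNIV. partial_deriv i f x * p $ i) = 0"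
proof -
  let ?g = "\<lambda>x. \<Sum>i\<in>UNIV. partial_deriv i f x * p $ i"
  have f0: "Cper p q 0 f" and f1: "Cper p q (Suc 0) f"
    using f Cper_mono[OF f, of 0] by auto
  have g: "Cper p q 0 ?g"
    using f1 by (intro Cper_sum Cper_mult Cper_const Cper_partial_deriv)
  obtain B where B: "\<And>x. \<bar>?g x\<bar> \<le> B" using Cper_bounded[OF g] by blast
  have der: "((\<lambda>t. f (x + t *\<^sub>R p)) has_real_derivative ?g (x + t *\<^sub>R p)) (at t)" for x t
  proof -
    have d: "((\<lambda>t::real. x + t *\<^sub>R p) has_derivative (\<lambda>h. h *\<^sub>R p)) (at t)"
      by (auto intro!: derivative_eq_intros)
    have "((\<lambda>t. f (x + t *\<^sub>R p)) has_derivative (\<lambda>h. \<Sum>i\<in>UNIV. partial_deriv i f (x + t *\<^sub>R p) * (h *\<^sub>R p) $ i)) (at t)"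
      by (rule has_derivative_compose[OF d has_derivative_partial_deriv[OF Cper_differentiable[OF f1]]])
    then show ?thesis
      by (rule has_derivative_imp_has_field_derivative) (simp add: sum_distrib_left mult_ac)
  qed
  define s where "s n = inverse (real (Suc n))" for n
  define F where "F n x = (f (x + s n *\<^sub>R p) - f x) / s n" for n x
  have s: "0 < s n" "s n \<le> 1" for n by (auto simp: s_def field_simps)
  have Fbound: "\<bar>F n x\<bar> \<le> B" for n x
  proof -
    obtain z where "f (x + s n *\<^sub>R p) - f (x + 0 *\<^sub>R p) = (s n - 0) * ?g (x + z *\<^sub>R p)"
      using MVT2[of 0 "s n" "\<lambda>t. f (x + t *\<^sub>R p)" "\<lambda>t. ?g (x + t *\<^sub>R p)"] s[of n] der by blast
    then have "F n x = ?g (x + z *\<^sub>R p)" using s[of n] by (simp add: F_def)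
    then show ?thesis using B by metis
  qed
  have Flim: "(\<lambda>n. F n x) \<longlonglongrightarrow> ?g x" for x
  proof -
    have "((\<lambda>h. (f (x + h *\<^sub>R p) - f x) / h) \<longlongrightarrow> ?g x) (at 0)"
      using der[of x 0] by (simp add: DERIV_def)
    moreover have "filterlim s (at 0) sequentially"
    proof (rule filterlim_atI)
      show "s \<longlonglongrightarrow> 0" unfolding s_def by (rule LIMSEQ_inverse_real_of_nat)
      show "\<forall>\<^sub>F n in sequentially. s n \<noteq> 0" using s(1) by (intro always_eventually allI) (metis less_irrefl)
    qed
    ultimately show ?thesis unfolding F_def by (rule filterlim_compose)
  qed
  have shiftC: "Cper p q 0 (\<lambda>x. f (x + c))" for c
  proof -
    have "f (x + p + c) = f (x + c)" "f (x + q + c) = f (x + c)" for x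
      using f0[unfolded Cper_def periodic_def, THEN conjunct2, rule_format, of "x + c"] by (simp_all add: algebra_simps)
    moreover have "continuous_on UNIV (\<lambda>x. f (x + c))"
      by (rule continuous_on_compose2[OF Cper_continuous[OF f0, of UNIV]]) (auto intro: continuous_intros)
    ultimately show ?thesis by (simp add: Cper_def periodic_def)
  qed
  have FC: "Cper p q 0 (F n)" for n
    unfolding F_def[abs_def] divide_inverse
    by (intro Cper_mult Cper_diff Cper_const shiftC f0)
  have int0: "cint (F n) = 0" for n
  proof -
    have "cint (F n) = inverse (s n) * cint (\<lambda>x. f (x + s n *\<^sub>R p) - f x)"
      unfolding F_def[abs_def] divide_inverse by (subst mult.commute) (rule cint_cmult)
    also have "cint (\<lambda>x. f (x + s n *\<^sub>R p) - f x) = 0"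
      using cint_diff[OF shiftC f0, of "s n *\<^sub>R p"] cint_shift[OF f0, of "s n"] s[of n] by simp
    finally show ?thesis by simp
  qed
  have "(\<lambda>n. cint (F n)) \<longlonglongrightarrow> cint ?g"
    unfolding cell_integral_def set_lebesgue_integral_def
  proof (rule integral_dominated_convergence[where w="\<lambda>x. indicator (cell p q) x *\<^sub>R B"])
    show "integrable lborel (\<lambda>x. indicator (cell p q) x *\<^sub>R B)"
      using Cper_integrable[OF Cper_const[of p q 0 B]] by (simp add: set_integrable_def)
    show "(\<lambda>x. indicator (cell p q) x *\<^sub>R F n x) \<in> borel_measurable lborel" for n
      using Cper_integrable[OF FC[of n]] unfolding set_integrable_def by (rule borel_measurable_integrable)
    show "(\<lambda>x. indicator (cell p q) x *\<^sub>R ?g x) \<in> borel_measurable lborel"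
      using Cper_integrable[OF g] unfolding set_integrable_def by (rule borel_measurable_integrable)
    show "AE x in lborel. (\<lambda>i. indicator (cell p q) x *\<^sub>R F i x) \<longlonglongrightarrow> indicator (cell p q) x *\<^sub>R ?g x"
      using Flim by (auto intro!: tendsto_intros simp del: real_scaleR_def)
    show "AE x in lborel. norm (indicator (cell p q) x *\<^sub>R F n x) \<le> indicator (cell p q) x *\<^sub>R B" for n
      using Fbound by (auto simp: indicator_def)
  qed
  then show ?thesis by (simp add: int0 LIMSEQ_const_iff)
qed

end

context lattice
begin

lemma cell_flip: "cell q p = cell p q"
  using lattice.cell_eq[OF lattice_flip] cell_eq by auto

lemma cint_partial_deriv:
  assumes f: "Cper p q 1 f"
  shows "cint (partial_deriv i f) = 0"
proof -
  let ?D = "\<lambda>a x. \<Sum>j\<in>UNIV. partial_deriv j f x * a $ j"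
  have f1: "Cper p q (Suc 0) f" using f by simp
  have C: "Cper p q 0 (?D a)" for a
    using f1 by (intro Cper_sum Cper_mult Cper_const Cper_partial_deriv)
  have "Cper q p 1 f" using f by (auto simp: Cper_def periodic_def)
  then have 2: "cint (?D q) = 0"
    using lattice.cint_derivative_along[OF lattice_flip] by (simp add: cell_integral_def cell_flip)
  have ax: "axis i 1 $ j = P $ i * p $ j + Q $ i * q $ j" for j
    using arg_cong[OF coords[of "axis i 1"], of "\<lambda>v. v $ j"] by (simp add: inner_axis)
  have "partial_deriv i f x = P $ i * ?D p x + Q $ i * ?D q x" for x
  proof -
    have "partial_deriv i f x = (\<Sum>j\<in>UNIV. partial_deriv j f x * axis i 1 $ j)"
      by (simp add: axis_def if_distrib cong: if_cong)
    then show ?thesis unfolding ax by (simp add: sum.distrib sum_distrib_left algebra_simps)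
  qed
  then have "partial_deriv i f = (\<lambda>x. P $ i * ?D p x + Q $ i * ?D q x)" by auto
  then show ?thesis
    using cint_add[OF Cper_cmult[OF C] Cper_cmult[OF C], of "P $ i" p "Q $ i" q] cint_derivative_along[OF f] 2
    by (simp add: cint_cmult del: sum_2)
qed

lemma cint_by_parts:
  assumes u: "Cper p q 1 u" and v: "Cper p q 1 v"
  shows "cint (\<lambda>x. partial_deriv i u x * v x) = - cint (\<lambda>x. partial_deriv i v x * u x)"
proof -
  have d: "u differentiable_on UNIV" "v differentiable_on UNIV" using u v by (simp_all add: Cper_def)
  have C: "Cper p q 0 (\<lambda>x. partial_deriv i u x * v x)" "Cper p q 0 (\<lambda>x. partial_deriv i v x * u x)"
    using u v by (auto intro!: Cper_mult Cper_partial_deriv intro: Cper_mono)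
  have "cint (partial_deriv i (\<lambda>x. u x * v x)) = 0"
    using u v by (intro cint_partial_deriv Cper_mult)
  then show ?thesis
    using cint_add[OF C(2) C(1)] by (simp add: partial_deriv_mult[OF d] mult.commute)
qed

lemma green:
  assumes u: "Cper p q 2 u" and v: "Cper p q 1 v"
  shows "cint (\<lambda>x. laplacian u x * v x) = - (\<Sum>i\<in>UNIV. cint (\<lambda>x. partial_deriv i u x * partial_deriv i v x))"
proof -
  have u1: "Cper p q 1 (partial_deriv i u)" for i using u by (intro Cper_partial_deriv) (simp add: numeral_2_eq_2)
  then have u2: "Cper p q (Suc 0) (partial_deriv i u)" for i by simp
  have C: "Cper p q 0 (\<lambda>x. partial_deriv i (partial_deriv i u) x * v x)" for i
    by (rule Cper_mult[OF Cper_partial_deriv[OF u2] Cper_mono[OF v]]) simp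
  show ?thesis
    unfolding laplacian_def sum_distrib_right
    by (subst cint_sum[OF C]) (simp only: cint_by_parts[OF u1 v] sum_negf, simp only: mult.commute)
qed

lemma laplacian_symmetric:
  assumes u: "Cper p q 2 u" and v: "Cper p q 2 v"
  shows "cint (\<lambda>x. laplacian u x * v x) = cint (\<lambda>x. u x * laplacian v x)"
proof -
  have "Cper p q 1 u" "Cper p q 1 v" using u v by (auto intro: Cper_mono)
  then show ?thesis using green[OF u, of v] green[OF v, of u] by (simp add: mult.commute)
qed

text \<open>
  The set where \<open>f\<close> does not vanish meets the interior of the cell in an open null set, hence not at all. Points of
  the cell on its boundary are limits of interior points along the segment to the centre.
\<close>

lemma cint_definite:
  assumes f: "Cper p q m f" and 0: "cint (\<lambda>x. (f x)\<^sup>2) = 0"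
  shows "f x = 0"
proof -
  define U where "U = {x. f x \<noteq> 0} \<inter> {x. 0 < P \<bullet> x} \<inter> {x. P \<bullet> x < 1} \<inter> {x. 0 < Q \<bullet> x} \<inter> {x. Q \<bullet> x < 1}"
  have cont: "continuous_on UNIV f" using f by (rule Cper_continuous)
  have "open U" unfolding U_def
    by (intro open_Int open_Collect_less open_Collect_neq cont continuous_intros)
  have i: "integrable lborel (\<lambda>x. indicator (cell p q) x *\<^sub>R (f x)\<^sup>2)"
    using Cper_integrable[OF Cper_power[OF f]] by (simp add: set_integrable_def)
  have "AE x in lborel. indicator (cell p q) x *\<^sub>R (f x)\<^sup>2 = 0"
    using 0 by (subst integral_nonneg_eq_0_iff_AE[OF i, symmetric])
      (auto simp: cell_integral_def set_lebesgue_integral_def)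
  then have "AE x in lborel. x \<notin> U"
    by eventually_elim (auto simp: U_def cell_eq indicator_def)
  then have "U \<in> null_sets lborel"
    using \<open>open U\<close> by (subst (asm) AE_iff_null_sets[symmetric]) auto
  then have "negligible U"
    by (simp add: negligible_iff_null_sets null_sets_completionI)
  then have "U = {}" using open_not_negligible \<open>open U\<close> by blast
  obtain y where y: "y \<in> cell p q" "f y = f x"
    using periodic_rep[of x] f unfolding Cper_def by metis
  define c where "c = (1/2) *\<^sub>R p + (1/2) *\<^sub>R q"
  define z where "z n = y + inverse (real (Suc n)) *\<^sub>R (c - y)" for n
  have "z n \<in> {x. 0 < P \<bullet> x} \<inter> {x. P \<bullet> x < 1} \<inter> {x. 0 < Q \<bullet> x} \<inter> {x. Q \<bullet> x < 1}" for n
  proof -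
    define s where "s = inverse (real (Suc n))"
    have s: "0 < s" "s \<le> 1" by (auto simp: s_def field_simps)
    have c: "P \<bullet> c = 1/2" "Q \<bullet> c = 1/2" by (simp_all add: c_def inner_add_right Pp Pq Qp Qq)
    have *: "0 < t + s * (1/2 - t) \<and> t + s * (1/2 - t) < 1" if "0 \<le> t" "t < 1" for t
    proof -
      have "t + s * (1/2 - t) = (1 - s) * t + s * (1/2)" by (simp add: algebra_simps)
      moreover have "0 \<le> (1 - s) * t" using s that by simp
      moreover have "(1 - s) * t \<le> (1 - s) * 1" using s that by (intro mult_left_mono) auto
      ultimately show ?thesis using s by auto
    qed
    have "P \<bullet> z n = P \<bullet> y + s * (1/2 - P \<bullet> y)" "Q \<bullet> z n = Q \<bullet> y + s * (1/2 - Q \<bullet> y)"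
      by (simp_all add: z_def s_def inner_add_right inner_diff_right c)
    then show ?thesis using *[of "P \<bullet> y"] *[of "Q \<bullet> y"] y(1) by (simp add: cell_eq)
  qed
  then have fz: "f (z n) = 0" for n using \<open>U = {}\<close> by (auto simp: U_def)
  have "z \<longlonglongrightarrow> y + 0 *\<^sub>R (c - y)"
    unfolding z_def by (intro tendsto_intros LIMSEQ_inverse_real_of_nat)
  then have "(\<lambda>n. f (z n)) \<longlonglongrightarrow> f y"
    using cont by (auto intro: continuous_on_tendsto_compose)
  then have "f y = 0" by (simp add: fz LIMSEQ_const_iff)
  with y show ?thesis by simp
qed

end

section \<open>The BDF kernels and their inverse\<close>

lemma bdf_poly_3: "bdf_poly 3 = [:11/6, -7/6, 1/3:]"
  and bdf_poly_4: "bdf_poly 4 = [:25/12, -23/12, 13/12, -1/4:]"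
  and bdf_poly_5: "bdf_poly 5 = [:137/60, -163/60, 137/60, -21/20, 1/5:]"
  by (simp_all add: bdf_poly_def numeral_eq_Suc)

lemma bdf_b_eq_0:
  assumes "k \<in> {3, 4, 5}" "k \<le> j"
  shows "bdf_b k j = 0"
proof -
  have "degree (bdf_poly k) < k"
    using assms(1) by (auto simp: bdf_poly_3 bdf_poly_4 bdf_poly_5)
  then show ?thesis using assms(2) by (simp add: bdf_b_def coeff_eq_0)
qed

lemma bdf_b_values:
  "bdf_b 3 0 = 11/6" "bdf_b 3 (Suc 0) = -7/6" "bdf_b 3 2 = 1/3"
  "bdf_b 4 0 = 25/12" "bdf_b 4 (Suc 0) = -23/12" "bdf_b 4 2 = 13/12" "bdf_b 4 3 = -1/4"
  "bdf_b 5 0 = 137/60" "bdf_b 5 (Suc 0) = -163/60" "bdf_b 5 2 = 137/60" "bdf_b 5 3 = -21/20" "bdf_b 5 4 = 1/5"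
  unfolding bdf_b_def bdf_poly_3 bdf_poly_4 bdf_poly_5 by (simp_all add: numeral_eq_Suc)

lemma bdf_b_sum:
  "(\<Sum>i<3. bdf_b 3 i * v i) = 11/6 * v 0 - 7/6 * v (Suc 0) + 1/3 * v 2"
  "(\<Sum>i<4. bdf_b 4 i * v i) = 25/12 * v 0 - 23/12 * v (Suc 0) + 13/12 * v 2 - 1/4 * v 3"
  "(\<Sum>i<5. bdf_b 5 i * v i) = 137/60 * v 0 - 163/60 * v (Suc 0) + 137/60 * v 2 - 21/20 * v 3 + 1/5 * v 4"
proof -
  have 3: "{..<3::nat} = {0, Suc 0, 2}" and 4: "{..<4::nat} = {0, Suc 0, 2, 3}"
    and 5: "{..<5::nat} = {0, Suc 0, 2, 3, 4}" by auto
  show "(\<Sum>i<3. bdf_b 3 i * v i) = 11/6 * v 0 - 7/6 * v (Suc 0) + 1/3 * v 2"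
    unfolding 3 by (simp add: bdf_b_values)
  show "(\<Sum>i<4. bdf_b 4 i * v i) = 25/12 * v 0 - 23/12 * v (Suc 0) + 13/12 * v 2 - 1/4 * v 3"
    unfolding 4 by (simp add: bdf_b_values)
  show "(\<Sum>i<5. bdf_b 5 i * v i) = 137/60 * v 0 - 163/60 * v (Suc 0) + 137/60 * v 2 - 21/20 * v 3 + 1/5 * v 4"
    unfolding 5 by (simp add: bdf_b_values)
qed

lemma bdf_sum_eq:
  assumes k: "k \<in> {3, 4, 5}" and n: "k \<le> n"
  shows "(\<Sum>j=1..n. bdf_b k (n - j) * f j) = (\<Sum>i<k. bdf_b k i * f (n - i))"
proof -
  have "(\<Sum>j=1..n. bdf_b k (n - j) * f j) = (\<Sum>i<n. bdf_b k i * f (n - i))"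
    by (rule sum.reindex_bij_witness[of _ "\<lambda>i. n - i" "\<lambda>j. n - j"]) auto
  also have "\<dots> = (\<Sum>i<k. bdf_b k i * f (n - i))"
    using n by (intro sum.mono_neutral_right) (auto simp: bdf_b_eq_0[OF k])
  finally show ?thesis .
qed

text \<open>
  The quadratic form of the discrete energy on real sequences, which is integrated later to give
  the form with negative norms.
\<close>

definition G_form :: "nat \<Rightarrow> (nat \<Rightarrow> real) \<Rightarrow> nat \<Rightarrow> real" where
  "G_form k v n =
    (if k = 3 then
       1/6 * (v n)\<^sup>2 + 1/6 * (7/4 * v n - v (n-1))\<^sup>2
     else if k = 4 then
       13627/43008 * (v n)\<^sup>2 + 7/24 * (65/56 * v n - v (n-1))\<^sup>2
       + 1/8 * (3/2 * (v n - v (n-1)) + v (n-2))\<^sup>2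
     else
       1198850903/1678080000 * (v n)\<^sup>2 + 437/900 * (4931/6992 * v n - v (n-1))\<^sup>2
       + 9/40 * (23/18 * (v n - v (n-1)) + v (n-2))\<^sup>2
       + 1/10 * (2 * (v n - v (n-1)) + 2 * v (n-2) - v (n-3))\<^sup>2)"

lemma G_form_nonneg: "0 \<le> G_form k v n"
  by (simp add: G_form_def)

lemma G_form_zero: "(\<And>i. i \<le> n \<Longrightarrow> v i = 0) \<Longrightarrow> G_form k v n = 0"
  by (simp add: G_form_def)

text \<open>
  The difference of the two sides is a sum of squares. It is found by completing squares
  starting from the oldest value; the linear forms are symmetric or antisymmetric under reversal of the
  sequence.
\<close>

lemma bdf_energy_inequality:
  assumes "k \<in> {3, 4, 5}"
  shows "G_form k v n - G_form k v (n - 1) + sigma_L k / 2 * (v n)\<^sup>2 \<le> v n * (\<Sum>i<k. bdf_b k i * v (n - i))"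
proof -
  let ?v = "\<lambda>i. v (n - i)"
  consider "k = 3" | "k = 4" | "k = 5" using assms by auto
  then show ?thesis
  proof cases
    case 1
    have "v n * (\<Sum>i<k. bdf_b k i * v (n - i)) = G_form k v n - G_form k v (n - 1) + sigma_L k / 2 * (v n)\<^sup>2
        + 1/6 * (v n - 7/4 * v (n - 1) + v (n - 2))\<^sup>2"
      unfolding 1 bdf_b_sum[where v="?v"]
      by (simp add: G_form_def sigma_L_def power2_eq_square field_simps numeral_2_eq_2)
    then show ?thesis by simp
  next
    case 2
    have "v n * (\<Sum>i<k. bdf_b k i * v (n - i)) = G_form k v n - G_form k v (n - 1) + sigma_L k / 2 * (v n)\<^sup>2
        + 1/8 * (v (n - 3) - 3/2 * v (n - 2) + 3/2 * v (n - 1) - v n)\<^sup>2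
        + 1/6 * (v n - 29/32 * v (n - 1) + v (n - 2))\<^sup>2"
      unfolding 2 bdf_b_sum[where v="?v"]
      by (simp add: G_form_def sigma_L_def power2_eq_square field_simps numeral_2_eq_2 numeral_3_eq_3)
    then show ?thesis by simp
  next
    case 3
    have "v n * (\<Sum>i<k. bdf_b k i * v (n - i)) = G_form k v n - G_form k v (n - 1) + sigma_L k / 2 * (v n)\<^sup>2
        + 1/10 * (v n - 2 * v (n - 1) + 2 * v (n - 2) - 2 * v (n - 3) + v (n - 4))\<^sup>2
        + 1/8 * (v (n - 3) - 7/10 * v (n - 2) + 7/10 * v (n - 1) - v n)\<^sup>2
        + 1/6 * (v n + 187/800 * v (n - 1) + v (n - 2))\<^sup>2"
      unfolding 3 bdf_b_sum[where v="?v"]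
      by (simp add: G_form_def sigma_L_def power2_eq_square field_simps numeral_2_eq_2 numeral_3_eq_3 eval_nat_numeral)
    then show ?thesis by simp
  qed
qed

text \<open>
  Toeplitz sums starting at index \<open>0\<close>. Identifying a sequence with a formal power series turns them into
  products, so that inverse kernels are inverse power series.
\<close>

definition conv :: "(nat \<Rightarrow> real) \<Rightarrow> (nat \<Rightarrow> real) \<Rightarrow> nat \<Rightarrow> real" where
  "conv a w l = (\<Sum>j\<le>l. a (l - j) * w j)"

lemma conv_eq_fps: "conv a w l = fps_nth (Abs_fps a * Abs_fps w) l"
proof -
  have "fps_nth (Abs_fps a * Abs_fps w) l = (\<Sum>i\<le>l. a i * w (l - i))"
    by (simp add: fps_mult_nth atLeast0AtMost)
  also have "\<dots> = conv a w l"
    unfolding conv_def by (rule sum.reindex_bij_witness[of _ "\<lambda>i. l - i" "\<lambda>i. l - i"]) auto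
  finally show ?thesis by simp
qed

lemma Abs_fps_conv: "Abs_fps (conv a w) = Abs_fps a * Abs_fps w"
  by (simp add: fps_eq_iff conv_eq_fps)

lemma conv_assoc_fps: "conv a (conv b w) l = fps_nth (Abs_fps a * Abs_fps b * Abs_fps w) l"
  by (simp add: conv_eq_fps[of a] Abs_fps_conv mult.assoc)

lemma conv_add: "conv a (\<lambda>j. v j + w j) l = conv a v l + conv a w l"
  by (simp add: conv_def sum.distrib algebra_simps)

lemma bdf_b0_pos: "k \<in> {3, 4, 5} \<Longrightarrow> 0 < bdf_b k 0"
  by (auto simp: bdf_b_values)

text \<open>
  The recursion for the DOC kernels says that all coefficients of this product beyond the first vanish.
\<close>

lemma doc_bdf_fps:
  assumes "k \<in> {3, 4, 5}"
  shows "Abs_fps (doc k) * Abs_fps (bdf_b k) = 1"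
proof (rule fps_ext)
  fix n
  have b0: "bdf_b k 0 \<noteq> 0" using bdf_b0_pos[OF assms] by simp
  have "(\<Sum>i=0..n. doc k i * bdf_b k (n - i)) = (\<Sum>i<n. doc k i * bdf_b k (n - i)) + doc k n * bdf_b k 0"
    by (simp add: atLeast0AtMost lessThan_Suc_atMost[symmetric])
  also have "doc k n * bdf_b k 0 = (if n = 0 then 1 else - (\<Sum>i<n. doc k i * bdf_b k (n - i)))"
    using b0 by (subst doc.simps) simp
  finally show "fps_nth (Abs_fps (doc k) * Abs_fps (bdf_b k)) n = fps_nth 1 n"
    by (simp add: fps_mult_nth split: if_splits)
qed

lemma conv_doc_bdf: "k \<in> {3, 4, 5} \<Longrightarrow> conv (doc k) (conv (bdf_b k) w) l = w l"
  by (simp add: conv_assoc_fps doc_bdf_fps)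

lemma conv_bdf_doc: "k \<in> {3, 4, 5} \<Longrightarrow> conv (bdf_b k) (conv (doc k) w) l = w l"
  by (simp add: conv_assoc_fps mult.commute[of "Abs_fps (bdf_b k)"] doc_bdf_fps)

text \<open>
  The BDF formula and the energy look back at most four steps; with five leading zeros the sums
  and the energy may be written without case distinctions at the start of the sequence.
\<close>

definition zero_pad :: "(nat \<Rightarrow> real) \<Rightarrow> nat \<Rightarrow> real" where
  "zero_pad w i = (if i < 5 then 0 else w (i - 5))"

lemma conv_bdf_zero_pad:
  assumes "k \<in> {3, 4, 5}"
  shows "conv (bdf_b k) w l = (\<Sum>i<k. bdf_b k i * zero_pad w (l + 5 - i))"
proof -
  have "conv (bdf_b k) w l = (\<Sum>i\<le>l. bdf_b k i * w (l - i))"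
    unfolding conv_def by (rule sum.reindex_bij_witness[of _ "\<lambda>i. l - i" "\<lambda>i. l - i"]) auto
  also have "\<dots> = (\<Sum>i\<le>l. bdf_b k i * zero_pad w (l + 5 - i))"
    by (rule sum.cong) (auto simp: zero_pad_def)
  also have "\<dots> = (\<Sum>i<k. bdf_b k i * zero_pad w (l + 5 - i))"
  proof (rule sum.mono_neutral_cong)
    show "bdf_b k i * zero_pad w (l + 5 - i) = 0" if "i \<in> {..<k} - {..l}" for i
      using that by (auto simp: zero_pad_def)
    show "bdf_b k i * zero_pad w (l + 5 - i) = 0" if "i \<in> {..l} - {..<k}" for i
      using that bdf_b_eq_0[OF assms] by simp
  qed auto
  finally show ?thesis .
qed

text \<open>
  The increments of \<open>G\<close> in the energy inequality telescope from \<open>0\<close> to a nonnegative value.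
\<close>

lemma bdf_coercive:
  assumes k: "k \<in> {3, 4, 5}"
  shows "sigma_L k / 2 * (\<Sum>l\<le>m. (w l)\<^sup>2) \<le> (\<Sum>l\<le>m. w l * conv (bdf_b k) w l)"
proof -
  let ?v = "zero_pad w"
  have "G_form k ?v (m + 5) + sigma_L k / 2 * (\<Sum>l\<le>m. (w l)\<^sup>2) \<le> (\<Sum>l\<le>m. w l * conv (bdf_b k) w l)"
  proof (induction m)
    case 0
    have "G_form k ?v 4 = 0" by (rule G_form_zero) (simp add: zero_pad_def)
    moreover have "?v 5 = w 0" by (simp add: zero_pad_def)
    ultimately show ?case using bdf_energy_inequality[OF k, of ?v 5]
      by (simp add: conv_bdf_zero_pad[OF k])
  next
    case (Suc m)
    have "?v (Suc m + 5) = w (Suc m)" by (simp add: zero_pad_def)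
    then show ?case using Suc bdf_energy_inequality[OF k, of ?v "Suc m + 5"]
      by (simp add: conv_bdf_zero_pad[OF k] algebra_simps)
  qed
  then show ?thesis using G_form_nonneg[of k ?v "m + 5"] by linarith
qed

definition bdf_l1 :: "nat \<Rightarrow> real" where
  "bdf_l1 k = (\<Sum>i<k. \<bar>bdf_b k i\<bar>)"

text \<open>
  Young's inequality for convolutions, with the \<open>\<ell>\<^sup>1\<close> norm of the kernel.
\<close>

lemma bdf_young:
  assumes k: "k \<in> {3, 4, 5}"
  shows "(\<Sum>l\<le>m. (conv (bdf_b k) w l)\<^sup>2) \<le> (bdf_l1 k)\<^sup>2 * (\<Sum>l\<le>m. (w l)\<^sup>2)"
proof -
  let ?v = "zero_pad w"
  have "(conv (bdf_b k) w l)\<^sup>2 \<le> bdf_l1 k * (\<Sum>i<k. \<bar>bdf_b k i\<bar> * (?v (l + 5 - i))\<^sup>2)" for l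
  proof -
    have "(conv (bdf_b k) w l)\<^sup>2 = (\<Sum>i<k. sqrt \<bar>bdf_b k i\<bar> * (sgn (bdf_b k i) * sqrt \<bar>bdf_b k i\<bar> * ?v (l + 5 - i)))\<^sup>2"
      unfolding conv_bdf_zero_pad[OF k]
    proof (rule arg_cong[where f="\<lambda>x. x\<^sup>2"], rule sum.cong)
      fix i
      have "sqrt \<bar>bdf_b k i\<bar> * (sgn (bdf_b k i) * sqrt \<bar>bdf_b k i\<bar> * ?v (l + 5 - i))
          = (sgn (bdf_b k i) * (sqrt \<bar>bdf_b k i\<bar> * sqrt \<bar>bdf_b k i\<bar>)) * ?v (l + 5 - i)"
        by (simp only: mult_ac)
      also have "sgn (bdf_b k i) * (sqrt \<bar>bdf_b k i\<bar> * sqrt \<bar>bdf_b k i\<bar>) = bdf_b k i"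
        by (simp add: sgn_mult_abs del: real_sqrt_abs2)
      finally show "bdf_b k i * ?v (l + 5 - i) = sqrt \<bar>bdf_b k i\<bar> * (sgn (bdf_b k i) * sqrt \<bar>bdf_b k i\<bar> * ?v (l + 5 - i))"
        by (rule sym)
    qed simp
    also have "\<dots> \<le> (\<Sum>i<k. (sqrt \<bar>bdf_b k i\<bar>)\<^sup>2) * (\<Sum>i<k. (sgn (bdf_b k i) * sqrt \<bar>bdf_b k i\<bar> * ?v (l + 5 - i))\<^sup>2)"
      by (rule Cauchy_Schwarz_ineq_sum)
    also have "(\<Sum>i<k. (sgn (bdf_b k i) * sqrt \<bar>bdf_b k i\<bar> * ?v (l + 5 - i))\<^sup>2) = (\<Sum>i<k. \<bar>bdf_b k i\<bar> * (?v (l + 5 - i))\<^sup>2)"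
      by (rule sum.cong) (auto simp: power_mult_distrib sgn_if)
    finally show ?thesis by (simp add: bdf_l1_def)
  qed
  then have "(\<Sum>l\<le>m. (conv (bdf_b k) w l)\<^sup>2) \<le> (\<Sum>l\<le>m. bdf_l1 k * (\<Sum>i<k. \<bar>bdf_b k i\<bar> * (?v (l + 5 - i))\<^sup>2))"
    by (rule sum_mono)
  also have "\<dots> = bdf_l1 k * (\<Sum>i<k. \<bar>bdf_b k i\<bar> * (\<Sum>l\<le>m. (?v (l + 5 - i))\<^sup>2))"
    by (simp only: sum_distrib_left) (rule sum.swap)
  also have "\<dots> \<le> bdf_l1 k * (\<Sum>i<k. \<bar>bdf_b k i\<bar> * (\<Sum>l\<le>m. (w l)\<^sup>2))"
  proof (rule mult_left_mono[OF sum_mono[OF mult_left_mono]])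
    fix i assume "i \<in> {..<k}"
    then have i: "i < 5" using k by auto
    have "(\<Sum>l\<le>m. (?v (l + 5 - i))\<^sup>2) = (\<Sum>l\<in>{i..m}. (w (l - i))\<^sup>2)"
      using i by (intro sum.mono_neutral_cong_right) (auto simp: zero_pad_def)
    also have "\<dots> = (\<Sum>l\<in>(\<lambda>l. l - i) ` {i..m}. (w l)\<^sup>2)"
      by (subst sum.reindex) (auto simp: inj_on_def)
    also have "\<dots> \<le> (\<Sum>l\<le>m. (w l)\<^sup>2)"
      by (rule sum_mono2) auto
    finally show "(\<Sum>l\<le>m. (?v (l + 5 - i))\<^sup>2) \<le> (\<Sum>l\<le>m. (w l)\<^sup>2)" .
  qed (auto simp: bdf_l1_def intro: sum_nonneg)
  also have "\<dots> = (bdf_l1 k)\<^sup>2 * (\<Sum>l\<le>m. (w l)\<^sup>2)"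
    by (simp add: bdf_l1_def sum_distrib_right[symmetric] power2_eq_square)
  finally show ?thesis .
qed

lemma sigma_L_pos: "0 < sigma_L k"
  by (simp add: sigma_L_def)

text \<open>
  For \<open>u = \<theta> * f\<close> one has \<open>f = b * u\<close>, so coercivity gives \<open>\<sigma>/2 \<Sum> u\<^sup>2 \<le> \<Sum> u f\<close>.
\<close>

lemma doc_bounded:
  assumes k: "k \<in> {3, 4, 5}"
  shows "(\<Sum>l\<le>m. (conv (doc k) f l)\<^sup>2) \<le> 4 / (sigma_L k)\<^sup>2 * (\<Sum>l\<le>m. (f l)\<^sup>2)"
proof -
  let ?u = "conv (doc k) f" and ?s = "sigma_L k"
  have s: "0 < ?s" by (rule sigma_L_pos)
  have "?s / 2 * (\<Sum>l\<le>m. (?u l)\<^sup>2) \<le> (\<Sum>l\<le>m. ?u l * f l)"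
    using bdf_coercive[OF k, of ?u m] by (simp add: conv_bdf_doc[OF k])
  also have "\<dots> \<le> (\<Sum>l\<le>m. ?s / 4 * (?u l)\<^sup>2 + 1 / ?s * (f l)\<^sup>2)"
  proof (rule sum_mono)
    fix l
    have "0 \<le> (?s * ?u l - 2 * f l)\<^sup>2 / (4 * ?s)" using s by simp
    also have "\<dots> = ?s / 4 * (?u l)\<^sup>2 + 1 / ?s * (f l)\<^sup>2 - ?u l * f l"
      using s by (simp add: power2_eq_square field_simps)
    finally show "?u l * f l \<le> ?s / 4 * (?u l)\<^sup>2 + 1 / ?s * (f l)\<^sup>2" by simp
  qed
  also have "\<dots> = ?s / 4 * (\<Sum>l\<le>m. (?u l)\<^sup>2) + 1 / ?s * (\<Sum>l\<le>m. (f l)\<^sup>2)"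
    by (simp only: sum.distrib sum_distrib_left)
  finally have "?s / 4 * (\<Sum>l\<le>m. (?u l)\<^sup>2) \<le> 1 / ?s * (\<Sum>l\<le>m. (f l)\<^sup>2)" by linarith
  then have "4 / ?s * (?s / 4 * (\<Sum>l\<le>m. (?u l)\<^sup>2)) \<le> 4 / ?s * (1 / ?s * (\<Sum>l\<le>m. (f l)\<^sup>2))"
    using s by (intro mult_left_mono) auto
  then show ?thesis using s by (simp add: power2_eq_square)
qed

lemma bdf_l1_values: "bdf_l1 3 = 10/3" "bdf_l1 4 = 16/3" "bdf_l1 5 = 128/15"
proof -
  have 3: "{..<3::nat} = {0, Suc 0, 2}" and 4: "{..<4::nat} = {0, Suc 0, 2, 3}"
    and 5: "{..<5::nat} = {0, Suc 0, 2, 3, 4}" by auto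
  show "bdf_l1 3 = 10/3" "bdf_l1 4 = 16/3" "bdf_l1 5 = 128/15"
    unfolding bdf_l1_def 3 4 5 by (simp_all add: bdf_b_values)
qed

lemma bdf_l1_pos: "k \<in> {3, 4, 5} \<Longrightarrow> 0 < bdf_l1 k"
  by (auto simp: bdf_l1_values)

text \<open>
  Again with \<open>u = \<theta> * f\<close>: the form is \<open>\<Sum> u (b * u)\<close>, which dominates \<open>\<Sum> u\<^sup>2\<close>, which
  in turn dominates \<open>\<Sum> f\<^sup>2 = \<Sum> (b * u)\<^sup>2\<close>.
\<close>

lemma doc_coercive:
  assumes k: "k \<in> {3, 4, 5}"
  shows "sigma_L k / (bdf_l1 k)\<^sup>2 * (\<Sum>l\<le>m. (f l)\<^sup>2) \<le> 2 * (\<Sum>l\<le>m. f l * conv (doc k) f l)"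
proof -
  let ?u = "conv (doc k) f"
  have "(\<Sum>l\<le>m. (f l)\<^sup>2) \<le> (bdf_l1 k)\<^sup>2 * (\<Sum>l\<le>m. (?u l)\<^sup>2)"
    using bdf_young[OF k, of ?u m] by (simp add: conv_bdf_doc[OF k])
  moreover have "sigma_L k * (\<Sum>l\<le>m. (?u l)\<^sup>2) \<le> 2 * (\<Sum>l\<le>m. f l * ?u l)"
    using bdf_coercive[OF k, of ?u m] by (simp add: conv_bdf_doc[OF k] mult.commute)
  moreover have "sigma_L k / (bdf_l1 k)\<^sup>2 * (\<Sum>l\<le>m. (f l)\<^sup>2)
      \<le> sigma_L k / (bdf_l1 k)\<^sup>2 * ((bdf_l1 k)\<^sup>2 * (\<Sum>l\<le>m. (?u l)\<^sup>2))"
    using calculation(1) sigma_L_pos[of k] by (intro mult_left_mono) auto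
  ultimately show ?thesis using bdf_l1_pos[OF k] by simp
qed

text \<open>
  The matrix of order one has the single eigenvalue \<open>b\<^sub>0\<^sup>2\<close>.
\<close>

lemma const_m2_lower:
  assumes "const_m2 k m2"
  shows "(bdf_b k 0)\<^sup>2 \<le> m2"
proof -
  let ?A = "transpose_mat (bdf_matrix k 1) * bdf_matrix k 1"
  have A: "?A = mat 1 1 (\<lambda>_. (bdf_b k 0)\<^sup>2)"
    by (rule eq_matI) (auto simp: bdf_matrix_def scalar_prod_def power2_eq_square)
  have "{e. eigenvalue ?A e} = {(bdf_b k 0)\<^sup>2}"
  proof (intro equalityI subsetI)
    fix e assume "e \<in> {e. eigenvalue ?A e}"
    then obtain v where v: "v \<in> carrier_vec 1" "v \<noteq> 0\<^sub>v 1" "mat 1 1 (\<lambda>_. (bdf_b k 0)\<^sup>2) *\<^sub>v v = e \<cdot>\<^sub>v v"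
      unfolding A by (auto simp: eigenvalue_def eigenvector_def)
    have "vec_index v 0 \<noteq> 0"
      using v(1,2) by (auto simp: Matrix.vec_eq_iff)
    moreover have "(bdf_b k 0)\<^sup>2 * vec_index v 0 = e * vec_index v 0"
      using arg_cong[OF v(3), of "\<lambda>u. vec_index u 0"] v(1) by (simp add: scalar_prod_def)
    ultimately show "e \<in> {(bdf_b k 0)\<^sup>2}" by simp
  next
    fix e assume "e \<in> {(bdf_b k 0)\<^sup>2}"
    then have "eigenvector ?A (vec 1 (\<lambda>_. 1)) e"
      unfolding A eigenvector_def by (auto simp: scalar_prod_def Matrix.vec_eq_iff)
    then show "e \<in> {e. eigenvalue ?A e}" by (auto simp: eigenvalue_def)
  qed
  then show ?thesis using assms unfolding const_m2_def lambda_max_def by force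
qed

text \<open>
  Here \<open>a\<close> measures the dissipation of the linear part of the equation. The weight in the second
  estimate is chosen so that the factor of \<open>\<Sum> f\<^sup>2\<close> is the one appearing with \<open>c\<^sub>3\<^sup>2\<close> in \<open>c\<^sub>4\<close>; the
  numbers \<open>4\<close> and \<open>29\<close> are such that \<open>s (1 - s)\<^sup>2 - 4 s\<^sup>2 + 29 \<ge> 0\<close> for \<open>s \<ge> 0\<close>,
  see \<open>interpolation\<close>.
\<close>

lemma doc_estimates:
  assumes k: "k \<in> {3, 4, 5}" and m2: "(bdf_b k 0)\<^sup>2 \<le> m2"
  obtains a where "0 < a"
    and "\<And>f m. a * (\<Sum>l\<le>m. (f l)\<^sup>2) \<le> 2 * (\<Sum>l\<le>m. f l * conv (doc k) f l)"
    and "\<And>f g m. 2 * (\<Sum>l\<le>m. g l * conv (doc k) f l)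
           \<le> 2 * m2 * m3_bdf k / (m1_bdf k)\<^sup>2 * (\<Sum>l\<le>m. (f l)\<^sup>2) + 4 * a * (\<Sum>l\<le>m. (g l)\<^sup>2)"
    and "29 * a \<le> 250 * m2\<^sup>2 / m1_bdf k ^ 5"
proof -
  define s where "s = sigma_L k"
  define a where "a = s / (bdf_l1 k)\<^sup>2"
  have s: "0 < s" unfolding s_def by (rule sigma_L_pos)
  have m2p: "0 < m2" using m2 bdf_b0_pos[OF k] by (smt (verit) zero_less_power)
  have m13: "0 < m1_bdf k" "0 < m3_bdf k" using k by (auto simp: m1_bdf_def m3_bdf_def rho_bdf_def)
  have a: "0 < a" using s bdf_l1_pos[OF k] by (simp add: a_def)
  \<comment> \<open>The weight in \<open>2 g u \<le> c u\<^sup>2 + g\<^sup>2 / c\<close>; multiplied by the bound \<open>4 / s\<^sup>2\<close> for the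
    convolution it gives \<open>2 m\<^sub>2 m\<^sub>3 / m\<^sub>1\<^sup>2\<close>.\<close>
  define c where "c = m2 * m3_bdf k * s\<^sup>2 / (2 * (m1_bdf k)\<^sup>2)"
  have c: "0 < c" using m2p m13 s by (simp add: c_def)
  have ca: "1 / c \<le> 4 * a"
  proof -
    have "1 / c = 2 * (m1_bdf k)\<^sup>2 / (m3_bdf k * s\<^sup>2) / m2" by (simp add: c_def)
    also have "\<dots> \<le> 2 * (m1_bdf k)\<^sup>2 / (m3_bdf k * s\<^sup>2) / (bdf_b k 0)\<^sup>2"
      using m2 m2p m13 s bdf_b0_pos[OF k] by (intro divide_left_mono) auto
    also have "\<dots> \<le> 4 * a"
      using k by (auto simp: a_def s_def sigma_L_def m1_bdf_def m3_bdf_def rho_bdf_def bdf_l1_values bdf_b_values power2_eq_square)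
    finally show ?thesis .
  qed
  have "29 * a \<le> 250 * ((bdf_b k 0)\<^sup>2)\<^sup>2 / m1_bdf k ^ 5"
    using k by (auto simp: a_def s_def sigma_L_def m1_bdf_def bdf_l1_values bdf_b_values power2_eq_square power_divide)
  also have "\<dots> \<le> 250 * m2\<^sup>2 / m1_bdf k ^ 5"
    using m2 m13 by (intro divide_right_mono mult_left_mono power_mono) auto
  finally have 4: "29 * a \<le> 250 * m2\<^sup>2 / m1_bdf k ^ 5" .
  show ?thesis
  proof (rule that[OF a _ _ 4])
    show "a * (\<Sum>l\<le>m. (f l)\<^sup>2) \<le> 2 * (\<Sum>l\<le>m. f l * conv (doc k) f l)" for f m
      unfolding a_def s_def by (rule doc_coercive[OF k])
    show "2 * (\<Sum>l\<le>m. g l * conv (doc k) f l)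
           \<le> 2 * m2 * m3_bdf k / (m1_bdf k)\<^sup>2 * (\<Sum>l\<le>m. (f l)\<^sup>2) + 4 * a * (\<Sum>l\<le>m. (g l)\<^sup>2)" for f g m
    proof -
      let ?u = "conv (doc k) f"
      have "2 * (g l * ?u l) \<le> c * (?u l)\<^sup>2 + 4 * a * (g l)\<^sup>2" for l
      proof -
        have "0 \<le> (c * ?u l - g l)\<^sup>2 / c" using c by simp
        also have "\<dots> = c * (?u l)\<^sup>2 + 1 / c * (g l)\<^sup>2 - 2 * (g l * ?u l)"
          using c by (simp add: power2_eq_square field_simps)
        finally have "2 * (g l * ?u l) \<le> c * (?u l)\<^sup>2 + 1 / c * (g l)\<^sup>2" by simp
        also have "1 / c * (g l)\<^sup>2 \<le> 4 * a * (g l)\<^sup>2" using ca by (intro mult_right_mono) auto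
        finally show ?thesis by simp
      qed
      then have "2 * (\<Sum>l\<le>m. g l * ?u l) \<le> (\<Sum>l\<le>m. c * (?u l)\<^sup>2 + 4 * a * (g l)\<^sup>2)"
        unfolding sum_distrib_left by (rule sum_mono)
      also have "\<dots> = c * (\<Sum>l\<le>m. (?u l)\<^sup>2) + 4 * a * (\<Sum>l\<le>m. (g l)\<^sup>2)"
        by (simp only: sum.distrib sum_distrib_left)
      also have "c * (\<Sum>l\<le>m. (?u l)\<^sup>2) \<le> c * (4 / s\<^sup>2 * (\<Sum>l\<le>m. (f l)\<^sup>2))"
        using c unfolding s_def by (intro mult_left_mono doc_bounded[OF k]) auto
      also have "\<dots> = 2 * m2 * m3_bdf k / (m1_bdf k)\<^sup>2 * (\<Sum>l\<le>m. (f l)\<^sup>2)"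
        using s m13 by (simp add: c_def field_simps)
      finally show ?thesis by simp
    qed
  qed
qed

text \<open>
  The sum defining the BDF formula at time \<open>k + j\<close> splits into the starting differences, whose convolution with the DOC kernels is
  \<open>v_init\<close>, and the convolution of the later differences, which the DOC kernels undo.
\<close>

lemma doc_bdf_initial:
  assumes k: "k \<in> {3, 4, 5}"
  shows "conv (doc k) (\<lambda>j. \<Sum>i=1..k + j. bdf_b k (k + j - i) * bdiff v i) l = bdiff v (k + l) + v_init k v (k + l)"
proof -
  let ?d = "bdiff v"
  have split: "(\<Sum>i=1..k + j. bdf_b k (k + j - i) * ?d i)
      = (\<Sum>i=1..k-1. bdf_b k (k + j - i) * ?d i) + conv (bdf_b k) (\<lambda>i. ?d (k + i)) j" for j
  proof -
    have "{1..k + j} = {1..k-1} \<union> {k..k + j}" using k by auto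
    then have "(\<Sum>i=1..k + j. bdf_b k (k + j - i) * ?d i)
        = (\<Sum>i=1..k-1. bdf_b k (k + j - i) * ?d i) + (\<Sum>i=k..k + j. bdf_b k (k + j - i) * ?d i)"
      using k by (simp only:) (rule sum.union_disjoint, auto)
    also have "(\<Sum>i=k..k + j. bdf_b k (k + j - i) * ?d i) = conv (bdf_b k) (\<lambda>i. ?d (k + i)) j"
      unfolding conv_def by (rule sum.reindex_bij_witness[of _ "\<lambda>i. k + i" "\<lambda>i. i - k"]) (auto simp: add.commute[of j k])
    finally show ?thesis .
  qed
  have "conv (doc k) (\<lambda>j. \<Sum>i=1..k-1. bdf_b k (k + j - i) * ?d i) l
      = (\<Sum>i=1..k-1. ?d i * (\<Sum>j\<le>l. doc k (l - j) * bdf_b k (k + j - i)))"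
    unfolding conv_def sum_distrib_left by (subst sum.swap) (simp add: mult_ac)
  also have "\<dots> = v_init k v (k + l)"
  proof -
    have "(\<Sum>j\<le>l. doc k (l - j) * bdf_b k (k + j - i)) = (\<Sum>j=k..k + l. doc k (k + l - j) * bdf_b k (j - i))" for i
      by (rule sum.reindex_bij_witness[of _ "\<lambda>j. j - k" "\<lambda>j. k + j"]) auto
    then show ?thesis by (simp add: v_init_def)
  qed
  finally show ?thesis
    by (simp only: split conv_add conv_doc_bdf[OF k] add.commute[of "v_init _ _ _"])
qed

section \<open>Trigonometric polynomials on the torus\<close>

context lattice
begin

abbreviation area :: real where "area \<equiv> cint (\<lambda>_. 1)"

lemma area_pos: "0 < area"
proof -
  have "area \<noteq> 0" using cint_definite[OF Cper_const[of p q 0 1]] by auto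
  moreover have "0 \<le> area" by (rule cint_nonneg) simp
  ultimately show ?thesis by simp
qed

lemma cint_const: "cint (\<lambda>_. c) = c * area"
  using cint_cmult[of c "\<lambda>_. 1"] by simp

definition freq :: "int \<times> int \<Rightarrow> real^2" where
  "freq z = (2 * pi * of_int (fst z)) *\<^sub>R P + (2 * pi * of_int (snd z)) *\<^sub>R Q"

text \<open>
  The real and imaginary parts of the characters of the torus. The pairs \<open>z\<close> and \<open>-z\<close> give the same
  functions up to sign, which is why two terms appear in the orthogonality relations.
\<close>

definition C :: "int \<times> int \<Rightarrow> real^2 \<Rightarrow> real" where "C z x = cos (freq z \<bullet> x)"
definition S :: "int \<times> int \<Rightarrow> real^2 \<Rightarrow> real" where "S z x = sin (freq z \<bullet> x)"

lemma freq_add: "freq (z + y) = freq z + freq y"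
  by (simp add: freq_def algebra_simps)

lemma freq_diff: "freq (z - y) = freq z - freq y"
  by (simp add: freq_def algebra_simps)

lemma freq_0 [simp]: "freq 0 = 0"
  by (simp add: freq_def)

lemma freq_minus: "freq (- z) = - freq z"
  using freq_diff[of 0 z] by simp

lemma freq_p: "freq z \<bullet> p = 2 * pi * of_int (fst z)" and freq_q: "freq z \<bullet> q = 2 * pi * of_int (snd z)"
  by (simp_all add: freq_def inner_add_left Pp Pq Qp Qq)

lemma freq_eq_0_iff: "freq z = 0 \<longleftrightarrow> z = 0"
proof
  assume "freq z = 0"
  then show "z = 0" using freq_p[of z] freq_q[of z] by (simp add: prod_eq_iff)
qed simp

lemma periodic_C: "periodic p q (C z)" and periodic_S: "periodic p q (S z)"
  by (simp_all add: periodic_def C_def S_def inner_add_right freq_p freq_q cos_add sin_add)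

lemma has_derivative_C: "(C z has_derivative (\<lambda>h. \<Sum>i\<in>UNIV. (- (freq z $ i) * S z x) * h $ i)) (at x)"
proof -
  have "((\<lambda>x. cos (freq z \<bullet> x)) has_derivative (\<lambda>h. - sin (freq z \<bullet> x) * (freq z \<bullet> h))) (at x)"
    by (auto intro!: derivative_eq_intros)
  moreover have "- sin (freq z \<bullet> x) * (freq z \<bullet> h) = (\<Sum>i\<in>UNIV. (- (freq z $ i) * S z x) * h $ i)" for h
    by (simp add: S_def inner_vec_def[of "freq z" h] sum_distrib_left mult_ac)
  ultimately show ?thesis by (simp only: C_def[abs_def])
qed

lemma has_derivative_S: "(S z has_derivative (\<lambda>h. \<Sum>i\<in>UNIV. (freq z $ i * C z x) * h $ i)) (at x)"
proof -
  have "((\<lambda>x. sin (freq z \<bullet> x)) has_derivative (\<lambda>h. cos (freq z \<bullet> x) * (freq z \<bullet> h))) (at x)"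
    by (auto intro!: derivative_eq_intros)
  moreover have "cos (freq z \<bullet> x) * (freq z \<bullet> h) = (\<Sum>i\<in>UNIV. (freq z $ i * C z x) * h $ i)" for h
    by (simp add: C_def inner_vec_def[of "freq z" h] sum_distrib_left mult_ac)
  ultimately show ?thesis by (simp only: S_def[abs_def])
qed

lemma partial_deriv_C: "partial_deriv i (C z) = (\<lambda>x. - (freq z $ i) * S z x)"
  and partial_deriv_S: "partial_deriv i (S z) = (\<lambda>x. freq z $ i * C z x)"
  by (intro ext partial_deriv_eqI[OF has_derivative_C] partial_deriv_eqI[OF has_derivative_S])+

lemma C_S_smooth: "C_space m (C z) \<and> C_space m (S z)"
proof (induction m)
  case 0
  have "continuous_on UNIV (C z)" "continuous_on UNIV (S z)"
    unfolding C_def[abs_def] S_def[abs_def] by (intro continuous_intros)+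
  then show ?case by simp
next
  case (Suc m)
  moreover have "C z differentiable_on UNIV" "S z differentiable_on UNIV"
    unfolding differentiable_on_def differentiable_def using has_derivative_C has_derivative_S by blast+
  ultimately show ?case
    unfolding C_space.simps partial_deriv_C partial_deriv_S by (auto intro!: C_space_intros)
qed

lemma Cper_C: "Cper p q m (C z)" and Cper_S: "Cper p q m (S z)"
  using C_S_smooth periodic_C periodic_S by (auto simp: Cper_def)

lemma sum_freq_sq: "(\<Sum>i\<in>UNIV. freq z $ i * freq z $ i) = (norm (freq z))\<^sup>2"
  by (simp add: power2_norm_eq_inner inner_vec_def)

lemma laplacian_C: "laplacian (C z) = (\<lambda>x. - (norm (freq z))\<^sup>2 * C z x)"
proof
  fix x
  have "partial_deriv i (partial_deriv i (C z)) x = - (freq z $ i * freq z $ i) * C z x" for i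
    unfolding partial_deriv_C
    by (subst partial_deriv_cmult) (simp_all add: partial_deriv_S Cper_differentiable[OF Cper_S])
  then show "laplacian (C z) x = - (norm (freq z))\<^sup>2 * C z x"
    unfolding laplacian_def sum_freq_sq[symmetric] by (simp add: sum_distrib_right sum_negf)
qed

lemma laplacian_S: "laplacian (S z) = (\<lambda>x. - (norm (freq z))\<^sup>2 * S z x)"
proof
  fix x
  have "partial_deriv i (partial_deriv i (S z)) x = - (freq z $ i * freq z $ i) * S z x" for i
    unfolding partial_deriv_S
    by (subst partial_deriv_cmult) (simp_all add: partial_deriv_C Cper_differentiable[OF Cper_C])
  then show "laplacian (S z) x = - (norm (freq z))\<^sup>2 * S z x"
    unfolding laplacian_def sum_freq_sq[symmetric] by (simp add: sum_distrib_right sum_negf)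
qed

text \<open>
  Each of these functions with \<open>z \<noteq> 0\<close> is, up to a nonzero factor, a partial derivative of another one.
\<close>

lemma cint_C: "cint (C z) = (if z = 0 then area else 0)"
proof (cases "z = 0")
  case True
  then show ?thesis by (simp add: C_def[abs_def])
next
  case False
  then obtain i where "freq z $ i \<noteq> 0" using freq_eq_0_iff[of z] by (auto simp: Finite_Cartesian_Product.vec_eq_iff)
  moreover have "freq z $ i * cint (C z) = 0"
    using cint_partial_deriv[OF Cper_S, of i z] by (simp only: partial_deriv_S cint_cmult)
  ultimately show ?thesis using False by simp
qed

lemma cint_S: "cint (S z) = 0"
proof (cases "z = 0")
  case True
  then show ?thesis using cint_const[of 0] by (simp add: S_def[abs_def])
next
  case False
  then obtain i where "freq z $ i \<noteq> 0" using freq_eq_0_iff[of z] by (auto simp: Finite_Cartesian_Product.vec_eq_iff)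
  moreover have "- (freq z $ i) * cint (S z) = 0"
    using cint_partial_deriv[OF Cper_C, of i z] by (simp only: partial_deriv_C cint_cmult)
  ultimately show ?thesis using False by simp
qed

lemma C_mult_C: "C z x * C y x = 1/2 * C (z - y) x + 1/2 * C (z + y) x"
  and S_mult_S: "S z x * S y x = 1/2 * C (z - y) x - 1/2 * C (z + y) x"
  and S_mult_C: "S z x * C y x = 1/2 * S (z + y) x + 1/2 * S (z - y) x"
  by (simp_all add: C_def S_def freq_add freq_diff inner_add_left inner_diff_left cos_add cos_diff sin_add sin_diff field_simps)

lemma cint_lincomb:
  "Cper p q m f \<Longrightarrow> Cper p q n g \<Longrightarrow> cint (\<lambda>x. a * f x + b * g x) = a * cint f + b * cint g"
  using cint_add[OF Cper_cmult Cper_cmult, of m f n g a b] by (simp only: cint_cmult)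

lemmas cint_lincomb0 = cint_lincomb[where m=0 and n=0]

lemma cint_C_C: "cint (\<lambda>x. C z x * C y x) = area / 2 * (of_bool (y = z) + of_bool (y = - z))"
proof -
  have "cint (\<lambda>x. C z x * C y x) = 1/2 * cint (C (z - y)) + 1/2 * cint (C (z + y))"
    unfolding C_mult_C by (rule cint_lincomb[OF Cper_C[of 0] Cper_C[of 0]])
  moreover have "z - y = 0 \<longleftrightarrow> y = z" "z + y = 0 \<longleftrightarrow> y = - z"
    by (auto simp: eq_neg_iff_add_eq_0 add.commute)
  ultimately show ?thesis by (simp only: cint_C) (simp split: if_splits)
qed

lemma cint_S_S: "cint (\<lambda>x. S z x * S y x) = area / 2 * (of_bool (y = z) - of_bool (y = - z))"
proof -
  have "cint (\<lambda>x. S z x * S y x) = 1/2 * cint (C (z - y)) + (-1/2) * cint (C (z + y))"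
    unfolding S_mult_S using cint_lincomb[OF Cper_C[of 0] Cper_C[of 0], of "1/2" _ "-1/2"] by simp
  moreover have "z - y = 0 \<longleftrightarrow> y = z" "z + y = 0 \<longleftrightarrow> y = - z"
    by (auto simp: eq_neg_iff_add_eq_0 add.commute)
  ultimately show ?thesis by (simp only: cint_C) (simp split: if_splits)
qed

lemma cint_S_C: "cint (\<lambda>x. S z x * C y x) = 0"
  unfolding S_mult_C cint_lincomb[OF Cper_S[of 0] Cper_S[of 0]] by (simp only: cint_S)

definition coefC :: "(real^2 \<Rightarrow> real) \<Rightarrow> int \<times> int \<Rightarrow> real" where "coefC g z = cint (\<lambda>x. g x * C z x)"
definition coefS :: "(real^2 \<Rightarrow> real) \<Rightarrow> int \<times> int \<Rightarrow> real" where "coefS g z = cint (\<lambda>x. g x * S z x)"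

lemma C_uminus: "C (- z) = C z" and S_uminus: "S (- z) = (\<lambda>x. - S z x)"
  by (auto simp: C_def S_def freq_minus)

lemma coefC_uminus: "coefC g (- z) = coefC g z" and coefS_uminus: "coefS g (- z) = - coefS g z"
  by (simp_all add: coefC_def coefS_def C_uminus S_uminus cint_minus)

text \<open>
  With \<open>T\<close> the sum of the terms \<open>a\<^sub>z C\<^sub>z + b\<^sub>z S\<^sub>z\<close>, expand \<open>0 \<le> \<integral> (area g - T)\<^sup>2\<close>. The terms for \<open>z\<close> and
  \<open>-z\<close> coincide, so in \<open>\<integral> T\<^sup>2\<close> every \<open>a\<^sub>z\<^sup>2 + b\<^sub>z\<^sup>2\<close> is counted at most twice, each time with the factor \<open>area/2\<close>.
\<close>

lemma bessel:
  assumes g: "Cper p q 0 g" and F: "finite F"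
  shows "(\<Sum>z\<in>F. (coefC g z)\<^sup>2 + (coefS g z)\<^sup>2) \<le> area * cint (\<lambda>x. (g x)\<^sup>2)"
proof -
  let ?a = "coefC g" and ?b = "coefS g"
  define B where "B = (\<Sum>z\<in>F. (?a z)\<^sup>2 + (?b z)\<^sup>2)"
  define t where "t z x = ?a z * C z x + ?b z * S z x" for z x
  define T where "T x = (\<Sum>z\<in>F. t z x)" for x
  have tC: "Cper p q 0 (t z)" for z
    unfolding t_def[abs_def] by (intro Cper_add Cper_cmult Cper_C Cper_S)
  have TC: "Cper p q 0 T" unfolding T_def[abs_def] by (intro Cper_sum tC)
  have gT: "cint (\<lambda>x. g x * T x) = B"
  proof -
    have "cint (\<lambda>x. g x * t z x) = (?a z)\<^sup>2 + (?b z)\<^sup>2" for z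
    proof -
      have "cint (\<lambda>x. g x * t z x) = cint (\<lambda>x. ?a z * (g x * C z x) + ?b z * (g x * S z x))"
        by (simp add: t_def algebra_simps)
      also have "\<dots> = cint (\<lambda>x. ?a z * (g x * C z x)) + cint (\<lambda>x. ?b z * (g x * S z x))"
        by (intro cint_add0 Cper_cmult Cper_mult g Cper_C Cper_S)
      finally show ?thesis by (simp add: cint_cmult coefC_def coefS_def power2_eq_square)
    qed
    then show ?thesis
      unfolding T_def sum_distrib_left B_def by (subst cint_sum[OF Cper_mult[OF g tC]]) simp
  qed
  have tt: "cint (\<lambda>x. t z x * t y x) = area / 2 * ((?a z)\<^sup>2 + (?b z)\<^sup>2) * (of_bool (y = z) + of_bool (y = - z))" for z y
  proof -
    have "cint (\<lambda>x. t z x * t y x) = cint (\<lambda>x. (?a z * ?a y) * (C z x * C y x) + (?b z * ?b y) * (S z x * S y x)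
        + ((?b z * ?a y) * (S z x * C y x) + (?a z * ?b y) * (S y x * C z x)))"
      by (simp add: t_def algebra_simps)
    also have "\<dots> = ?a z * ?a y * cint (\<lambda>x. C z x * C y x) + ?b z * ?b y * cint (\<lambda>x. S z x * S y x)
        + (?b z * ?a y * cint (\<lambda>x. S z x * C y x) + ?a z * ?b y * cint (\<lambda>x. S y x * C z x))"
      by (subst cint_add[of 0 _ 0] | intro Cper_add Cper_cmult Cper_mult Cper_C Cper_S | simp only: cint_cmult)+
    also have "\<dots> = area / 2 * ((?a z)\<^sup>2 + (?b z)\<^sup>2) * (of_bool (y = z) + of_bool (y = - z))"
    proof -
      have "?b z = 0" if "z = - z" using coefS_uminus[of g z] that by simp
      then have "?a z * ?a y * (of_bool (y = z) + of_bool (y = - z)) + ?b z * ?b y * (of_bool (y = z) - of_bool (y = - z))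
          = ((?a z)\<^sup>2 + (?b z)\<^sup>2) * (of_bool (y = z) + of_bool (y = - z))"
        by (cases "y = z"; cases "y = - z") (auto simp: coefC_uminus coefS_uminus power2_eq_square)
      then have "area / 2 * (?a z * ?a y * (of_bool (y = z) + of_bool (y = - z)) + ?b z * ?b y * (of_bool (y = z) - of_bool (y = - z)))
          = area / 2 * (((?a z)\<^sup>2 + (?b z)\<^sup>2) * (of_bool (y = z) + of_bool (y = - z)))"
        by (rule arg_cong)
      then show ?thesis
        unfolding cint_C_C cint_S_S cint_S_C by (simp only: distrib_left mult_ac)
    qed
    finally show ?thesis .
  qed
  have TT: "cint (\<lambda>x. (T x)\<^sup>2) \<le> area * B"
  proof -
    have "cint (\<lambda>x. (T x)\<^sup>2) = cint (\<lambda>x. \<Sum>z\<in>F. \<Sum>y\<in>F. t z x * t y x)"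
      by (simp only: T_def power2_eq_square sum_product)
    also have "\<dots> = (\<Sum>z\<in>F. \<Sum>y\<in>F. cint (\<lambda>x. t z x * t y x))"
      by (subst cint_sum[of _ 0] | intro Cper_sum Cper_mult tC | rule refl sum.cong)+
    also have "\<dots> = (\<Sum>z\<in>F. area / 2 * ((?a z)\<^sup>2 + (?b z)\<^sup>2) * (\<Sum>y\<in>F. of_bool (y = z) + of_bool (y = - z)))"
      by (simp only: tt sum_distrib_left)
    also have "\<dots> \<le> (\<Sum>z\<in>F. area / 2 * ((?a z)\<^sup>2 + (?b z)\<^sup>2) * 2)"
    proof (intro sum_mono mult_left_mono)
      fix z
      have "(\<Sum>y\<in>F. of_bool (y = w) :: real) \<le> 1" for w
        using F by (simp add: of_bool_def if_distrib sum.delta cong: if_cong)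
      from this[of z] this[of "- z"]
      show "(\<Sum>y\<in>F. of_bool (y = z) + of_bool (y = - z)) \<le> (2::real)"
        by (simp add: sum.distrib)
    qed (use area_pos in simp)
    also have "\<dots> = area * B" by (simp add: B_def sum_distrib_left)
    finally show ?thesis .
  qed
  have "0 \<le> cint (\<lambda>x. (area * g x - T x)\<^sup>2)" by (rule cint_nonneg) simp
  also have "\<dots> = cint (\<lambda>x. area\<^sup>2 * (g x)\<^sup>2 + (T x)\<^sup>2 - (2 * area) * (g x * T x))"
    by (simp add: power2_eq_square algebra_simps)
  also have "\<dots> = cint (\<lambda>x. area\<^sup>2 * (g x)\<^sup>2 + (T x)\<^sup>2) - cint (\<lambda>x. (2 * area) * (g x * T x))"
    by (intro cint_diff0 Cper_add Cper_cmult Cper_mult Cper_power g TC)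
  also have "cint (\<lambda>x. area\<^sup>2 * (g x)\<^sup>2 + (T x)\<^sup>2) = cint (\<lambda>x. area\<^sup>2 * (g x)\<^sup>2) + cint (\<lambda>x. (T x)\<^sup>2)"
    by (intro cint_add0 Cper_cmult Cper_power g TC)
  finally have "2 * area * B \<le> area\<^sup>2 * cint (\<lambda>x. (g x)\<^sup>2) + area * B"
    using TT unfolding cint_cmult gT by linarith
  then have "area * B \<le> area * (area * cint (\<lambda>x. (g x)\<^sup>2))"
    by (simp add: power2_eq_square algebra_simps)
  then show ?thesis using area_pos by (simp add: B_def)
qed

text \<open>
  Trigonometric polynomials; the generating rules make closure under products, and any property
  preserved by linear combinations, an induction.
\<close>

inductive trig :: "(real^2 \<Rightarrow> real) \<Rightarrow> bool" where
  trig_C: "trig (\<lambda>x. a * C z x)"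
| trig_S: "trig (\<lambda>x. a * S z x)"
| trig_add: "trig f \<Longrightarrow> trig g \<Longrightarrow> trig (\<lambda>x. f x + g x)"

lemma trig_cmult: "trig f \<Longrightarrow> trig (\<lambda>x. a * f x)"
proof (induction rule: trig.induct)
  case (trig_C b z)
  show ?case using trig.trig_C[of "a * b" z] by (simp add: mult.assoc)
next
  case (trig_S b z)
  show ?case using trig.trig_S[of "a * b" z] by (simp add: mult.assoc)
next
  case (trig_add f g)
  then show ?case using trig.trig_add by (auto simp: distrib_left)
qed

lemma trig_mult_C: "trig f \<Longrightarrow> trig (\<lambda>x. f x * C y x)"
proof (induction rule: trig.induct)
  case (trig_C a z)
  have "trig (\<lambda>x. a/2 * C (z - y) x + a/2 * C (z + y) x)" by (intro trig.intros)
  then show ?case by (simp add: mult.assoc[of a] C_mult_C distrib_left)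
next
  case (trig_S a z)
  have "trig (\<lambda>x. a/2 * S (z + y) x + a/2 * S (z - y) x)" by (intro trig.intros)
  then show ?case by (simp add: mult.assoc[of a] S_mult_C distrib_left)
next
  case (trig_add f g)
  then show ?case using trig.trig_add by (auto simp: distrib_right)
qed

lemma trig_mult_S: "trig f \<Longrightarrow> trig (\<lambda>x. f x * S y x)"
proof (induction rule: trig.induct)
  case (trig_C a z)
  have "trig (\<lambda>x. a/2 * S (y + z) x + a/2 * S (y - z) x)" by (intro trig.intros)
  moreover have "a * C z x * S y x = a/2 * S (y + z) x + a/2 * S (y - z) x" for x
    using S_mult_C[of y x z] by (simp add: mult.assoc mult.commute[of "C z x" "S y x"] distrib_left)
  ultimately show ?case by simp
next
  case (trig_S a z)
  have "trig (\<lambda>x. a/2 * C (z - y) x + (-a/2) * C (z + y) x)" by (intro trig.intros)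
  then show ?case by (simp add: mult.assoc[of a] S_mult_S right_diff_distrib)
next
  case (trig_add f g)
  then show ?case using trig.trig_add by (auto simp: distrib_right)
qed

lemma trig_mult: "trig g \<Longrightarrow> trig f \<Longrightarrow> trig (\<lambda>x. f x * g x)"
proof (induction arbitrary: f rule: trig.induct)
  case (trig_C a z)
  then show ?case using trig_mult_C[OF trig_cmult[of f a]] by (simp add: mult_ac)
next
  case (trig_S a z)
  then show ?case using trig_mult_S[OF trig_cmult[of f a]] by (simp add: mult_ac)
next
  case (trig_add g h)
  then show ?case using trig.trig_add[of "\<lambda>x. f x * g x" "\<lambda>x. f x * h x"] by (simp add: distrib_left)
qed

lemma trig_Cper: "trig f \<Longrightarrow> Cper p q 0 f"
  by (induction rule: trig.induct) (intro Cper_add Cper_cmult Cper_C Cper_S | assumption)+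

lemma trig_orthogonal:
  assumes "trig f" and h: "Cper p q 0 h" and 0: "\<And>z. coefC h z = 0" "\<And>z. coefS h z = 0"
  shows "cint (\<lambda>x. h x * f x) = 0"
  using assms(1)
proof (induction rule: trig.induct)
  case (trig_C a z)
  then show ?case using 0(1)[of z] cint_cmult[of a "\<lambda>x. h x * C z x"] by (simp add: coefC_def mult_ac)
next
  case (trig_S a z)
  then show ?case using 0(2)[of z] cint_cmult[of a "\<lambda>x. h x * S z x"] by (simp add: coefS_def mult_ac)
next
  case (trig_add f g)
  have "cint (\<lambda>x. h x * f x + h x * g x) = cint (\<lambda>x. h x * f x) + cint (\<lambda>x. h x * g x)"
    by (intro cint_add0 Cper_mult h trig_Cper trig_add)
  then show ?case using trig_add by (simp add: distrib_left)
qed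

definition torus_map :: "real^2 \<Rightarrow> complex \<times> complex" where
  "torus_map x = (cis (2 * pi * (P \<bullet> x)), cis (2 * pi * (Q \<bullet> x)))"

lemma cis_eq_imp_int:
  assumes "cis (2 * pi * s) = cis (2 * pi * t)"
  obtains n :: int where "s = t + of_int n"
proof -
  have "sin (2 * pi * s) = sin (2 * pi * t) \<and> cos (2 * pi * s) = cos (2 * pi * t)"
    using assms by (simp add: complex_eq_iff)
  then obtain n where n: "2 * pi * s = 2 * pi * t + 2 * pi * of_int n"
    unfolding sin_cos_eq_iff by blast
  have "2 * pi * s = 2 * pi * (t + of_int n)" using n by (simp only: distrib_left)
  then have "s = t + of_int n" by simp
  then show ?thesis by (rule that)
qed

lemma torus_map_eq:
  assumes "torus_map x = torus_map y" "periodic p q f"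
  shows "f x = f y"
proof -
  obtain m n :: int where "P \<bullet> x = P \<bullet> y + of_int m" "Q \<bullet> x = Q \<bullet> y + of_int n"
    using assms(1) by (auto simp: torus_map_def elim!: cis_eq_imp_int)
  then have "x = (P \<bullet> y + of_int m) *\<^sub>R p + (Q \<bullet> y + of_int n) *\<^sub>R q"
    using coords[of x] by simp
  also have "\<dots> = ((P \<bullet> y) *\<^sub>R p + (Q \<bullet> y) *\<^sub>R q) + of_int m *\<^sub>R p + of_int n *\<^sub>R q"
    by (simp add: algebra_simps)
  finally have "x = y + of_int m *\<^sub>R p + of_int n *\<^sub>R q" by (simp only: coords)
  then show ?thesis using periodic_int[OF assms(2)] by simp
qed

text \<open>
  A continuous periodic function factors through the embedding of the torus into \<open>\<complex>\<^sup>2\<close> as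
  a continuous function on the compact image. By Stone and Weierstrass it is approximated by functions on the image
  whose pullbacks are trigonometric polynomials; the coordinates separate points.
\<close>

lemma trig_dense:
  assumes h: "Cper p q m h" and e: "0 < e"
  obtains t where "trig t" "\<And>x. \<bar>h x - t x\<bar> < e"
proof -
  define K where "K = cball (0::real^2) (norm p + norm q)"
  define T where "T = range torus_map"
  have per: "periodic p q h" using h by (simp add: Cper_def)
  have cont: "continuous_on A torus_map" for A
    unfolding torus_map_def[abs_def] by (intro continuous_intros)
  have TK: "torus_map ` K = T"
  proof -
    have "torus_map x \<in> torus_map ` K" for x
    proof -
      define y where "y = x + of_int (-\<lfloor>P \<bullet> x\<rfloor>) *\<^sub>R p + of_int (-\<lfloor>Q \<bullet> x\<rfloor>) *\<^sub>R q"
      have y: "y \<in> cell p q"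
        by (simp add: y_def cell_eq inner_diff_right inner_add_right Pp Pq Qp Qq) linarith
      have "cis (2 * pi * (s - of_int n)) = cis (2 * pi * s)" for s n
        by (simp add: complex_eq_iff right_diff_distrib cos_diff sin_diff)
      then have "torus_map y = torus_map x"
        by (simp add: torus_map_def y_def inner_diff_right inner_add_right Pp Pq Qp Qq)
      with y have "y \<in> cell p q" "torus_map y = torus_map x" by auto
      then show ?thesis using cell_subset_cball by (auto simp: K_def intro: rev_image_eqI)
    qed
    then show ?thesis by (auto simp: T_def)
  qed
  have K: "compact K" by (simp add: K_def)
  \<comment> \<open>The function on the image of the torus; it is continuous because a continuous surjection of a
    compact space onto a Hausdorff space is a quotient map.\<close>
  define H where "H u = h (SOME x. torus_map x = u)" for u
  have H: "H (torus_map x) = h x" for x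
  proof -
    have "torus_map (SOME y. torus_map y = torus_map x) = torus_map x" by (rule someI) (rule refl)
    then show ?thesis unfolding H_def by (rule torus_map_eq[OF _ per])
  qed
  have contH: "continuous_on T H"
    unfolding continuous_openin_preimage_eq
  proof (intro allI impI)
    fix U :: "real set" assume U: "open U"
    have "openin (top_of_set K) (K \<inter> h -` U)"
      using Cper_continuous[OF h, of K] U by (simp add: continuous_openin_preimage_eq)
    also have "K \<inter> h -` U = K \<inter> torus_map -` (T \<inter> H -` U)"
      unfolding T_def vimage_def by (simp add: H)
    finally show "openin (top_of_set T) (T \<inter> H -` U)"
      by (subst (asm) Abstract_Topology_2.continuous_imp_quotient_map[OF cont TK K]) auto
  qed
  let ?R = "\<lambda>f. continuous_on T f \<and> trig (\<lambda>x. f (torus_map x))"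
  have "\<exists>g. ?R g \<and> (\<forall>x\<in>T. \<bar>H x - g x\<bar> < e)"
  proof (rule Stone_Weierstrass_HOL[where P="?R"])
    show "compact T" using compact_continuous_image[OF cont K] by (simp add: TK)
    show "?R (\<lambda>x. c)" for c
      using trig_C[of c 0] by (simp add: C_def)
    show "?R f \<and> ?R g \<Longrightarrow> ?R (\<lambda>x. f x + g x)" "?R f \<and> ?R g \<Longrightarrow> ?R (\<lambda>x. f x * g x)" for f g
      by (auto intro!: continuous_intros trig_add trig_mult)
    fix u v :: "complex \<times> complex" assume uv: "u \<in> T \<and> v \<in> T \<and> u \<noteq> v"
    have 1: "trig (\<lambda>x. Re (fst (torus_map x)))" "trig (\<lambda>x. Im (fst (torus_map x)))"
      using trig_C[of 1 "(1, 0)"] trig_S[of 1 "(1, 0)"] by (simp_all add: C_def S_def freq_def torus_map_def)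
    have 2: "trig (\<lambda>x. Re (snd (torus_map x)))" "trig (\<lambda>x. Im (snd (torus_map x)))"
      using trig_C[of 1 "(0, 1)"] trig_S[of 1 "(0, 1)"] by (simp_all add: C_def S_def freq_def torus_map_def)
    have R: "?R (\<lambda>u. Re (fst u))" "?R (\<lambda>u. Im (fst u))" "?R (\<lambda>u. Re (snd u))" "?R (\<lambda>u. Im (snd u))"
      using 1 2 by (auto intro!: continuous_intros)
    consider "Re (fst u) \<noteq> Re (fst v)" | "Im (fst u) \<noteq> Im (fst v)"
      | "Re (snd u) \<noteq> Re (snd v)" | "Im (snd u) \<noteq> Im (snd v)"
      using uv by (auto simp: prod_eq_iff complex_eq_iff)
    then show "\<exists>f. ?R f \<and> f u \<noteq> f v"
    proof cases
      case 1 with R(1) show ?thesis by (intro exI[of _ "\<lambda>u. Re (fst u)"]) simp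
    next
      case 2 with R(2) show ?thesis by (intro exI[of _ "\<lambda>u. Im (fst u)"]) simp
    next
      case 3 with R(3) show ?thesis by (intro exI[of _ "\<lambda>u. Re (snd u)"]) simp
    next
      case 4 with R(4) show ?thesis by (intro exI[of _ "\<lambda>u. Im (snd u)"]) simp
    qed
  qed (use contH e in auto)
  then obtain g where g: "trig (\<lambda>x. g (torus_map x))" "\<forall>x\<in>T. \<bar>H x - g x\<bar> < e" by blast
  have "\<bar>h x - g (torus_map x)\<bar> < e" for x
    using g(2)[rule_format, of "torus_map x"] by (simp add: T_def H)
  then show ?thesis using g(1) that by blast
qed

text \<open>
  If \<open>t\<close> is a trigonometric polynomial close to \<open>h\<close>, then \<open>\<integral> h\<^sup>2 = \<integral> h (h - t)\<close> is small.
\<close>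

lemma fourier_complete:
  assumes h: "Cper p q 0 h" and 0: "\<And>z. coefC h z = 0" "\<And>z. coefS h z = 0"
  shows "h x = 0"
proof (rule cint_definite[OF h])
  obtain B where B: "\<And>x. \<bar>h x\<bar> \<le> B" using Cper_bounded[OF h] by blast
  then have B0: "0 \<le> B" using abs_ge_zero order_trans by blast
  have le: "cint (\<lambda>x. (h x)\<^sup>2) \<le> 0 + e" if e: "0 < e" for e
  proof -
    define d where "d = e / (B * area + 1)"
    have pos: "0 < B * area + 1" using B0 area_pos by (simp add: add_nonneg_pos)
    have d: "0 < d" using e pos by (simp add: d_def)
    obtain t where t: "trig t" "\<And>x. \<bar>h x - t x\<bar> < d" using trig_dense[OF h d] by blast
    have tC: "Cper p q 0 t" by (rule trig_Cper[OF t(1)])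
    have "cint (\<lambda>x. (h x)\<^sup>2) = cint (\<lambda>x. h x * t x + h x * (h x - t x))"
      by (simp add: power2_eq_square algebra_simps)
    also have "\<dots> = cint (\<lambda>x. h x * t x) + cint (\<lambda>x. h x * (h x - t x))"
      by (intro cint_add0 Cper_mult Cper_diff h tC)
    also have "cint (\<lambda>x. h x * t x) = 0" by (rule trig_orthogonal[OF t(1) h 0])
    also have "cint (\<lambda>x. h x * (h x - t x)) \<le> cint (\<lambda>x. B * d)"
    proof (rule cint_mono[of 0 _ 0])
      fix x
      have "h x * (h x - t x) \<le> \<bar>h x\<bar> * \<bar>h x - t x\<bar>" by (simp flip: abs_mult)
      also have "\<dots> \<le> B * d" using B t(2)[of x] B0 by (intro mult_mono) auto
      finally show "h x * (h x - t x) \<le> B * d" .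
    qed (intro Cper_const Cper_mult Cper_diff h tC)+
    also have "\<dots> = (B * d) * area" by (rule cint_const)
    also have "\<dots> = e * (B * area / (B * area + 1))" by (simp add: d_def)
    also have "\<dots> \<le> e * 1" using e pos by (intro mult_left_mono) auto
    finally show ?thesis by simp
  qed
  show "cint (\<lambda>x. (h x)\<^sup>2) = 0"
    using field_le_epsilon[of _ 0, OF le] cint_nonneg[of "\<lambda>x. (h x)\<^sup>2"] by (intro antisym) auto
qed

end

section \<open>Trigonometric series\<close>

definition trig_series :: "(nat \<Rightarrow> real^2) \<Rightarrow> (nat \<Rightarrow> real) \<Rightarrow> (nat \<Rightarrow> real) \<Rightarrow> real^2 \<Rightarrow> real" where
  "trig_series \<kappa> \<alpha> \<beta> x = (\<Sum>j. \<alpha> j * cos (\<kappa> j \<bullet> x) + \<beta> j * sin (\<kappa> j \<bullet> x))"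

lemma abs_trig_term_le: "\<bar>a * cos t + b * sin t\<bar> \<le> \<bar>a\<bar> + \<bar>b :: real\<bar>"
proof -
  have "\<bar>a * cos t\<bar> \<le> \<bar>a\<bar> * 1" "\<bar>b * sin t\<bar> \<le> \<bar>b\<bar> * 1"
    unfolding abs_mult by (intro mult_left_mono; simp)+
  then show ?thesis by linarith
qed

lemma trig_series_sums:
  assumes "summable (\<lambda>j. \<bar>\<alpha> j\<bar> + \<bar>\<beta> j\<bar>)"
  shows "(\<lambda>j. \<alpha> j * cos (\<kappa> j \<bullet> x) + \<beta> j * sin (\<kappa> j \<bullet> x)) sums trig_series \<kappa> \<alpha> \<beta> x"
  unfolding trig_series_def
  by (intro summable_sums summable_comparison_test'[OF assms]) (simp add: abs_trig_term_le)

lemma trig_series_uniform: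
  assumes "summable (\<lambda>j. \<bar>\<alpha> j\<bar> + \<bar>\<beta> j\<bar>)"
  shows "uniform_limit UNIV (\<lambda>n x. \<Sum>j<n. \<alpha> j * cos (\<kappa> j \<bullet> x) + \<beta> j * sin (\<kappa> j \<bullet> x)) (trig_series \<kappa> \<alpha> \<beta>) sequentially"
  unfolding trig_series_def[abs_def]
  by (rule Weierstrass_m_test[OF _ assms]) (simp add: abs_trig_term_le)

lemma trig_series_continuous:
  assumes "summable (\<lambda>j. \<bar>\<alpha> j\<bar> + \<bar>\<beta> j\<bar>)"
  shows "continuous_on UNIV (trig_series \<kappa> \<alpha> \<beta>)"
  by (rule uniform_limit_theorem[OF _ trig_series_uniform[OF assms]])
     (intro always_eventually allI continuous_intros, simp)

text \<open>
  Termwise differentiation: the differentiated series converges uniformly, with a remainder bounded by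
  a tail of \<open>\<Sum> (\<bar>\<alpha>\<bar> + \<bar>\<beta>\<bar>) \<bar>\<kappa>\<bar>\<close>.
\<close>

lemma trig_series_has_derivative:
  assumes s0: "summable (\<lambda>j. \<bar>\<alpha> j\<bar> + \<bar>\<beta> j\<bar>)" and s1: "summable (\<lambda>j. (\<bar>\<alpha> j\<bar> + \<bar>\<beta> j\<bar>) * norm (\<kappa> j))"
  shows "(trig_series \<kappa> \<alpha> \<beta> has_derivative
           (\<lambda>h. \<Sum>i\<in>UNIV. trig_series \<kappa> (\<lambda>j. \<kappa> j $ i * \<beta> j) (\<lambda>j. - (\<kappa> j $ i) * \<alpha> j) x * h $ i)) (at x)"
proof -
  define f where "f j x = \<alpha> j * cos (\<kappa> j \<bullet> x) + \<beta> j * sin (\<kappa> j \<bullet> x)" for j x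
  define f' where "f' j x h = (\<beta> j * cos (\<kappa> j \<bullet> x) + (- \<alpha> j) * sin (\<kappa> j \<bullet> x)) * (\<kappa> j \<bullet> h)" for j x h
  let ?c = "\<lambda>j. (\<bar>\<alpha> j\<bar> + \<bar>\<beta> j\<bar>) * norm (\<kappa> j)"
  have bound: "\<bar>f' j x h\<bar> \<le> ?c j * norm h" for j x h
  proof -
    have "\<bar>f' j x h\<bar> \<le> (\<bar>\<beta> j\<bar> + \<bar>- \<alpha> j\<bar>) * (norm (\<kappa> j) * norm h)"
      unfolding f'_def abs_mult by (intro mult_mono abs_trig_term_le Cauchy_Schwarz_ineq2) auto
    then show ?thesis by (simp add: mult_ac add.commute)
  qed
  have sf': "summable (\<lambda>j. f' j x h)" for x h
    by (rule summable_comparison_test'[OF summable_mult2[OF s1]]) (use bound in auto)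
  have "\<exists>g. \<forall>x\<in>UNIV. (\<lambda>j. f j x) sums g x \<and> (g has_derivative (\<lambda>h. \<Sum>j. f' j x h)) (at x within UNIV)"
  proof (rule has_derivative_series[where x=0])
    show "(f j has_derivative f' j x) (at x within UNIV)" for j x
      unfolding f_def[abs_def] f'_def[abs_def]
      by (auto intro!: derivative_eq_intros simp: algebra_simps)
    show "(\<lambda>j. f j 0) sums trig_series \<kappa> \<alpha> \<beta> 0" unfolding f_def by (rule trig_series_sums[OF s0])
    fix e :: real assume "0 < e"
    then obtain N where N: "\<And>n. n \<ge> N \<Longrightarrow> norm (\<Sum>i. ?c (i + n)) < e"
      using suminf_exist_split[OF _ s1] by blast
    have "norm ((\<Sum>i<n. f' i x h) - (\<Sum>j. f' j x h)) \<le> e * norm h" if "n \<ge> N" for n x h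
    proof -
      have "norm ((\<Sum>i<n. f' i x h) - (\<Sum>j. f' j x h)) = norm (\<Sum>i. f' (i + n) x h)"
        by (subst suminf_split_initial_segment[OF sf', of x h n]) simp
      also have "\<dots> \<le> (\<Sum>i. ?c (i + n) * norm h)"
        using bound by (intro norm_suminf_le) (auto intro!: summable_mult2 summable_ignore_initial_segment s1)
      also have "\<dots> = (\<Sum>i. ?c (i + n)) * norm h"
        by (rule suminf_mult2[symmetric]) (rule summable_ignore_initial_segment[OF s1])
      also have "\<dots> \<le> e * norm h"
        using N[OF that] by (intro mult_right_mono) auto
      finally show ?thesis .
    qed
    then show "\<forall>\<^sub>F n in sequentially. \<forall>x\<in>UNIV. \<forall>h. norm ((\<Sum>i<n. f' i x h) - (\<Sum>j. f' j x h)) \<le> e * norm h"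
      unfolding eventually_sequentially by blast
  qed auto
  then obtain g where g: "\<And>x. (\<lambda>j. f j x) sums g x" "\<And>x. (g has_derivative (\<lambda>h. \<Sum>j. f' j x h)) (at x)" by auto
  have "g = trig_series \<kappa> \<alpha> \<beta>"
    using g(1) trig_series_sums[OF s0] by (intro ext) (auto simp: f_def intro: sums_unique2)
  moreover have "(\<Sum>j. f' j x h) = (\<Sum>i\<in>UNIV. trig_series \<kappa> (\<lambda>j. \<kappa> j $ i * \<beta> j) (\<lambda>j. - (\<kappa> j $ i) * \<alpha> j) x * h $ i)" for h
  proof -
    have s2: "summable (\<lambda>j. \<bar>\<kappa> j $ i * \<beta> j\<bar> + \<bar>- (\<kappa> j $ i) * \<alpha> j\<bar>)" for i
    proof (rule summable_comparison_test'[OF s1])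
      fix j
      have "\<bar>\<kappa> j $ i\<bar> * (\<bar>\<alpha> j\<bar> + \<bar>\<beta> j\<bar>) \<le> norm (\<kappa> j) * (\<bar>\<alpha> j\<bar> + \<bar>\<beta> j\<bar>)"
        by (intro mult_right_mono component_le_norm_cart) auto
      then show "norm (\<bar>\<kappa> j $ i * \<beta> j\<bar> + \<bar>- (\<kappa> j $ i) * \<alpha> j\<bar>) \<le> ?c j"
        by (simp add: abs_mult algebra_simps)
    qed
    have "(\<lambda>j. \<Sum>i\<in>UNIV. (\<kappa> j $ i * \<beta> j * cos (\<kappa> j \<bullet> x) + - (\<kappa> j $ i) * \<alpha> j * sin (\<kappa> j \<bullet> x)) * h $ i)
        sums (\<Sum>i\<in>UNIV. trig_series \<kappa> (\<lambda>j. \<kappa> j $ i * \<beta> j) (\<lambda>j. - (\<kappa> j $ i) * \<alpha> j) x * h $ i)"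
      by (intro sums_sum sums_mult2 trig_series_sums s2)
    moreover have "(\<Sum>i\<in>UNIV. (\<kappa> j $ i * \<beta> j * cos (\<kappa> j \<bullet> x) + - (\<kappa> j $ i) * \<alpha> j * sin (\<kappa> j \<bullet> x)) * h $ i) = f' j x h" for j
      unfolding f'_def inner_vec_def[of "\<kappa> j" h] sum_distrib_left
      by (rule sum.cong) (auto simp: algebra_simps)
    ultimately show ?thesis by (simp add: sums_iff)
  qed
  ultimately show ?thesis using g(2)[of x] by simp
qed

lemma summable_bound:
  fixes f g :: "nat \<Rightarrow> real"
  assumes "summable g" "\<And>j. \<bar>f j\<bar> \<le> c * g j"
  shows "summable f"
  by (rule summable_comparison_test'[OF summable_mult[OF assms(1)]]) (use assms(2) in auto)

text \<open>
  A partial derivative is a series of the same kind whose coefficients have grown by one power of the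
  frequency, so this is an induction on the order.
\<close>

lemma trig_series_C_space:
  assumes "summable (\<lambda>j. (\<bar>\<alpha> j\<bar> + \<bar>\<beta> j\<bar>) * (1 + norm (\<kappa> j)) ^ m)"
  shows "C_space m (trig_series \<kappa> \<alpha> \<beta>)"
    and "0 < m \<Longrightarrow> partial_deriv i (trig_series \<kappa> \<alpha> \<beta>) = trig_series \<kappa> (\<lambda>j. \<kappa> j $ i * \<beta> j) (\<lambda>j. - (\<kappa> j $ i) * \<alpha> j)"
proof -
  have main: "C_space m (trig_series \<kappa> \<alpha> \<beta>) \<and>
    (0 < m \<longrightarrow> (\<forall>i. partial_deriv i (trig_series \<kappa> \<alpha> \<beta>) = trig_series \<kappa> (\<lambda>j. \<kappa> j $ i * \<beta> j) (\<lambda>j. - (\<kappa> j $ i) * \<alpha> j)))"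
    using assms
  proof (induction m arbitrary: \<alpha> \<beta>)
    case 0
    then show ?case by (simp add: trig_series_continuous)
  next
    case (Suc m)
    let ?c = "\<lambda>j. (\<bar>\<alpha> j\<bar> + \<bar>\<beta> j\<bar>) * (1 + norm (\<kappa> j)) ^ Suc m"
    have ge1: "1 \<le> (1 + norm (\<kappa> j)) ^ l" for j l by (rule one_le_power) simp
    have s0: "summable (\<lambda>j. \<bar>\<alpha> j\<bar> + \<bar>\<beta> j\<bar>)"
    proof (rule summable_bound[OF Suc.prems, of _ 1])
      fix j
      have "(\<bar>\<alpha> j\<bar> + \<bar>\<beta> j\<bar>) * 1 \<le> ?c j" by (intro mult_left_mono ge1) auto
      then show "\<bar>\<bar>\<alpha> j\<bar> + \<bar>\<beta> j\<bar>\<bar> \<le> 1 * ?c j" by simp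
    qed
    have s1: "summable (\<lambda>j. (\<bar>\<alpha> j\<bar> + \<bar>\<beta> j\<bar>) * norm (\<kappa> j))"
    proof (rule summable_bound[OF Suc.prems, of _ 1])
      fix j
      have "norm (\<kappa> j) * 1 \<le> (1 + norm (\<kappa> j)) * (1 + norm (\<kappa> j)) ^ m"
        by (intro mult_mono ge1) auto
      then have "(\<bar>\<alpha> j\<bar> + \<bar>\<beta> j\<bar>) * norm (\<kappa> j) \<le> ?c j" by (intro mult_left_mono) auto
      then show "\<bar>(\<bar>\<alpha> j\<bar> + \<bar>\<beta> j\<bar>) * norm (\<kappa> j)\<bar> \<le> 1 * ?c j" by simp
    qed
    note D = trig_series_has_derivative[OF s0 s1]
    have P: "partial_deriv i (trig_series \<kappa> \<alpha> \<beta>) = trig_series \<kappa> (\<lambda>j. \<kappa> j $ i * \<beta> j) (\<lambda>j. - (\<kappa> j $ i) * \<alpha> j)" for i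
      by (rule ext, rule partial_deriv_eqI[OF D])
    have "C_space m (trig_series \<kappa> (\<lambda>j. \<kappa> j $ i * \<beta> j) (\<lambda>j. - (\<kappa> j $ i) * \<alpha> j))" for i
    proof (rule Suc.IH[THEN conjunct1], rule summable_bound[OF Suc.prems, of _ 1])
      fix j
      have "\<bar>\<kappa> j $ i\<bar> \<le> 1 + norm (\<kappa> j)" using component_le_norm_cart[of "\<kappa> j" i] by simp
      then have "\<bar>\<kappa> j $ i\<bar> * ((\<bar>\<alpha> j\<bar> + \<bar>\<beta> j\<bar>) * (1 + norm (\<kappa> j)) ^ m) \<le> (1 + norm (\<kappa> j)) * ((\<bar>\<alpha> j\<bar> + \<bar>\<beta> j\<bar>) * (1 + norm (\<kappa> j)) ^ m)"
        by (intro mult_right_mono) auto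
      also have "\<bar>\<kappa> j $ i\<bar> * ((\<bar>\<alpha> j\<bar> + \<bar>\<beta> j\<bar>) * (1 + norm (\<kappa> j)) ^ m)
          = (\<bar>\<kappa> j $ i * \<beta> j\<bar> + \<bar>- (\<kappa> j $ i) * \<alpha> j\<bar>) * (1 + norm (\<kappa> j)) ^ m"
        by (simp add: abs_mult algebra_simps)
      finally show "\<bar>(\<bar>\<kappa> j $ i * \<beta> j\<bar> + \<bar>- (\<kappa> j $ i) * \<alpha> j\<bar>) * (1 + norm (\<kappa> j)) ^ m\<bar> \<le> 1 * ?c j"
        by (simp add: mult_ac)
    qed
    moreover have "trig_series \<kappa> \<alpha> \<beta> differentiable_on UNIV"
      unfolding differentiable_on_def differentiable_def using D by blast
    ultimately show ?case by (simp add: P)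
  qed
  then show "C_space m (trig_series \<kappa> \<alpha> \<beta>)" by blast
  show "0 < m \<Longrightarrow> partial_deriv i (trig_series \<kappa> \<alpha> \<beta>) = trig_series \<kappa> (\<lambda>j. \<kappa> j $ i * \<beta> j) (\<lambda>j. - (\<kappa> j $ i) * \<alpha> j)"
    using main by blast
qed

lemma laplacian_trig_series:
  assumes s: "summable (\<lambda>j. (\<bar>\<alpha> j\<bar> + \<bar>\<beta> j\<bar>) * (1 + norm (\<kappa> j))\<^sup>2)"
  shows "laplacian (trig_series \<kappa> \<alpha> \<beta>) = trig_series \<kappa> (\<lambda>j. - (norm (\<kappa> j))\<^sup>2 * \<alpha> j) (\<lambda>j. - (norm (\<kappa> j))\<^sup>2 * \<beta> j)"
proof
  fix x
  have le: "\<bar>\<kappa> j $ i\<bar> \<le> 1 + norm (\<kappa> j)" for i j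
    using component_le_norm_cart[of "\<kappa> j" i] by simp
  have s1: "summable (\<lambda>j. (\<bar>\<kappa> j $ i * \<beta> j\<bar> + \<bar>- (\<kappa> j $ i) * \<alpha> j\<bar>) * (1 + norm (\<kappa> j)) ^ 1)" for i
  proof (rule summable_bound[OF s, of _ 1])
    fix j
    have "\<bar>\<kappa> j $ i\<bar> * ((\<bar>\<alpha> j\<bar> + \<bar>\<beta> j\<bar>) * (1 + norm (\<kappa> j))) \<le> (1 + norm (\<kappa> j)) * ((\<bar>\<alpha> j\<bar> + \<bar>\<beta> j\<bar>) * (1 + norm (\<kappa> j)))"
      by (intro mult_right_mono le) auto
    also have "\<bar>\<kappa> j $ i\<bar> * ((\<bar>\<alpha> j\<bar> + \<bar>\<beta> j\<bar>) * (1 + norm (\<kappa> j)))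
        = (\<bar>\<kappa> j $ i * \<beta> j\<bar> + \<bar>- (\<kappa> j $ i) * \<alpha> j\<bar>) * (1 + norm (\<kappa> j)) ^ 1"
      by (simp add: abs_mult algebra_simps)
    finally show "\<bar>(\<bar>\<kappa> j $ i * \<beta> j\<bar> + \<bar>- (\<kappa> j $ i) * \<alpha> j\<bar>) * (1 + norm (\<kappa> j)) ^ 1\<bar>
        \<le> 1 * ((\<bar>\<alpha> j\<bar> + \<bar>\<beta> j\<bar>) * (1 + norm (\<kappa> j))\<^sup>2)"
      by (simp add: mult_ac power2_eq_square)
  qed
  have s2: "summable (\<lambda>j. \<bar>\<kappa> j $ i * (- (\<kappa> j $ i) * \<alpha> j)\<bar> + \<bar>- (\<kappa> j $ i) * (\<kappa> j $ i * \<beta> j)\<bar>)" for i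
  proof (rule summable_bound[OF s1[of i], of _ 1])
    fix j
    have "\<bar>\<kappa> j $ i\<bar> * (\<bar>\<kappa> j $ i * \<beta> j\<bar> + \<bar>- (\<kappa> j $ i) * \<alpha> j\<bar>) \<le> (1 + norm (\<kappa> j)) * (\<bar>\<kappa> j $ i * \<beta> j\<bar> + \<bar>- (\<kappa> j $ i) * \<alpha> j\<bar>)"
      by (intro mult_right_mono le) auto
    then show "\<bar>\<bar>\<kappa> j $ i * (- (\<kappa> j $ i) * \<alpha> j)\<bar> + \<bar>- (\<kappa> j $ i) * (\<kappa> j $ i * \<beta> j)\<bar>\<bar>
        \<le> 1 * ((\<bar>\<kappa> j $ i * \<beta> j\<bar> + \<bar>- (\<kappa> j $ i) * \<alpha> j\<bar>) * (1 + norm (\<kappa> j)) ^ 1)"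
      by (simp add: abs_mult algebra_simps)
  qed
  have "partial_deriv i (partial_deriv i (trig_series \<kappa> \<alpha> \<beta>)) =
      trig_series \<kappa> (\<lambda>j. \<kappa> j $ i * (- (\<kappa> j $ i) * \<alpha> j)) (\<lambda>j. - (\<kappa> j $ i) * (\<kappa> j $ i * \<beta> j))" for i
    using trig_series_C_space(2)[OF s, of i] trig_series_C_space(2)[OF s1[of i], of i] by simp
  then have "laplacian (trig_series \<kappa> \<alpha> \<beta>) x =
      (\<Sum>i\<in>UNIV. trig_series \<kappa> (\<lambda>j. \<kappa> j $ i * (- (\<kappa> j $ i) * \<alpha> j)) (\<lambda>j. - (\<kappa> j $ i) * (\<kappa> j $ i * \<beta> j)) x)"
    by (simp add: laplacian_def)
  moreover have "(\<lambda>j. \<Sum>i\<in>UNIV. \<kappa> j $ i * (- (\<kappa> j $ i) * \<alpha> j) * cos (\<kappa> j \<bullet> x) + - (\<kappa> j $ i) * (\<kappa> j $ i * \<beta> j) * sin (\<kappa> j \<bullet> x))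
    sums (\<Sum>i\<in>UNIV. trig_series \<kappa> (\<lambda>j. \<kappa> j $ i * (- (\<kappa> j $ i) * \<alpha> j)) (\<lambda>j. - (\<kappa> j $ i) * (\<kappa> j $ i * \<beta> j)) x)"
    by (intro sums_sum trig_series_sums s2)
  moreover have "(\<Sum>i\<in>UNIV. \<kappa> j $ i * (- (\<kappa> j $ i) * \<alpha> j) * cos (\<kappa> j \<bullet> x) + - (\<kappa> j $ i) * (\<kappa> j $ i * \<beta> j) * sin (\<kappa> j \<bullet> x))
     = - (norm (\<kappa> j))\<^sup>2 * \<alpha> j * cos (\<kappa> j \<bullet> x) + - (norm (\<kappa> j))\<^sup>2 * \<beta> j * sin (\<kappa> j \<bullet> x)" for j
  proof -
    have "(\<Sum>i\<in>UNIV. \<kappa> j $ i * (- (\<kappa> j $ i) * \<alpha> j) * cos (\<kappa> j \<bullet> x) + - (\<kappa> j $ i) * (\<kappa> j $ i * \<beta> j) * sin (\<kappa> j \<bullet> x))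
       = (\<Sum>i\<in>UNIV. \<kappa> j $ i * \<kappa> j $ i) * (- \<alpha> j * cos (\<kappa> j \<bullet> x) - \<beta> j * sin (\<kappa> j \<bullet> x))"
      unfolding sum_distrib_right by (rule sum.cong) (auto simp: algebra_simps)
    also have "(\<Sum>i\<in>UNIV. \<kappa> j $ i * \<kappa> j $ i) = (norm (\<kappa> j))\<^sup>2"
      by (simp add: power2_norm_eq_inner inner_vec_def)
    finally show ?thesis by (simp add: algebra_simps)
  qed
  ultimately show "laplacian (trig_series \<kappa> \<alpha> \<beta>) x = trig_series \<kappa> (\<lambda>j. - (norm (\<kappa> j))\<^sup>2 * \<alpha> j) (\<lambda>j. - (norm (\<kappa> j))\<^sup>2 * \<beta> j) x"
    by (simp add: trig_series_def sums_iff)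
qed

text \<open>
  The bound is stated with a correction term so that it can be proved by induction; the
  offset \<open>1/2\<close> is what makes the increments of the correction large enough.
\<close>

lemma sum_inverse_squares_int: "(\<Sum>m\<in>{-int N..int N}. 1 / (1 + (real_of_int m)\<^sup>2)) \<le> 5 - 2 / (real N + 1/2)"
proof (induction N)
  case (Suc N)
  let ?f = "\<lambda>m. 1 / (1 + (real_of_int m)\<^sup>2)"
  have I: "{-int (Suc N)..int (Suc N)} = insert (-int (Suc N)) (insert (int (Suc N)) {-int N..int N})" by auto
  have "sum ?f {-int (Suc N)..int (Suc N)} = ?f (-int (Suc N)) + (?f (int (Suc N)) + sum ?f {-int N..int N})"
    unfolding I by (subst sum.insert, simp, simp, subst sum.insert) simp_all
  also have "?f (-int (Suc N)) = 1 / (1 + (real N + 1)\<^sup>2)" by (simp add: power2_eq_square algebra_simps)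
  also have "?f (int (Suc N)) = 1 / (1 + (real N + 1)\<^sup>2)" by (simp add: add.commute)
  finally have "sum ?f {-int (Suc N)..int (Suc N)} = 2 / (1 + (real N + 1)\<^sup>2) + sum ?f {-int N..int N}"
    by simp
  also have "2 / (1 + (real N + 1)\<^sup>2) \<le> 2 / (real N + 1/2) - 2 / (real (Suc N) + 1/2)"
  proof -
    have "2 / (real N + 1/2) - 2 / (real (Suc N) + 1/2) = 2 / ((real N + 1/2) * (real N + 3/2))"
      by (simp add: field_simps)
    moreover have "2 / (1 + (real N + 1)\<^sup>2) \<le> 2 / ((real N + 1/2) * (real N + 3/2))"
    proof (rule frac_le)
      show "0 < (real N + 1/2) * (real N + 3/2)" by (intro mult_pos_pos) auto
      show "(real N + 1/2) * (real N + 3/2) \<le> 1 + (real N + 1)\<^sup>2" by (simp add: power2_eq_square algebra_simps)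
    qed auto
    ultimately show ?thesis by simp
  qed
  finally show ?case using Suc.IH by simp
qed simp

context lattice
begin

text \<open>
  The scalar products of a frequency with the periods are \<open>2\<pi>\<close> times its integer coordinates.
\<close>

lemma freq_lower:
  obtains K where "0 < K" "\<And>z. (of_int (fst z))\<^sup>2 + (of_int (snd z))\<^sup>2 \<le> K * (norm (freq z))\<^sup>2"
proof
  let ?K = "((norm p)\<^sup>2 + (norm q)\<^sup>2) / (4 * pi\<^sup>2)"
  have "p \<noteq> 0" using Pp by auto
  then show "0 < ?K" by (intro divide_pos_pos add_pos_nonneg) auto
  fix z
  have "(freq z \<bullet> p)\<^sup>2 \<le> (norm (freq z) * norm p)\<^sup>2" "(freq z \<bullet> q)\<^sup>2 \<le> (norm (freq z) * norm q)\<^sup>2"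
    using Cauchy_Schwarz_ineq2[of "freq z" p] Cauchy_Schwarz_ineq2[of "freq z" q]
    by (auto simp: abs_le_square_iff[symmetric])
  then have "4 * pi\<^sup>2 * ((of_int (fst z))\<^sup>2 + (of_int (snd z))\<^sup>2) \<le> ((norm p)\<^sup>2 + (norm q)\<^sup>2) * (norm (freq z))\<^sup>2"
    by (simp add: freq_p freq_q power_mult_distrib algebra_simps)
  then show "(of_int (fst z))\<^sup>2 + (of_int (snd z))\<^sup>2 \<le> ?K * (norm (freq z))\<^sup>2"
    by (simp add: field_simps)
qed

text \<open>
  Up to a factor, \<open>\<bar>\<kappa>\<bar>\<^sup>-\<^sup>4\<close> is at most \<open>(m\<^sup>2 + n\<^sup>2)\<^sup>-\<^sup>2\<close>, hence at most the product of \<open>(1 + m\<^sup>2)\<^sup>-\<^sup>1\<close> and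
  \<open>(1 + n\<^sup>2)\<^sup>-\<^sup>1\<close>, which is summed over a square. At frequency zero the term is \<open>1 / 0 = 0\<close>.
\<close>

lemma freq_summable:
  assumes e: "inj (e :: nat \<Rightarrow> int \<times> int)"
  shows "summable (\<lambda>j. 1 / norm (freq (e j)) ^ 4)"
proof -
  obtain K where K: "0 < K" "\<And>z. (of_int (fst z))\<^sup>2 + (of_int (snd z))\<^sup>2 \<le> K * (norm (freq z))\<^sup>2"
    using freq_lower by blast
  define u where "u m = 1 / (1 + (real_of_int m)\<^sup>2)" for m
  have u0: "0 \<le> u m" for m by (simp add: u_def)
  have le: "1 / norm (freq z) ^ 4 \<le> 9/4 * K\<^sup>2 * (u (fst z) * u (snd z))" for z
  proof (cases "z = 0")
    case True
    then show ?thesis using u0 by simp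
  next
    case False
    define a b where "a = (real_of_int (fst z))\<^sup>2" and "b = (real_of_int (snd z))\<^sup>2"
    have "1 \<le> (fst z)\<^sup>2 + (snd z)\<^sup>2"
      using False by (smt (verit) prod_eq_iff zero_less_power2 zero_prod_def fst_conv snd_conv zero_le_power2)
    then have ab: "1 \<le> a + b" unfolding a_def b_def by (metis of_int_1_le_iff of_int_add of_int_power)
    have nn: "0 \<le> a" "0 \<le> b" by (simp_all add: a_def b_def)
    define n2 where "n2 = (norm (freq z))\<^sup>2"
    have n2: "0 < n2" "a + b \<le> K * n2"
      using False K(2)[of z] by (simp_all add: n2_def freq_eq_0_iff a_def b_def)
    have "(1 + a) * (1 + b) \<le> 9/4 * (a + b)\<^sup>2"
    proof -
      have "4 * (a * b) \<le> (a + b)\<^sup>2" using zero_le_power2[of "a - b"] by (simp add: power2_eq_square algebra_simps)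
      moreover have "1 \<le> (a + b)\<^sup>2" "a + b \<le> (a + b)\<^sup>2"
        using ab mult_mono[OF ab ab] mult_right_mono[OF ab, of "a + b"] by (auto simp: power2_eq_square)
      ultimately show ?thesis by (simp add: algebra_simps)
    qed
    also have "(a + b)\<^sup>2 \<le> (K * n2)\<^sup>2" using n2 nn by (intro power_mono) auto
    finally have "(1 + a) * (1 + b) \<le> 9/4 * K\<^sup>2 * n2\<^sup>2" by (simp add: power_mult_distrib)
    moreover have D: "0 < (1 + a) * (1 + b)" using nn by (intro mult_pos_pos) auto
    ultimately have "(1 + a) * (1 + b) / ((1 + a) * (1 + b) * n2\<^sup>2) \<le> 9/4 * K\<^sup>2 * n2\<^sup>2 / ((1 + a) * (1 + b) * n2\<^sup>2)"
      using n2 by (intro divide_right_mono) auto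
    moreover have "d / (d * n2\<^sup>2) = 1 / n2\<^sup>2" if "0 < d" for d :: real using that by simp
    note this[OF D]
    moreover have "9/4 * K\<^sup>2 * n2\<^sup>2 / ((1 + a) * (1 + b) * n2\<^sup>2) = 9/4 * K\<^sup>2 * (1 / ((1 + a) * (1 + b)))"
      using n2 by simp
    ultimately have "1 / n2\<^sup>2 \<le> 9/4 * K\<^sup>2 * (1 / ((1 + a) * (1 + b)))" by simp
    then show ?thesis by (simp add: u_def a_def b_def n2_def)
  qed
  show ?thesis
  proof (rule summableI_nonneg_bounded)
    fix n
    have fin: "finite (e ` {..<n})" by simp
    define N where "N = nat (Max (insert 0 ((\<lambda>z. max \<bar>fst z\<bar> \<bar>snd z\<bar>) ` e ` {..<n})))"
    have sub: "e ` {..<n} \<subseteq> {-int N..int N} \<times> {-int N..int N}"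
    proof
      fix z assume "z \<in> e ` {..<n}"
      then have "max \<bar>fst z\<bar> \<bar>snd z\<bar> \<le> Max (insert 0 ((\<lambda>z. max \<bar>fst z\<bar> \<bar>snd z\<bar>) ` e ` {..<n}))"
        using fin by (intro Max_ge) auto
      then have "\<bar>fst z\<bar> \<le> int N" "\<bar>snd z\<bar> \<le> int N" by (auto simp: N_def)
      then show "z \<in> {-int N..int N} \<times> {-int N..int N}" by (cases z) auto
    qed
    let ?I = "{-int N..int N}"
    have "(\<Sum>j<n. 1 / norm (freq (e j)) ^ 4) = (\<Sum>z\<in>e ` {..<n}. 1 / norm (freq z) ^ 4)"
      using e by (simp add: sum.reindex inj_on_subset[OF e] inj_on_def)
    also have "\<dots> \<le> (\<Sum>z\<in>e ` {..<n}. 9/4 * K\<^sup>2 * (u (fst z) * u (snd z)))"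
      by (intro sum_mono le)
    also have "\<dots> \<le> (\<Sum>z\<in>?I \<times> ?I. 9/4 * K\<^sup>2 * (u (fst z) * u (snd z)))"
      using sub u0 by (intro sum_mono2) (auto intro!: mult_nonneg_nonneg)
    also have "\<dots> = 9/4 * K\<^sup>2 * ((\<Sum>m\<in>?I. u m) * (\<Sum>m\<in>?I. u m))"
      unfolding sum_product sum.cartesian_product case_prod_unfold by (rule sum_distrib_left[symmetric])
    also have "\<dots> \<le> 9/4 * K\<^sup>2 * (5 * 5)"
    proof -
      have "(\<Sum>m\<in>?I. u m) \<le> 5"
        using sum_inverse_squares_int[of N] by (simp add: u_def) (smt (verit) divide_nonneg_nonneg of_nat_0_le_iff)
      then show ?thesis by (intro mult_left_mono mult_mono sum_nonneg u0) auto
    qed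
    finally show "(\<Sum>j<n. 1 / norm (freq (e j)) ^ 4) \<le> 9/4 * K\<^sup>2 * (5 * 5)" .
  qed simp
qed

lemma cint_uniform_limit:
  assumes F: "\<And>n. Cper p q 0 (F n)" and G: "Cper p q 0 G" and H: "Cper p q 0 H" "\<And>x. \<bar>H x\<bar> \<le> 1"
    and lim: "uniform_limit UNIV F G sequentially"
  shows "(\<lambda>n. cint (\<lambda>x. F n x * H x)) \<longlonglongrightarrow> cint (\<lambda>x. G x * H x)"
proof (rule metric_LIMSEQ_I)
  fix r :: real assume r: "0 < r"
  define e where "e = r / (2 * area)"
  have e: "0 < e" using r area_pos by (simp add: e_def)
  obtain N where N: "\<And>n x. n \<ge> N \<Longrightarrow> dist (F n x) (G x) < e"
    using lim e unfolding uniform_limit_iff eventually_sequentially by blast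
  have "dist (cint (\<lambda>x. F n x * H x)) (cint (\<lambda>x. G x * H x)) < r" if n: "n \<ge> N" for n
  proof -
    have le: "\<bar>(F n x - G x) * H x\<bar> \<le> e" for x
    proof -
      have "\<bar>(F n x - G x) * H x\<bar> \<le> e * 1"
        unfolding abs_mult using N[OF n, of x] H(2)[of x] e by (intro mult_mono) (auto simp: dist_real_def)
      then show ?thesis by simp
    qed
    have C: "Cper p q 0 (\<lambda>x. (F n x - G x) * H x)" by (intro Cper_mult Cper_diff F G H)
    have "cint (\<lambda>x. F n x * H x) - cint (\<lambda>x. G x * H x) = cint (\<lambda>x. (F n x - G x) * H x)"
      using cint_diff[OF Cper_mult[OF F H(1)] Cper_mult[OF G H(1)], of n] by (simp add: left_diff_distrib)
    moreover have "cint (\<lambda>x. (F n x - G x) * H x) \<le> cint (\<lambda>x. e)"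
      using le by (intro cint_mono[OF C Cper_const[of p q 0]]) (auto simp: abs_le_iff)
    moreover have "cint (\<lambda>x. - e) \<le> cint (\<lambda>x. (F n x - G x) * H x)"
      using le by (intro cint_mono[OF Cper_const[of p q 0] C]) (auto simp: abs_le_iff minus_le_iff)
    moreover have "cint (\<lambda>x. e) = r / 2" "cint (\<lambda>x. - e) = - (r / 2)"
      using area_pos unfolding cint_const[of e] cint_const[of "- e"] by (simp_all add: e_def)
    ultimately show ?thesis using r by (simp add: dist_real_def abs_less_iff)
  qed
  then show "\<exists>N. \<forall>n\<ge>N. dist (cint (\<lambda>x. F n x * H x)) (cint (\<lambda>x. G x * H x)) < r" by blast
qed

lemma Cper_trig_series:
  assumes "summable (\<lambda>j. (\<bar>\<alpha> j\<bar> + \<bar>\<beta> j\<bar>) * (1 + norm (freq (e j))) ^ m)"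
  shows "Cper p q m (trig_series (\<lambda>j. freq (e j)) \<alpha> \<beta>)"
proof -
  have "periodic p q (trig_series (\<lambda>j. freq (e j)) \<alpha> \<beta>)"
    using periodic_C periodic_S by (simp add: periodic_def trig_series_def C_def S_def)
  then show ?thesis using trig_series_C_space(1)[OF assms] by (simp add: Cper_def)
qed

text \<open>
  In an enumeration of all frequencies the mode \<open>z\<close> is met twice, as \<open>z\<close> and as \<open>-z\<close>, each time with
  half of its coefficient; for \<open>z = 0\<close> both halves come from the same term.
\<close>

lemma sums_coef:
  assumes e: "bij (e :: nat \<Rightarrow> int \<times> int)"
    and f: "\<And>j. f j = c / 2 * of_bool (z = e j) + c / 2 * of_bool (z = - e j)"
  shows "f sums (c :: real)"
proof -
  have *: "(\<lambda>j. c / 2 * of_bool (y = e j)) sums (c / 2)" for y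
  proof -
    have "(\<lambda>j. if j = inv_into UNIV e y then c / 2 else 0) sums (c / 2)" by (rule sums_single)
    moreover have "j = inv_into UNIV e y \<longleftrightarrow> y = e j" for j
      using e by (metis bij_inv_eq_iff)
    ultimately show ?thesis by (simp add: of_bool_def if_distrib cong: if_cong)
  qed
  have "z = - e j \<longleftrightarrow> - z = e j" for j using equation_minus_iff[of z "e j"] by auto
  then show ?thesis using sums_add[OF *[of z] *[of "- z"]] by (simp add: f[abs_def])
qed

text \<open>
  The series converges uniformly, so its Fourier coefficients are computed termwise and agree with
  those of \<open>v\<close>; completeness identifies the two functions.
\<close>

lemma fourier_series:
  assumes e: "bij (e :: nat \<Rightarrow> int \<times> int)" and v: "Cper p q 0 v"
    and s: "summable (\<lambda>j. \<bar>coefC v (e j)\<bar> + \<bar>coefS v (e j)\<bar>)"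
  shows "trig_series (\<lambda>j. freq (e j)) (\<lambda>j. coefC v (e j) / area) (\<lambda>j. coefS v (e j) / area) = v"
proof
  fix x
  let ?a = "\<lambda>j. coefC v (e j)" and ?b = "\<lambda>j. coefS v (e j)"
  define V where "V = trig_series (\<lambda>j. freq (e j)) (\<lambda>j. ?a j / area) (\<lambda>j. ?b j / area)"
  define Vn where "Vn n x = (\<Sum>j<n. ?a j / area * C (e j) x + ?b j / area * S (e j) x)" for n x
  have s': "summable (\<lambda>j. \<bar>?a j / area\<bar> + \<bar>?b j / area\<bar>)"
    by (rule summable_bound[OF s, of _ "1 / area"]) (use area_pos in \<open>simp add: add_divide_distrib\<close>)
  have V: "Cper p q 0 V" unfolding V_def using s' by (intro Cper_trig_series) simp
  have lim: "uniform_limit UNIV Vn V sequentially"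
    unfolding V_def Vn_def[abs_def] C_def S_def by (rule trig_series_uniform[OF s'])
  have t: "Cper p q 0 (\<lambda>x. ?a j / area * C (e j) x + ?b j / area * S (e j) x)" for j
    by (intro Cper_add Cper_cmult Cper_C Cper_S)
  have VnC: "Cper p q 0 (Vn n)" for n unfolding Vn_def[abs_def] by (intro Cper_sum t)
  have VnH: "cint (\<lambda>x. Vn n x * H x) = (\<Sum>j<n. ?a j / area * cint (\<lambda>x. C (e j) x * H x) + ?b j / area * cint (\<lambda>x. S (e j) x * H x))"
    if H: "Cper p q 0 H" for n H
  proof -
    have "cint (\<lambda>x. Vn n x * H x) = (\<Sum>j<n. cint (\<lambda>x. (?a j / area * C (e j) x + ?b j / area * S (e j) x) * H x))"
      unfolding Vn_def sum_distrib_right by (rule cint_sum0) (intro Cper_mult t H)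
    also have "\<dots> = (\<Sum>j<n. cint (\<lambda>x. ?a j / area * (C (e j) x * H x) + ?b j / area * (S (e j) x * H x)))"
      by (simp add: algebra_simps)
    also have "\<dots> = (\<Sum>j<n. ?a j / area * cint (\<lambda>x. C (e j) x * H x) + ?b j / area * cint (\<lambda>x. S (e j) x * H x))"
      by (intro sum.cong refl cint_lincomb0 Cper_mult Cper_C Cper_S H)
    finally show ?thesis .
  qed
  have cC: "coefC V z = coefC v z" for z
  proof -
    have "(\<lambda>j. ?a j / area * cint (\<lambda>x. C (e j) x * C z x) + ?b j / area * cint (\<lambda>x. S (e j) x * C z x)) sums coefC v z"
    proof (rule sums_coef[OF e])
      fix j
      have "?a j * of_bool (z = e j) = coefC v z * of_bool (z = e j)"
        "?a j * of_bool (z = - e j) = coefC v z * of_bool (z = - e j)"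
        by (auto simp: of_bool_def coefC_uminus)
      moreover have "?a j / area * (area / 2 * (X + Y)) + ?b j / area * 0 = (?a j * X + ?a j * Y) / 2" for X Y
        using area_pos by (simp add: distrib_left)
      ultimately show "?a j / area * cint (\<lambda>x. C (e j) x * C z x) + ?b j / area * cint (\<lambda>x. S (e j) x * C z x)
          = coefC v z / 2 * of_bool (z = e j) + coefC v z / 2 * of_bool (z = - e j)"
        unfolding cint_C_C cint_S_C by simp
    qed
    moreover have "(\<lambda>n. cint (\<lambda>x. Vn n x * C z x)) \<longlonglongrightarrow> cint (\<lambda>x. V x * C z x)"
      by (rule cint_uniform_limit[OF VnC V Cper_C _ lim]) (simp add: C_def)
    ultimately show ?thesis
      unfolding sums_def VnH[OF Cper_C] coefC_def[of V] using LIMSEQ_unique by blast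
  qed
  have cS: "coefS V z = coefS v z" for z
  proof -
    have "(\<lambda>j. ?a j / area * cint (\<lambda>x. C (e j) x * S z x) + ?b j / area * cint (\<lambda>x. S (e j) x * S z x)) sums coefS v z"
    proof (rule sums_coef[OF e])
      fix j
      have "?b j * of_bool (z = e j) = coefS v z * of_bool (z = e j)"
        "?b j * of_bool (z = - e j) = - (coefS v z * of_bool (z = - e j))"
        by (auto simp: of_bool_def coefS_uminus)
      moreover have "cint (\<lambda>x. C (e j) x * S z x) = 0" using cint_S_C[of z "e j"] by (simp only: mult.commute)
      moreover have "?a j / area * 0 + ?b j / area * (area / 2 * (X - Y)) = (?b j * X - ?b j * Y) / 2" for X Y
        using area_pos by (simp add: right_diff_distrib)
      ultimately show "?a j / area * cint (\<lambda>x. C (e j) x * S z x) + ?b j / area * cint (\<lambda>x. S (e j) x * S z x)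
          = coefS v z / 2 * of_bool (z = e j) + coefS v z / 2 * of_bool (z = - e j)"
        unfolding cint_S_S by simp
    qed
    moreover have "(\<lambda>n. cint (\<lambda>x. Vn n x * S z x)) \<longlonglongrightarrow> cint (\<lambda>x. V x * S z x)"
      by (rule cint_uniform_limit[OF VnC V Cper_S _ lim]) (simp add: S_def)
    ultimately show ?thesis
      unfolding sums_def VnH[OF Cper_S] coefS_def[of V] using LIMSEQ_unique by blast
  qed
  have hC: "coefC (\<lambda>x. V x - v x) z = 0" for z
    using cint_diff[OF Cper_mult[OF V Cper_C[of 0 z]] Cper_mult[OF v Cper_C[of 0 z]]] cC[of z]
    unfolding coefC_def left_diff_distrib by linarith
  have hS: "coefS (\<lambda>x. V x - v x) z = 0" for z
    using cint_diff[OF Cper_mult[OF V Cper_S[of 0 z]] Cper_mult[OF v Cper_S[of 0 z]]] cS[of z]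
    unfolding coefS_def left_diff_distrib by linarith
  have "V x - v x = 0" by (rule fourier_complete[OF Cper_diff[OF V v] hC hS])
  then show "trig_series (\<lambda>j. freq (e j)) (\<lambda>j. ?a j / area) (\<lambda>j. ?b j / area) x = v x" by (simp add: V_def)
qed

end

section \<open>The Poisson equation on the torus\<close>

context lattice
begin

text \<open>
  Integration by parts twice.
\<close>

lemma coefC_laplacian:
  assumes v: "Cper p q 2 v"
  shows "coefC (laplacian v) z = - (norm (freq z))\<^sup>2 * coefC v z"
    and "coefS (laplacian v) z = - (norm (freq z))\<^sup>2 * coefS v z"
proof -
  have "coefC (laplacian v) z = cint (\<lambda>x. - (norm (freq z))\<^sup>2 * (v x * C z x))"
    unfolding coefC_def laplacian_symmetric[OF v Cper_C] laplacian_C by (simp only: mult.left_commute)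
  then show "coefC (laplacian v) z = - (norm (freq z))\<^sup>2 * coefC v z"
    by (simp only: cint_cmult coefC_def)
  have "coefS (laplacian v) z = cint (\<lambda>x. - (norm (freq z))\<^sup>2 * (v x * S z x))"
    unfolding coefS_def laplacian_symmetric[OF v Cper_S] laplacian_S by (simp only: mult.left_commute)
  then show "coefS (laplacian v) z = - (norm (freq z))\<^sup>2 * coefS v z"
    by (simp only: cint_cmult coefS_def)
qed

lemma coef_0: "coefC v 0 = cint v" "coefS v 0 = 0"
proof -
  have "C 0 = (\<lambda>_. 1)" "S 0 = (\<lambda>_. 0)" by (auto simp: C_def S_def)
  then show "coefC v 0 = cint v" "coefS v 0 = 0"
    using cint_cmult[of 0 "\<lambda>_. 0"] by (simp_all add: coefC_def coefS_def)
qed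

text \<open>
  For \<open>z \<noteq> 0\<close> a coefficient of \<open>v\<close> is the one of \<open>\<Delta>v\<close> divided by \<open>-\<bar>\<kappa>\<bar>\<^sup>2\<close>. The inequality between the geometric and
  the arithmetic mean bounds it by the square of the latter, which is summable by Bessel's inequality,
  plus \<open>\<bar>\<kappa>\<bar>\<^sup>-\<^sup>4\<close>. The coefficient at zero vanishes with the mean.
\<close>

lemma summable_coef:
  assumes e: "bij (e :: nat \<Rightarrow> int \<times> int)" and v: "Cper p q 2 v" and mean: "cint v = 0"
  shows "summable (\<lambda>j. \<bar>coefC v (e j)\<bar> + \<bar>coefS v (e j)\<bar>)"
proof -
  let ?g = "laplacian v" and ?\<kappa> = "\<lambda>j. norm (freq (e j))"
  have inj: "inj e" using e by (rule bij_is_inj)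
  have g: "Cper p q 0 ?g" using v by (intro Cper_laplacian) (simp add: numeral_2_eq_2)
  have "summable (\<lambda>j. (coefC ?g (e j))\<^sup>2 + (coefS ?g (e j))\<^sup>2)"
  proof (rule summableI_nonneg_bounded)
    fix n
    have "(\<Sum>j<n. (coefC ?g (e j))\<^sup>2 + (coefS ?g (e j))\<^sup>2) = (\<Sum>z\<in>e ` {..<n}. (coefC ?g z)\<^sup>2 + (coefS ?g z)\<^sup>2)"
      using inj by (simp add: sum.reindex inj_on_subset[OF inj])
    also have "\<dots> \<le> area * cint (\<lambda>x. (?g x)\<^sup>2)" by (rule bessel[OF g]) simp
    finally show "(\<Sum>j<n. (coefC ?g (e j))\<^sup>2 + (coefS ?g (e j))\<^sup>2) \<le> area * cint (\<lambda>x. (?g x)\<^sup>2)" .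
  qed simp
  from summable_add[OF this freq_summable[OF inj]]
  show ?thesis
  proof (rule summable_bound[where c=1])
    fix j
    show "\<bar>\<bar>coefC v (e j)\<bar> + \<bar>coefS v (e j)\<bar>\<bar> \<le> 1 * ((coefC ?g (e j))\<^sup>2 + (coefS ?g (e j))\<^sup>2 + 1 / ?\<kappa> j ^ 4)"
    proof (cases "e j = 0")
      case True
      then show ?thesis using mean by (simp add: coef_0)
    next
      case False
      define r where "r = (?\<kappa> j)\<^sup>2"
      have r: "0 < r" using False by (simp add: r_def freq_eq_0_iff)
      have half: "2 * \<bar>a\<bar> \<le> (r * a)\<^sup>2 + 1 / r\<^sup>2" for a
      proof -
        have "0 \<le> (r * \<bar>a\<bar> - 1 / r)\<^sup>2" by simp
        also have "\<dots> = (r * a)\<^sup>2 + 1 / r\<^sup>2 - 2 * \<bar>a\<bar>"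
          using r by (simp add: power2_diff power_mult_distrib power_divide)
        finally show ?thesis by simp
      qed
      have "\<bar>coefC v (e j)\<bar> + \<bar>coefS v (e j)\<bar> \<le> (r * coefC v (e j))\<^sup>2 + (r * coefS v (e j))\<^sup>2 + 1 / r\<^sup>2"
        using half[of "coefC v (e j)"] half[of "coefS v (e j)"]
          zero_le_power2[of "r * coefC v (e j)"] zero_le_power2[of "r * coefS v (e j)"] by linarith
      then show ?thesis by (simp add: coefC_laplacian[OF v] r_def power_mult_distrib)
    qed
  qed
qed

text \<open>
  Dividing the Fourier coefficients of \<open>v\<close> by \<open>\<bar>\<kappa>\<bar>\<^sup>2\<close> leaves a series that is still absolutely
  summable after multiplication by \<open>(1 + \<bar>\<kappa>\<bar>)\<^sup>2\<close>.
\<close>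

theorem poisson_solvable:
  assumes v: "Cper p q 2 v" and mean: "cint v = 0"
  obtains w where "Cper p q 2 w" "cint w = 0" "laplacian w = (\<lambda>x. - v x)"
proof -
  define e where "e = from_nat_into (UNIV :: (int \<times> int) set)"
  have "infinite (UNIV :: (int \<times> int) set)" by (simp add: finite_prod)
  then have e: "bij e" unfolding e_def by (intro bij_betw_from_nat_into) auto
  have inj: "inj e" using e by (rule bij_is_inj)
  define \<kappa> where "\<kappa> j = freq (e j)" for j
  define a b where "a j = coefC v (e j)" and "b j = coefS v (e j)" for j
  have s: "summable (\<lambda>j. \<bar>a j\<bar> + \<bar>b j\<bar>)" unfolding a_def b_def by (rule summable_coef[OF e v mean])
  define \<alpha> \<beta> where "\<alpha> j = a j / (area * (norm (\<kappa> j))\<^sup>2)" and "\<beta> j = b j / (area * (norm (\<kappa> j))\<^sup>2)" for j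
  obtain K where K: "0 < K" "\<And>z. (of_int (fst z))\<^sup>2 + (of_int (snd z))\<^sup>2 \<le> K * (norm (freq z))\<^sup>2"
    using freq_lower by blast
  have s2: "summable (\<lambda>j. (\<bar>\<alpha> j\<bar> + \<bar>\<beta> j\<bar>) * (1 + norm (\<kappa> j))\<^sup>2)"
  proof (rule summable_bound[OF s])
    fix j
    let ?n = "norm (\<kappa> j)"
    show "\<bar>(\<bar>\<alpha> j\<bar> + \<bar>\<beta> j\<bar>) * (1 + ?n)\<^sup>2\<bar> \<le> (2 * K + 2) / area * (\<bar>a j\<bar> + \<bar>b j\<bar>)"
    proof (cases "\<kappa> j = 0")
      case True
      then show ?thesis using K area_pos by (simp add: \<alpha>_def \<beta>_def)
    next
      case False
      then have "e j \<noteq> 0" by (auto simp: \<kappa>_def)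
      then have "1 \<le> (fst (e j))\<^sup>2 + (snd (e j))\<^sup>2"
        by (smt (verit) prod_eq_iff zero_less_power2 zero_prod_def fst_conv snd_conv zero_le_power2)
      then have "1 \<le> K * ?n\<^sup>2"
        using K(2)[of "e j"] unfolding \<kappa>_def by (smt (verit) of_int_1_le_iff of_int_add of_int_power)
      moreover have "(1 + ?n)\<^sup>2 \<le> 2 + 2 * ?n\<^sup>2"
        using zero_le_power2[of "1 - ?n"] by (simp add: power2_eq_square algebra_simps)
      ultimately have le: "(1 + ?n)\<^sup>2 \<le> (2 * K + 2) * ?n\<^sup>2" by (simp add: algebra_simps)
      have "(\<bar>\<alpha> j\<bar> + \<bar>\<beta> j\<bar>) * (1 + ?n)\<^sup>2 \<le> (\<bar>\<alpha> j\<bar> + \<bar>\<beta> j\<bar>) * ((2 * K + 2) * ?n\<^sup>2)"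
        by (intro mult_left_mono le) auto
      also have "\<dots> = (2 * K + 2) / area * (\<bar>a j\<bar> + \<bar>b j\<bar>)"
        using False area_pos by (simp add: \<alpha>_def \<beta>_def abs_mult add_divide_distrib[symmetric] field_simps)
      finally show ?thesis by simp
    qed
  qed
  define w where "w = trig_series \<kappa> \<alpha> \<beta>"
  have w: "Cper p q 2 w" unfolding w_def \<kappa>_def[abs_def] using s2 by (intro Cper_trig_series) (simp add: \<kappa>_def)
  have "laplacian w = trig_series \<kappa> (\<lambda>j. - (norm (\<kappa> j))\<^sup>2 * \<alpha> j) (\<lambda>j. - (norm (\<kappa> j))\<^sup>2 * \<beta> j)"
    unfolding w_def by (rule laplacian_trig_series[OF s2])
  also have "\<dots> = (\<lambda>x. - trig_series \<kappa> (\<lambda>j. a j / area) (\<lambda>j. b j / area) x)"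
  proof
    fix x
    have z: "a j = 0 \<and> b j = 0" if "\<kappa> j = 0" for j
      using that mean by (simp add: \<kappa>_def freq_eq_0_iff a_def b_def coef_0)
    have eq: "- (norm (\<kappa> j))\<^sup>2 * \<alpha> j = - (a j / area)" "- (norm (\<kappa> j))\<^sup>2 * \<beta> j = - (b j / area)" for j
      using z[of j] by (cases "\<kappa> j = 0"; simp add: \<alpha>_def \<beta>_def)+
    have sa: "summable (\<lambda>j. \<bar>a j / area\<bar> + \<bar>b j / area\<bar>)"
      by (rule summable_bound[OF s, of _ "1 / area"]) (use area_pos in \<open>simp add: add_divide_distrib\<close>)
    have "(\<lambda>j. - (a j / area * cos (\<kappa> j \<bullet> x) + b j / area * sin (\<kappa> j \<bullet> x))) sums (- trig_series \<kappa> (\<lambda>j. a j / area) (\<lambda>j. b j / area) x)"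
      by (intro sums_minus trig_series_sums sa)
    then show "trig_series \<kappa> (\<lambda>j. - (norm (\<kappa> j))\<^sup>2 * \<alpha> j) (\<lambda>j. - (norm (\<kappa> j))\<^sup>2 * \<beta> j) x = - trig_series \<kappa> (\<lambda>j. a j / area) (\<lambda>j. b j / area) x"
      unfolding eq trig_series_def[of _ "\<lambda>j. - (a j / area)"] by (simp add: sums_iff)
  qed
  also have "trig_series \<kappa> (\<lambda>j. a j / area) (\<lambda>j. b j / area) = v"
    unfolding \<kappa>_def[abs_def] a_def b_def
    by (rule fourier_series[OF e Cper_mono[OF v]]) (use summable_coef[OF e v mean] in simp_all)
  finally have lw: "laplacian w = (\<lambda>x. - v x)" .
  define w' where "w' x = w x - cint w / area" for x
  have C: "Cper p q 2 w'" unfolding w'_def[abs_def] by (intro Cper_diff w Cper_const)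
  have "cint w' = cint w - cint (\<lambda>_. cint w / area)"
    unfolding w'_def[abs_def] by (rule cint_diff[OF w Cper_const[of p q 2]])
  also have "cint (\<lambda>_. cint w / area) = cint w / area * area" by (rule cint_const)
  finally have "cint w' = 0" using area_pos by simp
  moreover have "laplacian w' = (\<lambda>x. - v x)"
    using w unfolding w'_def[abs_def] by (subst laplacian_diff) (auto simp: Cper_def C_space_const lw)
  ultimately show ?thesis using that C by blast
qed

lemma grad_norm: "Cper p q 2 u \<Longrightarrow> (\<Sum>i\<in>UNIV. cint (\<lambda>x. (partial_deriv i u x)\<^sup>2)) = - cint (\<lambda>x. laplacian u x * u x)"
  using green[of u u] Cper_mono[of p q 2 u 1] by (simp add: power2_eq_square)

text \<open>
  The Dirichlet integral of \<open>u\<close> vanishes, so \<open>u\<close> is constant.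
\<close>

lemma harmonic_eq_0:
  assumes u: "Cper p q 2 u" and lap: "laplacian u = (\<lambda>_. 0)" and mean: "cint u = 0"
  shows "u x = 0"
proof -
  have u1: "Cper p q (Suc 0) u" and u2: "Cper p q (Suc 1) u" using u by (auto intro: Cper_mono simp: numeral_2_eq_2)
  have "(\<Sum>i\<in>UNIV. cint (\<lambda>x. (partial_deriv i u x)\<^sup>2)) = 0"
    using grad_norm[OF u] cint_cmult[of 0 "\<lambda>_. 0"] by (simp add: lap)
  then have "cint (\<lambda>x. (partial_deriv i u x)\<^sup>2) = 0" for i
    by (subst (asm) sum_nonneg_eq_0_iff) (auto intro: cint_nonneg)
  then have "partial_deriv i u y = 0" for i y
    by (rule cint_definite[OF Cper_partial_deriv[OF u2]])
  then have "(u has_derivative (\<lambda>h. 0)) (at y)" for y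
    using has_derivative_partial_deriv[OF Cper_differentiable[OF u1], of y] by simp
  then obtain c where c: "\<And>y. u y = c"
    using has_derivative_zero_constant[of UNIV u] by auto
  then have "u = (\<lambda>_. c)" by auto
  then have "c * area = 0" using mean cint_const[of c] by simp
  then show ?thesis using c area_pos by simp
qed

text \<open>
  Existence and uniqueness together justify the definite description.
\<close>

lemma inv_neg_laplacian:
  assumes v: "Cper p q 2 v" and mean: "cint v = 0"
  shows "Cper p q 2 (inv_neg_laplacian p q v)" "laplacian (inv_neg_laplacian p q v) = (\<lambda>x. - v x)"
proof -
  let ?P = "\<lambda>w. periodic p q w \<and> C_space 2 w \<and> ip p q w (\<lambda>_. 1) = 0 \<and> (\<forall>x. - laplacian w x = v x)"
  obtain w where w: "Cper p q 2 w" "cint w = 0" "laplacian w = (\<lambda>x. - v x)"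
    using poisson_solvable[OF v mean] by blast
  have "?P w" using w by (simp add: Cper_def ip_eq_cell_integral)
  moreover have "u = w" if "?P u" for u
  proof
    fix x
    have u: "Cper p q 2 u" "cint u = 0" "laplacian u = (\<lambda>x. - v x)"
      using that by (auto simp: Cper_def ip_eq_cell_integral fun_eq_iff minus_equation_iff)
    have "u x - w x = 0"
    proof (rule harmonic_eq_0)
      show "Cper p q 2 (\<lambda>x. u x - w x)" by (intro Cper_diff u w)
      show "laplacian (\<lambda>x. u x - w x) = (\<lambda>_. 0)"
        using u w by (subst laplacian_diff) (auto simp: Cper_def)
      show "cint (\<lambda>x. u x - w x) = 0" using cint_diff[OF u(1) w(1)] u w by simp
    qed
    then show "u x = w x" by simp
  qed
  ultimately have "?P (inv_neg_laplacian p q v)"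
    unfolding inv_neg_laplacian_def by (rule theI)
  then show "Cper p q 2 (inv_neg_laplacian p q v)" "laplacian (inv_neg_laplacian p q v) = (\<lambda>x. - v x)"
    by (auto simp: Cper_def fun_eq_iff minus_equation_iff)
qed

end

section \<open>The discrete energy\<close>

context lattice
begin

lemma cint_sq_nonneg: "0 \<le> cint (\<lambda>x. (f x)\<^sup>2)"
  by (rule cint_nonneg) simp

lemma L2norm_sq: "(L2norm p q f)\<^sup>2 = cint (\<lambda>x. (f x)\<^sup>2)"
  using cint_sq_nonneg[of f] by (simp add: L2norm_def ip_eq_cell_integral power2_eq_square)

lemma cauchy_schwarz:
  assumes f: "Cper p q 0 f" and g: "Cper p q 0 g"
  shows "\<bar>cint (\<lambda>x. f x * g x)\<bar> \<le> L2norm p q f * L2norm p q g"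
proof -
  define a b c where "a = cint (\<lambda>x. (f x)\<^sup>2)" and "b = cint (\<lambda>x. (g x)\<^sup>2)" and "c = cint (\<lambda>x. f x * g x)"
  have "c\<^sup>2 \<le> a * b"
  proof (cases "b = 0")
    case True
    then have "g x = 0" for x using cint_definite[OF g] by (simp add: b_def)
    then have "c = 0" using cint_cmult[of 0 "\<lambda>_. 0"] by (simp add: c_def)
    then show ?thesis by (simp add: a_def b_def cint_sq_nonneg)
  next
    case False
    then have b: "0 < b" using cint_sq_nonneg[of g] by (simp add: b_def less_le)
    have "0 \<le> cint (\<lambda>x. (b * f x - c * g x)\<^sup>2)" by (rule cint_sq_nonneg)
    also have "\<dots> = cint (\<lambda>x. b\<^sup>2 * (f x)\<^sup>2 + 1 * ((-2 * b * c) * (f x * g x) + c\<^sup>2 * (g x)\<^sup>2))"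
      by (simp add: power2_eq_square algebra_simps)
    also have "\<dots> = b\<^sup>2 * a + 1 * cint (\<lambda>x. (-2 * b * c) * (f x * g x) + c\<^sup>2 * (g x)\<^sup>2)"
      unfolding a_def by (intro cint_lincomb0 Cper_add Cper_cmult Cper_mult Cper_power f g)
    also have "cint (\<lambda>x. (-2 * b * c) * (f x * g x) + c\<^sup>2 * (g x)\<^sup>2) = (-2 * b * c) * c + c\<^sup>2 * b"
      unfolding b_def[symmetric] c_def[symmetric]
      using cint_lincomb[OF Cper_mult[OF f g] Cper_power[OF g, of 2], of "-2 * b * c" "c\<^sup>2"]
      by (simp only: b_def[symmetric] c_def[symmetric])
    finally have "0 \<le> b * (a * b - c\<^sup>2)" by (simp add: power2_eq_square algebra_simps)
    then show ?thesis using b by (simp add: zero_le_mult_iff)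
  qed
  then have "sqrt (c\<^sup>2) \<le> sqrt (a * b)" by (rule real_sqrt_le_mono)
  then show ?thesis
    by (simp add: a_def b_def c_def L2norm_def ip_eq_cell_integral power2_eq_square real_sqrt_mult)
qed

lemma L2norm_nonneg: "0 \<le> L2norm p q f"
  using cint_sq_nonneg[of f] by (simp add: L2norm_def ip_eq_cell_integral power2_eq_square)

lemma L2norm_triangle:
  assumes f: "Cper p q 0 f" and g: "Cper p q 0 g"
  shows "L2norm p q (\<lambda>x. f x + g x) \<le> L2norm p q f + L2norm p q g"
proof (rule power2_le_imp_le)
  have "cint (\<lambda>x. (f x + g x)\<^sup>2) = cint (\<lambda>x. 1 * ((f x)\<^sup>2 + (g x)\<^sup>2) + 2 * (f x * g x))"
    by (simp add: power2_eq_square algebra_simps)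
  also have "\<dots> = 1 * cint (\<lambda>x. (f x)\<^sup>2 + (g x)\<^sup>2) + 2 * cint (\<lambda>x. f x * g x)"
    by (intro cint_lincomb0 Cper_add Cper_mult Cper_power f g)
  also have "cint (\<lambda>x. (f x)\<^sup>2 + (g x)\<^sup>2) = cint (\<lambda>x. (f x)\<^sup>2) + cint (\<lambda>x. (g x)\<^sup>2)"
    by (intro cint_add0 Cper_power f g)
  finally show "(L2norm p q (\<lambda>x. f x + g x))\<^sup>2 \<le> (L2norm p q f + L2norm p q g)\<^sup>2"
    using cauchy_schwarz[OF f g] by (simp add: L2norm_sq power2_sum abs_le_iff)
qed (simp add: L2norm_nonneg)

lemma grad_nonneg: "0 \<le> (\<Sum>i\<in>UNIV. cint (\<lambda>x. (partial_deriv i u x)\<^sup>2))"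
  by (intro sum_nonneg cint_sq_nonneg)

text \<open>
  This relation is closed under linear combinations, so the negative norms of combinations of
  differences become Dirichlet integrals of the same combinations of their potentials.
\<close>

definition potential :: "(real^2 \<Rightarrow> real) \<Rightarrow> (real^2 \<Rightarrow> real) \<Rightarrow> bool" where
  "potential v w \<longleftrightarrow> Cper p q 2 v \<and> cint v = 0 \<and> Cper p q 2 w \<and> laplacian w = (\<lambda>x. - v x)"

lemma potential_inv: "Cper p q 2 v \<Longrightarrow> cint v = 0 \<Longrightarrow> potential v (inv_neg_laplacian p q v)"
  by (simp add: potential_def inv_neg_laplacian)

lemma potential_cmult: "potential v w \<Longrightarrow> potential (\<lambda>x. c * v x) (\<lambda>x. c * w x)"
  by (auto simp: potential_def Cper_cmult cint_cmult laplacian_cmult Cper_def[of _ _ _ w])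

lemma potential_add: "potential v w \<Longrightarrow> potential v' w' \<Longrightarrow> potential (\<lambda>x. v x + v' x) (\<lambda>x. w x + w' x)"
  using cint_add[of 2 v 2 v'] laplacian_add[of w w'] by (auto simp: potential_def Cper_add) (auto simp: Cper_def)

lemma potential_diff: "potential v w \<Longrightarrow> potential v' w' \<Longrightarrow> potential (\<lambda>x. v x - v' x) (\<lambda>x. w x - w' x)"
  using cint_diff[of 2 v 2 v'] laplacian_diff[of w w'] by (auto simp: potential_def Cper_diff) (auto simp: Cper_def)

lemma potential_ip: "potential v w \<Longrightarrow> Cper p q 1 u \<Longrightarrow> cint (\<lambda>x. v x * u x) = (\<Sum>i\<in>UNIV. cint (\<lambda>x. partial_deriv i w x * partial_deriv i u x))"
  using green[of w u] cint_minus[of "\<lambda>x. v x * u x"] by (simp add: potential_def)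

text \<open>
  The potential \<open>w\<close> may differ from the one of mean zero by a constant; the symmetry of the Laplacian
  shows that the value is the same.
\<close>

lemma norm_neg1_sq:
  assumes w: "potential v w"
  shows "(norm_neg1 p q v)\<^sup>2 = (\<Sum>i\<in>UNIV. cint (\<lambda>x. (partial_deriv i w x)\<^sup>2))"
proof -
  define u where "u = inv_neg_laplacian p q v"
  have u: "potential v u" unfolding u_def using w by (intro potential_inv) (auto simp: potential_def)
  have C: "Cper p q 2 w" "Cper p q 2 u" using u w by (auto simp: potential_def)
  have "cint (\<lambda>x. u x * v x) = - cint (\<lambda>x. u x * laplacian w x)"
    using w cint_minus[of "\<lambda>x. u x * v x"] by (simp add: potential_def)
  also have "\<dots> = - cint (\<lambda>x. laplacian u x * w x)"
    using laplacian_symmetric[OF C(2,1)] by simp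
  also have "\<dots> = cint (\<lambda>x. v x * w x)"
    using u cint_minus[of "\<lambda>x. v x * w x"] by (simp add: potential_def)
  also have "\<dots> = (\<Sum>i\<in>UNIV. cint (\<lambda>x. (partial_deriv i w x)\<^sup>2))"
    using potential_ip[OF w, of w] Cper_mono[OF C(1), of 1] by (simp add: power2_eq_square)
  finally show ?thesis
    using grad_nonneg[of w] by (simp add: norm_neg1_def ip_neg1_def ip_eq_cell_integral u_def)
qed

lemma potential_partial:
  assumes "potential v w"
  shows "Cper p q 0 (partial_deriv i w)" "w differentiable_on UNIV"
proof -
  have "Cper p q 2 w" using assms by (simp add: potential_def)
  then have "Cper p q (Suc 0) w" by (rule Cper_mono) simp
  then show "Cper p q 0 (partial_deriv i w)" "w differentiable_on UNIV"
    by (auto intro: Cper_partial_deriv Cper_differentiable)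
qed

lemma partial_deriv_diff:
  assumes "f differentiable_on UNIV" "g differentiable_on UNIV"
  shows "partial_deriv i (\<lambda>x. f x - g x) = (\<lambda>x. partial_deriv i f x - partial_deriv i g x)"
  using partial_deriv_add[OF assms(1), of "\<lambda>x. -1 * g x"] partial_deriv_cmult[OF assms(2), of i "-1"] assms(2)
  by (simp add: differentiable_on_def)

text \<open>
  This reduces the discrete energy to the real quadratic form, evaluated on the gradients of the
  potentials.
\<close>

lemma G_neg1_eq:
  assumes k: "k \<in> {3, 4, 5}" and W: "\<And>m. m \<le> n \<Longrightarrow> potential (v m) (W m)"
  shows "G_neg1 p q k v n = (\<Sum>i\<in>UNIV. cint (\<lambda>x. G_form k (\<lambda>m. partial_deriv i (W m) x) n))"
proof -
  define D where "D i m x = partial_deriv i (W m) x" for i m x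
  have p0: "potential (v n) (W n)" and p1: "potential (v (n-1)) (W (n-1))" and p2: "potential (v (n-2)) (W (n-2))"
    and p3: "potential (v (n-3)) (W (n-3))" using W by auto
  have dW: "W m differentiable_on UNIV" if "m \<le> n" for m using potential_partial(2)[OF W[OF that]] .
  have dc: "(\<lambda>x. c * f x) differentiable_on UNIV" if "f differentiable_on UNIV" for c and f :: "real^2 \<Rightarrow> real"
    using that by (auto simp: differentiable_on_def)
  have da: "(\<lambda>x. f x + g x) differentiable_on UNIV" "(\<lambda>x. f x - g x) differentiable_on UNIV"
    if "f differentiable_on UNIV" "g differentiable_on UNIV" for f g :: "real^2 \<Rightarrow> real"
    using that by (auto simp: differentiable_on_def)
  have CD: "Cper p q 0 (D i m)" if "m \<le> n" for i m
    unfolding D_def[abs_def] using potential_partial(1)[OF W[OF that]] .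
  have N0: "(norm_neg1 p q (v n))\<^sup>2 = (\<Sum>i\<in>UNIV. cint (\<lambda>x. (D i n x)\<^sup>2))"
    unfolding D_def by (rule norm_neg1_sq[OF p0])
  have N1: "(norm_neg1 p q (\<lambda>x. c * v n x - v (n-1) x))\<^sup>2 = (\<Sum>i\<in>UNIV. cint (\<lambda>x. (c * D i n x - D i (n-1) x)\<^sup>2))" for c
    unfolding D_def norm_neg1_sq[OF potential_diff[OF potential_cmult[OF p0] p1]]
    by (simp add: partial_deriv_diff partial_deriv_cmult dW dc)
  have N2: "(norm_neg1 p q (\<lambda>x. c * (v n x - v (n-1) x) + v (n-2) x))\<^sup>2
      = (\<Sum>i\<in>UNIV. cint (\<lambda>x. (c * (D i n x - D i (n-1) x) + D i (n-2) x)\<^sup>2))" for c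
    unfolding D_def norm_neg1_sq[OF potential_add[OF potential_cmult[OF potential_diff[OF p0 p1]] p2]]
    by (simp add: partial_deriv_diff partial_deriv_add partial_deriv_cmult dW dc da)
  have N3: "(norm_neg1 p q (\<lambda>x. 2 * (v n x - v (n-1) x) + 2 * v (n-2) x - v (n-3) x))\<^sup>2
      = (\<Sum>i\<in>UNIV. cint (\<lambda>x. (2 * (D i n x - D i (n-1) x) + 2 * D i (n-2) x - D i (n-3) x)\<^sup>2))"
    unfolding D_def norm_neg1_sq[OF potential_diff[OF potential_add[OF potential_cmult[OF potential_diff[OF p0 p1]] potential_cmult[OF p2]] p3]]
    by (simp add: partial_deriv_diff partial_deriv_add partial_deriv_cmult dW dc da)
  have S2: "cint (\<lambda>x. a * (f x)\<^sup>2 + b * (g x)\<^sup>2) = a * cint (\<lambda>x. (f x)\<^sup>2) + b * cint (\<lambda>x. (g x)\<^sup>2)"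
    if "Cper p q 0 f" "Cper p q 0 g" for a b f g
    using that by (intro cint_lincomb0 Cper_power)
  have S3: "cint (\<lambda>x. a * (f x)\<^sup>2 + b * (g x)\<^sup>2 + c * (h x)\<^sup>2)
      = a * cint (\<lambda>x. (f x)\<^sup>2) + b * cint (\<lambda>x. (g x)\<^sup>2) + c * cint (\<lambda>x. (h x)\<^sup>2)"
    if C: "Cper p q 0 f" "Cper p q 0 g" "Cper p q 0 h" for a b c f g h
  proof -
    have "cint (\<lambda>x. 1 * (a * (f x)\<^sup>2 + b * (g x)\<^sup>2) + c * (h x)\<^sup>2)
        = 1 * cint (\<lambda>x. a * (f x)\<^sup>2 + b * (g x)\<^sup>2) + c * cint (\<lambda>x. (h x)\<^sup>2)"
      using C by (intro cint_lincomb0 Cper_add Cper_cmult Cper_power)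
    then show ?thesis by (simp add: S2[OF C(1,2)])
  qed
  have S4: "cint (\<lambda>x. a * (f x)\<^sup>2 + b * (g x)\<^sup>2 + c * (h x)\<^sup>2 + d * (j x)\<^sup>2)
      = a * cint (\<lambda>x. (f x)\<^sup>2) + b * cint (\<lambda>x. (g x)\<^sup>2) + c * cint (\<lambda>x. (h x)\<^sup>2) + d * cint (\<lambda>x. (j x)\<^sup>2)"
    if C: "Cper p q 0 f" "Cper p q 0 g" "Cper p q 0 h" "Cper p q 0 j" for a b c d f g h j
  proof -
    have "cint (\<lambda>x. 1 * (a * (f x)\<^sup>2 + b * (g x)\<^sup>2 + c * (h x)\<^sup>2) + d * (j x)\<^sup>2)
        = 1 * cint (\<lambda>x. a * (f x)\<^sup>2 + b * (g x)\<^sup>2 + c * (h x)\<^sup>2) + d * cint (\<lambda>x. (j x)\<^sup>2)"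
      using C by (intro cint_lincomb0 Cper_add Cper_cmult Cper_power)
    then show ?thesis by (simp add: S3[OF C(1-3)])
  qed
  have C0: "Cper p q 0 (D i n)" and C1: "Cper p q 0 (\<lambda>x. c * D i n x - D i (n-1) x)"
    and C2: "Cper p q 0 (\<lambda>x. c * (D i n x - D i (n-1) x) + D i (n-2) x)"
    and C3: "Cper p q 0 (\<lambda>x. 2 * (D i n x - D i (n-1) x) + 2 * D i (n-2) x - D i (n-3) x)" for i c
    by (intro Cper_add Cper_diff Cper_cmult CD; simp)+
  have D: "partial_deriv i (W m) x = D i m x" for i m x by (simp add: D_def)
  consider "k = 3" | "k = 4" | "k = 5" using k by auto
  then show ?thesis
  proof cases
    case 1
    show ?thesis unfolding D 1
      by (simp only: G_neg1_def G_form_def refl if_True if_False numeral_eq_iff num.distinct num.inject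
            N0 N1 S2[OF C0 C1] sum.distrib sum_distrib_left)
  next
    case 2
    show ?thesis unfolding D 2
      by (simp only: G_neg1_def G_form_def refl if_True if_False numeral_eq_iff num.distinct num.inject
            N0 N1 N2 S3[OF C0 C1 C2] sum.distrib sum_distrib_left)
  next
    case 3
    show ?thesis unfolding D 3
      by (simp only: G_neg1_def G_form_def refl if_True if_False numeral_eq_iff num.distinct num.inject
            N0 N1 N2 N3 S4[OF C0 C1 C2 C3] sum.distrib sum_distrib_left)
  qed
qed

lemma G_form_Cper:
  assumes "\<And>m. m \<le> n \<Longrightarrow> Cper p q 0 (D m)"
  shows "Cper p q 0 (\<lambda>x. G_form k (\<lambda>m. D m x) n)"
proof (cases "k = 3")
  case True
  show ?thesis unfolding G_form_def if_P[OF True]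
    by (intro Cper_add Cper_cmult Cper_power Cper_diff assms; simp)
next
  case False
  note F = False
  show ?thesis
  proof (cases "k = 4")
    case True
    show ?thesis unfolding G_form_def if_not_P[OF F] if_P[OF True]
      by (intro Cper_add Cper_cmult Cper_power Cper_diff assms; simp)
  next
    case False
    show ?thesis unfolding G_form_def if_not_P[OF F] if_not_P[OF False]
      by (intro Cper_add Cper_cmult Cper_power Cper_diff assms; simp)
  qed
qed

lemma cint_laplacian_shift_sq:
  assumes u: "Cper p q 2 u"
  shows "cint (\<lambda>x. (laplacian u x + c * u x)\<^sup>2)
      = cint (\<lambda>x. (laplacian u x)\<^sup>2) - 2 * c * cint (\<lambda>x. - (laplacian u x * u x)) + c\<^sup>2 * cint (\<lambda>x. (u x)\<^sup>2)"
proof -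
  have C: "Cper p q 0 u" "Cper p q 0 (laplacian u)"
    using u by (auto intro: Cper_mono intro!: Cper_laplacian simp: numeral_2_eq_2)
  have "cint (\<lambda>x. (laplacian u x + c * u x)\<^sup>2) = cint (\<lambda>x. 1 * (1 * (laplacian u x)\<^sup>2 + (-2 * c) * (- (laplacian u x * u x))) + c\<^sup>2 * (u x)\<^sup>2)"
    by (simp add: power2_eq_square algebra_simps)
  also have "\<dots> = 1 * cint (\<lambda>x. 1 * (laplacian u x)\<^sup>2 + (-2 * c) * (- (laplacian u x * u x))) + c\<^sup>2 * cint (\<lambda>x. (u x)\<^sup>2)"
    by (intro cint_lincomb0 Cper_add Cper_cmult Cper_minus Cper_mult Cper_power C)
  also have "cint (\<lambda>x. 1 * (laplacian u x)\<^sup>2 + (-2 * c) * (- (laplacian u x * u x)))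
      = 1 * cint (\<lambda>x. (laplacian u x)\<^sup>2) + (-2 * c) * cint (\<lambda>x. - (laplacian u x * u x))"
    by (intro cint_lincomb0 Cper_minus Cper_mult Cper_power C)
  finally show ?thesis by simp
qed

text \<open>
  In terms of the spectral parameter \<open>s\<close> of \<open>-\<Delta>\<close> the claim is
  \<open>(1 - s)\<^sup>2 - \<epsilon> + 3\<epsilon>/(2s) \<ge> 0\<close> for \<open>s > 0\<close>. It is affine in \<open>\<epsilon>\<close> and clear for \<open>\<epsilon> = 0\<close>;
  for \<open>\<epsilon> = 1\<close> it is \<open>s\<^sup>-\<^sup>1\<close> times
  \<open>s\<^sup>3 - 2s\<^sup>2 + 3/2 = s (s - 4/3)\<^sup>2 + 2/3 (s - 4/3)\<^sup>2 + 17/54\<close>. The three terms correspond to the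
  squared norms of \<open>\<Delta>v + 4/3 v\<close>, of the gradient of \<open>v - 4/3 w\<close> and of the gradient of \<open>w\<close>.
\<close>

lemma stabilization:
  assumes w: "potential v w" and eps: "0 \<le> \<epsilon>" "\<epsilon> \<le> 1"
  shows "0 \<le> cint (\<lambda>x. (one_plus_laplacian v x)\<^sup>2) - \<epsilon> * cint (\<lambda>x. (v x)\<^sup>2) + 3/2 * \<epsilon> * cint (\<lambda>x. v x * w x)"
proof -
  have v2: "Cper p q 2 v" and w2: "Cper p q 2 w" and lw: "laplacian w = (\<lambda>x. - v x)"
    using w by (auto simp: potential_def)
  have C: "Cper p q 0 v" "Cper p q 0 w" "Cper p q 0 (laplacian v)"
    using v2 w2 by (auto intro: Cper_mono intro!: Cper_laplacian simp: numeral_2_eq_2)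
  define N0 N1 N2 M where "N0 = cint (\<lambda>x. (v x)\<^sup>2)" and "N1 = cint (\<lambda>x. - (laplacian v x * v x))"
    and "N2 = cint (\<lambda>x. (laplacian v x)\<^sup>2)" and "M = cint (\<lambda>x. v x * w x)"
  have sq: "cint (\<lambda>x. (laplacian v x + c * v x)\<^sup>2) = N2 - 2 * c * N1 + c\<^sup>2 * N0" for c
    unfolding N0_def N1_def N2_def by (rule cint_laplacian_shift_sq[OF v2])
  have L: "cint (\<lambda>x. (one_plus_laplacian v x)\<^sup>2) = N2 - 2 * N1 + N0"
    using sq[of 1] by (simp add: one_plus_laplacian_def add.commute)
  have M0: "0 \<le> M" using potential_ip[OF w, of w] Cper_mono[OF w2, of 1] grad_nonneg[of w] by (simp add: M_def power2_eq_square)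
  have grad: "0 \<le> N1 - 8/3 * N0 + 16/9 * M"
  proof -
    let ?u = "\<lambda>x. v x - 4/3 * w x"
    have u: "Cper p q 2 ?u" by (intro Cper_diff Cper_cmult v2 w2)
    have lu: "laplacian ?u = (\<lambda>x. laplacian v x + 4/3 * v x)"
    proof -
      have "C_space 2 v" "C_space 2 w" using v2 w2 by (simp_all add: Cper_def)
      then have "laplacian ?u = (\<lambda>x. laplacian v x - 4/3 * laplacian w x)"
        by (simp only: laplacian_diff C_space_cmult laplacian_cmult)
      then show ?thesis by (simp add: lw)
    qed
    have "cint (\<lambda>x. laplacian v x * w x) = cint (\<lambda>x. - (v x)\<^sup>2)"
      using laplacian_symmetric[OF v2 w2] by (simp add: lw power2_eq_square)
    also have "\<dots> = - N0" unfolding N0_def by (rule cint_minus)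
    finally have vw: "cint (\<lambda>x. laplacian v x * w x) = - N0" .
    have "0 \<le> - cint (\<lambda>x. laplacian ?u x * ?u x)"
      using grad_norm[OF u] grad_nonneg[of ?u] by simp
    also have "\<dots> = cint (\<lambda>x. - (laplacian ?u x * ?u x))" by (rule cint_minus[symmetric])
    also have "\<dots> = cint (\<lambda>x. 1 * (1 * - (laplacian v x * v x) + 4/3 * (laplacian v x * w x)) + 1 * ((-4/3) * (v x)\<^sup>2 + 16/9 * (v x * w x)))"
      unfolding lu by (simp add: power2_eq_square algebra_simps)
    also have "\<dots> = 1 * cint (\<lambda>x. 1 * - (laplacian v x * v x) + 4/3 * (laplacian v x * w x)) + 1 * cint (\<lambda>x. (-4/3) * (v x)\<^sup>2 + 16/9 * (v x * w x))"
      by (intro cint_lincomb0 Cper_add Cper_cmult Cper_minus Cper_mult Cper_power C)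
    also have "cint (\<lambda>x. 1 * - (laplacian v x * v x) + 4/3 * (laplacian v x * w x)) = 1 * N1 + 4/3 * (- N0)"
      unfolding N1_def vw[symmetric] by (intro cint_lincomb0 Cper_minus Cper_mult C)
    also have "cint (\<lambda>x. (-4/3) * (v x)\<^sup>2 + 16/9 * (v x * w x)) = (-4/3) * N0 + 16/9 * M"
      unfolding N0_def M_def by (intro cint_lincomb0 Cper_power Cper_mult C)
    finally show ?thesis by simp
  qed
  have "0 \<le> N2 - 8/3 * N1 + 16/9 * N0"
    using sq[of "4/3"] cint_sq_nonneg[of "\<lambda>x. laplacian v x + 4/3 * v x"] by (simp add: power2_eq_square)
  then have 1: "0 \<le> N2 - 2 * N1 + 3/2 * M" using grad M0 by linarith
  have 0: "0 \<le> N2 - 2 * N1 + N0" using L cint_sq_nonneg[of "one_plus_laplacian v"] by simp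
  have "0 \<le> (1 - \<epsilon>) * (N2 - 2 * N1 + N0) + \<epsilon> * (N2 - 2 * N1 + 3/2 * M)"
    using 0 1 eps by simp
  also have "\<dots> = N2 - 2 * N1 + N0 - \<epsilon> * N0 + 3/2 * \<epsilon> * M" by (simp add: algebra_simps)
  finally show ?thesis unfolding L N0_def[symmetric] M_def[symmetric] .
qed

lemma pfc_energy_eq:
  "pfc_energy p q \<epsilon> u = 1/2 * cint (\<lambda>x. (one_plus_laplacian u x)\<^sup>2) + 1/4 * cint (\<lambda>x. ((u x)\<^sup>2 - \<epsilon>)\<^sup>2) - 1/4 * cint (\<lambda>_. \<epsilon>\<^sup>2)"
  by (simp only: pfc_energy_def L2norm_sq)

lemma Cper_one_plus_laplacian: "Cper p q (Suc (Suc m)) u \<Longrightarrow> Cper p q m (one_plus_laplacian u)"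
  unfolding one_plus_laplacian_def[abs_def] by (intro Cper_add Cper_laplacian) (auto intro: Cper_mono)

lemma cint_one_plus_laplacian:
  assumes u: "Cper p q 2 u" and v: "Cper p q 2 v"
  shows "cint (\<lambda>x. one_plus_laplacian u x * v x) = cint (\<lambda>x. u x * one_plus_laplacian v x)"
proof -
  have C: "Cper p q 0 u" "Cper p q 0 v" "Cper p q 0 (laplacian u)" "Cper p q 0 (laplacian v)"
    using u v by (auto intro: Cper_mono intro!: Cper_laplacian simp: numeral_2_eq_2)
  show ?thesis unfolding one_plus_laplacian_def distrib_left distrib_right
    using laplacian_symmetric[OF u v] cint_add[OF Cper_mult[OF C(1,2)] Cper_mult[OF C(3,2)]]
      cint_add[OF Cper_mult[OF C(1,2)] Cper_mult[OF C(1,4)]] by simp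
qed

lemma Cper_chem_pot: "Cper p q 6 u \<Longrightarrow> Cper p q 2 (chem_pot \<epsilon> u)"
proof -
  assume u: "Cper p q 6 u"
  have "Cper p q (Suc (Suc (Suc (Suc 2)))) u" using u by (simp add: numeral_eq_Suc)
  then show ?thesis unfolding chem_pot_def[abs_def]
    by (intro Cper_diff Cper_add Cper_one_plus_laplacian Cper_power Cper_cmult Cper_mono[OF u]) auto
qed

text \<open>
  The quadratic part of the energy gives an identity, since \<open>2 a (a - b) = a\<^sup>2 - b\<^sup>2 + (a - b)\<^sup>2\<close>. For the
  quartic part, \<open>(u\<^sup>3 - \<epsilon> u) (u - v)\<close> exceeds the increment of \<open>(u\<^sup>2 - \<epsilon>)\<^sup>2 / 4\<close> minus
  \<open>\<epsilon>/2 (u - v)\<^sup>2\<close> by a sum of squares.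
\<close>

lemma chem_pot_energy:
  assumes u: "Cper p q 6 u" and v: "Cper p q 2 v"
  defines "d \<equiv> \<lambda>x. u x - v x"
  shows "pfc_energy p q \<epsilon> u - pfc_energy p q \<epsilon> v + 1/2 * cint (\<lambda>x. (one_plus_laplacian d x)\<^sup>2) - \<epsilon>/2 * cint (\<lambda>x. (d x)\<^sup>2)
      \<le> cint (\<lambda>x. chem_pot \<epsilon> u x * d x)"
proof -
  let ?L = one_plus_laplacian
  have u2: "Cper p q 2 u" and u4: "Cper p q (Suc (Suc 2)) u" using u by (auto intro: Cper_mono)
  have d2: "Cper p q 2 d" unfolding d_def by (intro Cper_diff u2 v)
  have Lu2: "Cper p q 2 (?L u)" by (rule Cper_one_plus_laplacian[OF u4])
  have C: "Cper p q 0 u" "Cper p q 0 v" "Cper p q 0 d" "Cper p q 0 (?L u)" "Cper p q 0 (?L v)" "Cper p q 0 (?L d)" "Cper p q 0 (?L (?L u))"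
    using u2 v d2 Lu2 by (auto intro: Cper_mono intro!: Cper_one_plus_laplacian simp: numeral_2_eq_2)
  have Ld: "?L d x = ?L u x - ?L v x" for x
    using u2 v by (simp add: one_plus_laplacian_def d_def laplacian_diff Cper_def)
  let ?A = "\<lambda>f. cint (\<lambda>x. (f x)\<^sup>2)"
  let ?Q = "\<lambda>u x. (u x)\<^sup>2 - \<epsilon>"
  have CQ: "Cper p q 0 (?Q u)" "Cper p q 0 (?Q v)" by (intro Cper_diff Cper_power Cper_const C)+
  have "cint (\<lambda>x. chem_pot \<epsilon> u x * d x) = cint (\<lambda>x. ?L (?L u) x * d x + ((u x)^3 - \<epsilon> * u x) * d x)"
    by (simp add: chem_pot_def algebra_simps)
  also have "\<dots> = cint (\<lambda>x. ?L (?L u) x * d x) + cint (\<lambda>x. ((u x)^3 - \<epsilon> * u x) * d x)"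
    by (intro cint_add0 Cper_mult Cper_diff Cper_cmult Cper_power C)
  also have "cint (\<lambda>x. ?L (?L u) x * d x) = cint (\<lambda>x. ?L u x * ?L d x)"
    by (rule cint_one_plus_laplacian[OF Lu2 d2])
  also have "\<dots> = cint (\<lambda>x. 1 * (1/2 * (?L u x)\<^sup>2 + (-1/2) * (?L v x)\<^sup>2) + 1/2 * (?L d x)\<^sup>2)"
    unfolding Ld by (simp add: power2_eq_square algebra_simps)
  also have "\<dots> = 1 * cint (\<lambda>x. 1/2 * (?L u x)\<^sup>2 + (-1/2) * (?L v x)\<^sup>2) + 1/2 * ?A (?L d)"
    by (intro cint_lincomb0 Cper_add Cper_cmult Cper_power C)
  also have "cint (\<lambda>x. 1/2 * (?L u x)\<^sup>2 + (-1/2) * (?L v x)\<^sup>2) = 1/2 * ?A (?L u) + (-1/2) * ?A (?L v)"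
    by (intro cint_lincomb0 Cper_power C)
  finally have 1: "cint (\<lambda>x. chem_pot \<epsilon> u x * d x) =
      1/2 * ?A (?L u) - 1/2 * ?A (?L v) + 1/2 * ?A (?L d) + cint (\<lambda>x. ((u x)^3 - \<epsilon> * u x) * d x)" by simp
  have "1/4 * ?A (?Q u) - 1/4 * ?A (?Q v) - \<epsilon>/2 * ?A d = 1 * cint (\<lambda>x. 1/4 * (?Q u x)\<^sup>2 + (-1/4) * (?Q v x)\<^sup>2) + (-\<epsilon>/2) * ?A d"
    using cint_lincomb[OF Cper_power[OF CQ(1)] Cper_power[OF CQ(2)], of "1/4" 2 "-1/4" 2] by simp
  also have "\<dots> = cint (\<lambda>x. 1 * (1/4 * (?Q u x)\<^sup>2 + (-1/4) * (?Q v x)\<^sup>2) + (-\<epsilon>/2) * (d x)\<^sup>2)"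
    by (rule cint_lincomb0[symmetric]) (intro Cper_add Cper_cmult Cper_power Cper_diff Cper_const C)+
  also have "\<dots> \<le> cint (\<lambda>x. ((u x)^3 - \<epsilon> * u x) * d x)"
  proof (rule cint_mono0)
    fix x
    have "((u x)^3 - \<epsilon> * u x) * d x = 1 * (1/4 * (?Q u x)\<^sup>2 + (-1/4) * (?Q v x)\<^sup>2) + (-\<epsilon>/2) * (d x)\<^sup>2
        + (1/4 * ((u x)\<^sup>2 - (v x)\<^sup>2)\<^sup>2 + 1/2 * (u x * d x)\<^sup>2)"
      by (simp add: d_def power2_eq_square power3_eq_cube field_simps)
    moreover have "0 \<le> 1/4 * ((u x)\<^sup>2 - (v x)\<^sup>2)\<^sup>2 + 1/2 * (u x * d x)\<^sup>2" by simp
    ultimately show "1 * (1/4 * (?Q u x)\<^sup>2 + (-1/4) * (?Q v x)\<^sup>2) + (-\<epsilon>/2) * (d x)\<^sup>2 \<le> ((u x)^3 - \<epsilon> * u x) * d x" by linarith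
  qed (intro Cper_add Cper_cmult Cper_mult Cper_power Cper_diff Cper_const C)+
  finally show ?thesis using 1 unfolding pfc_energy_eq by linarith
qed

text \<open>
  The double well dominates the \<open>L\<^sup>2\<close> norm because
  \<open>(u\<^sup>2 - \<epsilon>)\<^sup>2 - \<epsilon>\<^sup>2 - 4u\<^sup>2 + (2 + \<epsilon>)\<^sup>2 = (u\<^sup>2 - (2 + \<epsilon>))\<^sup>2\<close>; together with \<open>\<Delta>u = Lu - u\<close> the energy
  controls both norms in the embedding. That the embedding constant is nonnegative is seen
  on the constant function \<open>1\<close>.
\<close>

lemma energy_imp_bound:
  assumes u: "Cper p q 2 u" and E: "pfc_energy p q \<epsilon> u \<le> c0" and c: "const_cOmega p q c\<Omega>"
  shows "\<bar>u x\<bar> \<le> const_c1 p q \<epsilon> c\<Omega> c0"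
proof -
  let ?A = "\<lambda>f. cint (\<lambda>x. (f x)\<^sup>2)"
  have C: "Cper p q 0 u" "Cper p q 0 (laplacian u)" "Cper p q 0 (one_plus_laplacian u)"
    using u by (auto intro: Cper_mono intro!: Cper_laplacian Cper_one_plus_laplacian simp: numeral_2_eq_2)
  have area: "cell_area p q = area"
    by (simp add: cell_area_def cell_integral_def set_lebesgue_integral_def)
  have "2 * (4 * ?A u) - 2 * (2 + \<epsilon>)\<^sup>2 * area \<le> 2 * ?A (\<lambda>x. (u x)\<^sup>2 - \<epsilon>) - 2 * cint (\<lambda>_. \<epsilon>\<^sup>2)"
  proof -
    have "4 * ?A u + (- (2 + \<epsilon>)\<^sup>2) * area = cint (\<lambda>x. 4 * (u x)\<^sup>2 + (- (2 + \<epsilon>)\<^sup>2) * 1)"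
      by (rule cint_lincomb0[symmetric]) (intro Cper_power Cper_const C)+
    also have "\<dots> \<le> cint (\<lambda>x. ((u x)\<^sup>2 - \<epsilon>)\<^sup>2 - \<epsilon>\<^sup>2)"
    proof (rule cint_mono0)
      fix x
      have "((u x)\<^sup>2 - \<epsilon>)\<^sup>2 - \<epsilon>\<^sup>2 = 4 * (u x)\<^sup>2 + (- (2 + \<epsilon>)\<^sup>2) * 1 + ((u x)\<^sup>2 - (2 + \<epsilon>))\<^sup>2"
        by (simp add: power2_eq_square algebra_simps)
      then show "4 * (u x)\<^sup>2 + (- (2 + \<epsilon>)\<^sup>2) * 1 \<le> ((u x)\<^sup>2 - \<epsilon>)\<^sup>2 - \<epsilon>\<^sup>2"
        using zero_le_power2[of "(u x)\<^sup>2 - (2 + \<epsilon>)"] by linarith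
    qed (intro Cper_add Cper_cmult Cper_power Cper_diff Cper_const C)+
    also have "\<dots> = ?A (\<lambda>x. (u x)\<^sup>2 - \<epsilon>) - cint (\<lambda>_. \<epsilon>\<^sup>2)"
      by (intro cint_diff0 Cper_power Cper_diff Cper_const C)
    finally show ?thesis by simp
  qed
  then have key: "4 * ?A (one_plus_laplacian u) + 8 * ?A u \<le> 8 * c0 + 2 * (2 + \<epsilon>)\<^sup>2 * area"
    using E unfolding pfc_energy_eq by linarith
  have lap: "?A (laplacian u) \<le> 2 * ?A (one_plus_laplacian u) + 2 * ?A u"
  proof -
    have "?A (laplacian u) \<le> cint (\<lambda>x. 2 * (one_plus_laplacian u x)\<^sup>2 + 2 * (u x)\<^sup>2)"
    proof (rule cint_mono0)
      fix x
      have "2 * (one_plus_laplacian u x)\<^sup>2 + 2 * (u x)\<^sup>2 = (laplacian u x)\<^sup>2 + (2 * u x + laplacian u x)\<^sup>2"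
        by (simp add: one_plus_laplacian_def power2_eq_square algebra_simps)
      then show "(laplacian u x)\<^sup>2 \<le> 2 * (one_plus_laplacian u x)\<^sup>2 + 2 * (u x)\<^sup>2" by simp
    qed (intro Cper_add Cper_cmult Cper_power C)+
    also have "\<dots> = 2 * ?A (one_plus_laplacian u) + 2 * ?A u"
      by (intro cint_lincomb0 Cper_power C)
    finally show ?thesis .
  qed
  have "(L2norm p q u + L2norm p q (laplacian u))\<^sup>2 \<le> 2 * (L2norm p q u)\<^sup>2 + 2 * (L2norm p q (laplacian u))\<^sup>2"
    using zero_le_power2[of "L2norm p q u - L2norm p q (laplacian u)"] by (simp add: power2_eq_square algebra_simps)
  also have "\<dots> \<le> 8 * c0 + 2 * (2 + \<epsilon>)\<^sup>2 * area"
    unfolding L2norm_sq using key lap cint_sq_nonneg[of u] by linarith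
  finally have le: "L2norm p q u + L2norm p q (laplacian u) \<le> sqrt (8 * c0 + 2 * (2 + \<epsilon>)\<^sup>2 * area)"
    by (rule real_le_rsqrt)
  have c\<Omega>: "0 \<le> c\<Omega>"
  proof -
    have "periodic p q (\<lambda>_. 1) \<and> C_space 2 (\<lambda>_. 1)" by (simp add: periodic_def C_space_const)
    then have *: "Linfnorm p q (\<lambda>_. 1) \<le> c\<Omega> * (L2norm p q (\<lambda>_. 1) + L2norm p q (laplacian (\<lambda>_. 1)))"
      using c unfolding const_cOmega_def by blast
    have "1 \<le> Linfnorm p q (\<lambda>_. 1)" using Linfnorm_bound[OF Cper_const[of p q 0 1]] by simp
    then have "0 < c\<Omega> * (L2norm p q (\<lambda>_. 1) + L2norm p q (laplacian (\<lambda>_. 1)))" using * by linarith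
    moreover have "0 \<le> L2norm p q (\<lambda>_. 1) + L2norm p q (laplacian (\<lambda>_. 1))" by (intro add_nonneg_nonneg L2norm_nonneg)
    ultimately show ?thesis by (simp add: zero_less_mult_iff)
  qed
  have "\<bar>u x\<bar> \<le> Linfnorm p q u" by (rule Linfnorm_bound[OF u])
  also have "\<dots> \<le> c\<Omega> * (L2norm p q u + L2norm p q (laplacian u))"
    using c u unfolding const_cOmega_def Cper_def by blast
  also have "\<dots> \<le> const_c1 p q \<epsilon> c\<Omega> c0"
    unfolding const_c1_def area using le c\<Omega> by (rule mult_left_mono)
  finally show ?thesis .
qed

end

section \<open>A maximum bound for the numerical solution\<close>

context lattice
begin

lemma cint_laplacian:
  assumes "Cper p q 2 u"
  shows "cint (laplacian u) = 0"
  using laplacian_symmetric[OF assms Cper_const[of p q 2 1]] cint_cmult[of 0 "\<lambda>_. 0"] by simp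

lemma scheme_Cper:
  assumes "bdf_scheme p q \<epsilon> k \<tau> N \<phi>" "m \<le> N"
  shows "Cper p q 2 (\<phi> m)" "k \<le> m \<Longrightarrow> Cper p q 6 (\<phi> m)"
proof -
  show 6: "Cper p q 6 (\<phi> m)" if "k \<le> m" using assms that by (auto simp: bdf_scheme_def Cper_def)
  show "Cper p q 2 (\<phi> m)"
    using assms Cper_mono[OF 6, of 2] by (cases "k \<le> m") (auto simp: bdf_scheme_def Cper_def)
qed

lemma scheme_eq:
  assumes k: "k \<in> {3, 4, 5}" and s: "bdf_scheme p q \<epsilon> k \<tau> N \<phi>" and n: "k \<le> n" "n \<le> N"
  shows "laplacian (chem_pot \<epsilon> (\<phi> n)) x = 1 / \<tau> * (\<Sum>i<k. bdf_b k i * bdiff (\<lambda>m. \<phi> m x) (n - i))"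
proof -
  have "laplacian (chem_pot \<epsilon> (\<phi> n)) x = bdf_D k \<tau> (\<lambda>m. \<phi> m x) n"
    using s n by (auto simp: bdf_scheme_def)
  then show ?thesis unfolding bdf_D_def bdf_sum_eq[OF k n(1)] .
qed

lemma Cper_bdiff:
  assumes "bdf_scheme p q \<epsilon> k \<tau> N \<phi>" "m \<le> N"
  shows "Cper p q 2 (\<lambda>x. bdiff (\<lambda>i. \<phi> i x) m)"
  unfolding bdiff_def by (intro Cper_diff scheme_Cper[OF assms(1)]) (use assms in auto)

text \<open>
  The integral of the right-hand side of the scheme vanishes, so the integral of the newest difference is
  a combination of those of the older ones.
\<close>

lemma scheme_volume:
  assumes k: "k \<in> {3, 4, 5}" and s: "bdf_scheme p q \<epsilon> k \<tau> N \<phi>" and \<tau>: "0 < \<tau>"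
    and vol: "\<And>l. l < k \<Longrightarrow> cint (\<phi> l) = cint (\<phi> 0)" and m: "m \<le> N"
  shows "cint (\<lambda>x. bdiff (\<lambda>i. \<phi> i x) m) = 0"
  using m
proof (induction m rule: less_induct)
  case (less m)
  let ?d = "\<lambda>m x. bdiff (\<lambda>i. \<phi> i x) m"
  show ?case
  proof (cases "m < k")
    case True
    have "cint (?d m) = cint (\<phi> m) - cint (\<phi> (m - 1))"
      unfolding bdiff_def by (rule cint_diff[OF scheme_Cper(1)[OF s] scheme_Cper(1)[OF s]]) (use less.prems in auto)
    then show ?thesis using vol[of m] vol[of "m - 1"] True by simp
  next
    case False
    then have n: "k \<le> m" "m \<le> N" using less.prems by auto
    have "0 = cint (laplacian (chem_pot \<epsilon> (\<phi> m)))"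
      by (rule cint_laplacian[OF Cper_chem_pot[OF scheme_Cper(2)[OF s n(2,1)]], symmetric])
    also have "\<dots> = cint (\<lambda>x. 1 / \<tau> * (\<Sum>i<k. bdf_b k i * ?d (m - i) x))"
      by (rule arg_cong[where f=cint]) (simp add: scheme_eq[OF k s n] fun_eq_iff)
    also have "\<dots> = 1 / \<tau> * (\<Sum>i<k. cint (\<lambda>x. bdf_b k i * ?d (m - i) x))"
      by (subst cint_cmult, subst cint_sum[where m=2])
         (use n in \<open>auto intro!: Cper_cmult Cper_bdiff[OF s]\<close>)
    also have "\<dots> = 1 / \<tau> * (\<Sum>i<k. bdf_b k i * cint (?d (m - i)))" by (simp only: cint_cmult)
    also have "(\<Sum>i<k. bdf_b k i * cint (?d (m - i))) = (\<Sum>i\<in>{0}. bdf_b k i * cint (?d (m - i)))"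
      using less.IH n k by (intro sum.mono_neutral_right) auto
    finally show ?thesis using \<tau> bdf_b0_pos[OF k] by simp
  qed
qed

lemma G_neg1_nonneg: "0 \<le> G_neg1 p q k v n"
  by (simp add: G_neg1_def)

text \<open>
  The scheme at time \<open>n\<close> is tested with the potential \<open>W n\<close> of the newest difference \<open>d n\<close>.
\<close>

lemma energy_dissipation:
  assumes k: "k \<in> {3, 4, 5}" and s: "bdf_scheme p q \<epsilon> k \<tau> N \<phi>" and \<tau>: "0 < \<tau>"
    and vol: "\<And>l. l < k \<Longrightarrow> cint (\<phi> l) = cint (\<phi> 0)"
    and eps: "0 < \<epsilon>" "\<epsilon> < 1" and step: "\<tau> \<le> 2 / (3 * \<epsilon>) * sigma_L k"
    and n: "k \<le> n" "n \<le> N"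
  shows "discrete_energy p q \<epsilon> k \<tau> \<phi> n \<le> discrete_energy p q \<epsilon> k \<tau> \<phi> (n - 1)"
proof -
  define d where "d m x = bdiff (\<lambda>i. \<phi> i x) m" for m x
  define W where "W m = inv_neg_laplacian p q (d m)" for m
  define D where "D c m x = partial_deriv c (W m) x" for c m x
  let ?\<mu> = "chem_pot \<epsilon> (\<phi> n)"
  have P: "potential (d m) (W m)" if "m \<le> N" for m
    unfolding W_def d_def[abs_def] by (intro potential_inv Cper_bdiff[OF s that] scheme_volume[OF k s \<tau> vol that])
  have Pn: "potential (d n) (W n)" using P n by simp
  have Wn: "Cper p q 2 (W n)" and Wn1: "Cper p q 1 (W n)" using Pn Cper_mono[of p q 2 "W n" 1] by (auto simp: potential_def)
  have CD: "Cper p q 0 (D c m)" if "m \<le> N" for c m unfolding D_def[abs_def] by (rule potential_partial(1)[OF P[OF that]])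
  have \<mu>: "Cper p q 2 ?\<mu>" by (rule Cper_chem_pot[OF scheme_Cper(2)[OF s n(2,1)]])
  define M where "M = cint (\<lambda>x. d n x * W n x)"
  have M: "M = (\<Sum>c\<in>UNIV. cint (\<lambda>x. (D c n x)\<^sup>2))"
    unfolding M_def D_def potential_ip[OF Pn Wn1] by (simp add: power2_eq_square)
  have "cint (\<lambda>x. laplacian ?\<mu> x * W n x) = cint (\<lambda>x. - (?\<mu> x * d n x))"
    unfolding laplacian_symmetric[OF \<mu> Wn] using Pn by (simp add: potential_def)
  then have 1: "cint (\<lambda>x. laplacian ?\<mu> x * W n x) = - cint (\<lambda>x. ?\<mu> x * d n x)"
    by (simp only: cint_minus)
  have Cdn: "Cper p q 0 (d (n - i))" for i
    using P[of "n - i"] n Cper_mono[of p q 2 "d (n - i)" 0] by (auto simp: potential_def)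
  have CW: "Cper p q 0 (W n)" using Cper_mono[OF Wn, of 0] by simp
  have "cint (\<lambda>x. laplacian ?\<mu> x * W n x) = cint (\<lambda>x. 1 / \<tau> * (\<Sum>i<k. bdf_b k i * (d (n - i) x * W n x)))"
    by (simp add: scheme_eq[OF k s n] d_def sum_distrib_right mult.assoc)
  also have "\<dots> = 1 / \<tau> * (\<Sum>i<k. cint (\<lambda>x. bdf_b k i * (d (n - i) x * W n x)))"
    by (subst cint_cmult, subst cint_sum0) (intro Cper_cmult Cper_mult Cdn CW | rule refl)+
  also have "(\<Sum>i<k. cint (\<lambda>x. bdf_b k i * (d (n - i) x * W n x))) = (\<Sum>i<k. \<Sum>c\<in>UNIV. bdf_b k i * cint (\<lambda>x. D c (n - i) x * D c n x))"
  proof (rule sum.cong[OF refl])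
    fix i
    have "potential (d (n - i)) (W (n - i))" using P n by simp
    from potential_ip[OF this Wn1] show "cint (\<lambda>x. bdf_b k i * (d (n - i) x * W n x)) = (\<Sum>c\<in>UNIV. bdf_b k i * cint (\<lambda>x. D c (n - i) x * D c n x))"
      by (simp only: cint_cmult sum_distrib_left D_def)
  qed
  also have "\<dots> = (\<Sum>c\<in>UNIV. \<Sum>i<k. cint (\<lambda>x. bdf_b k i * (D c (n - i) x * D c n x)))"
    unfolding cint_cmult by (rule sum.swap)
  also have "\<dots> = (\<Sum>c\<in>UNIV. cint (\<lambda>x. D c n x * (\<Sum>i<k. bdf_b k i * D c (n - i) x)))"
  proof (rule sum.cong[OF refl])
    fix c
    have "cint (\<lambda>x. \<Sum>i<k. bdf_b k i * (D c (n - i) x * D c n x)) = (\<Sum>i<k. cint (\<lambda>x. bdf_b k i * (D c (n - i) x * D c n x)))"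
      by (rule cint_sum0) (intro Cper_cmult Cper_mult CD; use n in simp)
    then show "(\<Sum>i<k. cint (\<lambda>x. bdf_b k i * (D c (n - i) x * D c n x))) = cint (\<lambda>x. D c n x * (\<Sum>i<k. bdf_b k i * D c (n - i) x))"
      by (simp add: sum_distrib_left mult_ac)
  qed
  finally have 2: "cint (\<lambda>x. laplacian ?\<mu> x * W n x) = 1 / \<tau> * (\<Sum>c\<in>UNIV. cint (\<lambda>x. D c n x * (\<Sum>i<k. bdf_b k i * D c (n - i) x)))" .
  have Gn: "G_neg1 p q k d m = (\<Sum>c\<in>UNIV. cint (\<lambda>x. G_form k (\<lambda>l. D c l x) m))" if "m \<le> N" for m
    unfolding D_def by (rule G_neg1_eq[OF k]) (use P that in auto)
  have CG: "Cper p q 0 (\<lambda>x. G_form k (\<lambda>l. D c l x) m)" if "m \<le> N" for m c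
    by (rule G_form_Cper) (use CD that in auto)
  have 3: "G_neg1 p q k d n - G_neg1 p q k d (n - 1) + sigma_L k / 2 * M
      \<le> (\<Sum>c\<in>UNIV. cint (\<lambda>x. D c n x * (\<Sum>i<k. bdf_b k i * D c (n - i) x)))"
  proof -
    have "cint (\<lambda>x. G_form k (\<lambda>l. D c l x) n) - cint (\<lambda>x. G_form k (\<lambda>l. D c l x) (n - 1)) + sigma_L k / 2 * cint (\<lambda>x. (D c n x)\<^sup>2)
        \<le> cint (\<lambda>x. D c n x * (\<Sum>i<k. bdf_b k i * D c (n - i) x))" for c
    proof -
      have N: "n \<le> N" "n - 1 \<le> N" using n by auto
      have "cint (\<lambda>x. G_form k (\<lambda>l. D c l x) n) - cint (\<lambda>x. G_form k (\<lambda>l. D c l x) (n - 1)) + sigma_L k / 2 * cint (\<lambda>x. (D c n x)\<^sup>2)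
          = 1 * cint (\<lambda>x. G_form k (\<lambda>l. D c l x) n - G_form k (\<lambda>l. D c l x) (n - 1)) + sigma_L k / 2 * cint (\<lambda>x. (D c n x)\<^sup>2)"
        using cint_diff[OF CG[OF N(1)] CG[OF N(2)], of c c] by simp
      also have "\<dots> = cint (\<lambda>x. 1 * (G_form k (\<lambda>l. D c l x) n - G_form k (\<lambda>l. D c l x) (n - 1)) + sigma_L k / 2 * (D c n x)\<^sup>2)"
        by (rule cint_lincomb0[symmetric]) (intro Cper_diff CG Cper_power CD N)+
      also have "\<dots> \<le> cint (\<lambda>x. D c n x * (\<Sum>i<k. bdf_b k i * D c (n - i) x))"
      proof (rule cint_mono0)
        show "1 * (G_form k (\<lambda>l. D c l x) n - G_form k (\<lambda>l. D c l x) (n - 1)) + sigma_L k / 2 * (D c n x)\<^sup>2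
            \<le> D c n x * (\<Sum>i<k. bdf_b k i * D c (n - i) x)" for x
          using bdf_energy_inequality[OF k, of "\<lambda>l. D c l x" n] by simp
        show "Cper p q 0 (\<lambda>x. 1 * (G_form k (\<lambda>l. D c l x) n - G_form k (\<lambda>l. D c l x) (n - 1)) + sigma_L k / 2 * (D c n x)\<^sup>2)"
          by (intro Cper_add Cper_cmult Cper_diff CG Cper_power CD N)
        show "Cper p q 0 (\<lambda>x. D c n x * (\<Sum>i<k. bdf_b k i * D c (n - i) x))"
          by (intro Cper_mult Cper_sum Cper_cmult CD; use n in simp)
      qed
      finally show ?thesis .
    qed
    then have "(\<Sum>c\<in>UNIV. cint (\<lambda>x. G_form k (\<lambda>l. D c l x) n) - cint (\<lambda>x. G_form k (\<lambda>l. D c l x) (n - 1)) + sigma_L k / 2 * cint (\<lambda>x. (D c n x)\<^sup>2))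
        \<le> (\<Sum>c\<in>UNIV. cint (\<lambda>x. D c n x * (\<Sum>i<k. bdf_b k i * D c (n - i) x)))" by (rule sum_mono)
    moreover have "n - 1 \<le> N" using n by simp
    ultimately show ?thesis unfolding M Gn[OF n(2)] Gn[OF \<open>n - 1 \<le> N\<close>]
      by (simp only: sum.distrib sum_subtractf sum_distrib_left)
  qed
  have "1 / \<tau> * (G_neg1 p q k d n - G_neg1 p q k d (n - 1) + sigma_L k / 2 * M) \<le> - cint (\<lambda>x. ?\<mu> x * d n x)"
    using mult_left_mono[OF 3, of "1 / \<tau>"] \<tau> 1 2 by simp
  moreover have "pfc_energy p q \<epsilon> (\<phi> n) - pfc_energy p q \<epsilon> (\<phi> (n - 1)) + 1/2 * cint (\<lambda>x. (one_plus_laplacian (d n) x)\<^sup>2) - \<epsilon>/2 * cint (\<lambda>x. (d n x)\<^sup>2)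
      \<le> cint (\<lambda>x. ?\<mu> x * d n x)"
    using chem_pot_energy[OF scheme_Cper(2)[OF s n(2,1)] scheme_Cper(1)[OF s, of "n - 1"], of \<epsilon>] n
    by (simp add: d_def[abs_def] bdiff_def)
  moreover have "0 \<le> 1/2 * cint (\<lambda>x. (one_plus_laplacian (d n) x)\<^sup>2) - \<epsilon>/2 * cint (\<lambda>x. (d n x)\<^sup>2) + 1 / \<tau> * (sigma_L k / 2 * M)"
  proof -
    \<comment> \<open>This is the restriction on the time step.\<close>
    have "3/4 * \<epsilon> \<le> 1 / \<tau> * (sigma_L k / 2)" using step eps \<tau> by (simp add: field_simps)
    moreover have "0 \<le> M" unfolding M by (intro sum_nonneg cint_sq_nonneg)
    ultimately have "3/4 * \<epsilon> * M \<le> 1 / \<tau> * (sigma_L k / 2) * M" by (rule mult_right_mono)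
    then have "3/4 * \<epsilon> * M \<le> 1 / \<tau> * (sigma_L k / 2 * M)" by (simp only: mult.assoc)
    then show ?thesis using stabilization[OF Pn, of \<epsilon>] eps unfolding M_def[symmetric] by linarith
  qed
  ultimately have "pfc_energy p q \<epsilon> (\<phi> n) + 1 / \<tau> * G_neg1 p q k d n \<le> pfc_energy p q \<epsilon> (\<phi> (n - 1)) + 1 / \<tau> * G_neg1 p q k d (n - 1)"
    unfolding distrib_left right_diff_distrib by linarith
  then show ?thesis by (simp add: discrete_energy_def d_def[abs_def])
qed

lemma scheme_bound:
  assumes k: "k \<in> {3, 4, 5}" and s: "bdf_scheme p q \<epsilon> k \<tau> N \<phi>" and \<tau>: "0 < \<tau>"
    and vol: "\<And>l. l < k \<Longrightarrow> cint (\<phi> l) = cint (\<phi> 0)"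
    and eps: "0 < \<epsilon>" "\<epsilon> < 1" and step: "\<tau> \<le> 2 / (3 * \<epsilon>) * sigma_L k"
    and c0: "discrete_energy p q \<epsilon> k \<tau> \<phi> (k - 1) \<le> c0" and c: "const_cOmega p q c\<Omega>"
    and n: "k \<le> n" "n \<le> N"
  shows "\<bar>\<phi> n x\<bar> \<le> const_c1 p q \<epsilon> c\<Omega> c0"
proof -
  have "discrete_energy p q \<epsilon> k \<tau> \<phi> (k - 1 + j) \<le> c0" if "k - 1 + j \<le> N" for j
    using that
  proof (induction j)
    case (Suc j)
    have "k \<le> k - 1 + Suc j" using k by auto
    from energy_dissipation[OF k s \<tau> vol eps step this Suc.prems] Suc show ?case by simp
  qed (use c0 in simp)
  from this[of "n - (k - 1)"] n have "discrete_energy p q \<epsilon> k \<tau> \<phi> n \<le> c0" by simp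
  moreover have "0 \<le> 1 / \<tau> * G_neg1 p q k (\<lambda>m x. bdiff (\<lambda>i. \<phi> i x) m) n"
    using \<tau> G_neg1_nonneg by simp
  ultimately have "pfc_energy p q \<epsilon> (\<phi> n) \<le> c0" unfolding discrete_energy_def by linarith
  then show ?thesis by (rule energy_imp_bound[OF scheme_Cper(1)[OF s n(2)] _ c])
qed

end

section \<open>The truncation error\<close>

text \<open>
  The BDF formula of order \<open>k\<close> differentiates polynomials of degree at most \<open>k\<close> exactly.
\<close>

lemma bdf_moments:
  assumes "k \<in> {3, 4, 5}" "i \<le> k"
  shows "(\<Sum>j<k. bdf_b k j * ((- real j) ^ i - (- real (Suc j)) ^ i)) = of_bool (i = 1)"
proof -
  consider "k = 3" | "k = 4" | "k = 5" using assms by auto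
  then show ?thesis
  proof cases
    case 1
    with assms have "i \<in> {0, Suc 0, 2, 3}" by auto
    then show ?thesis unfolding 1 bdf_b_sum by (auto simp: power_numeral_reduce)
  next
    case 2
    with assms have "i \<in> {0, Suc 0, 2, 3, 4}" by auto
    then show ?thesis unfolding 2 bdf_b_sum by (auto simp: power_numeral_reduce)
  next
    case 3
    with assms have "i \<in> {0, Suc 0, 2, 3, 4, 5}" by auto
    then show ?thesis unfolding 3 bdf_b_sum by (auto simp: power_numeral_reduce)
  qed
qed

text \<open>
  Taylor expansion about the current time: the polynomial part is differentiated exactly, and each
  remainder is at most \<open>M (k\<tau>)\<^sup>k\<^sup>+\<^sup>1\<close>.
\<close>

lemma bdf_consistency:
  fixes f :: "nat \<Rightarrow> real \<Rightarrow> real"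
  assumes k: "k \<in> {3, 4, 5}"
    and f: "\<And>i t. i \<le> k \<Longrightarrow> t \<in> {0..T} \<Longrightarrow> (f i has_field_derivative f (Suc i) t) (at t within {0..T})"
    and M: "\<And>t. t \<in> {0..T} \<Longrightarrow> \<bar>f (Suc k) t\<bar> \<le> M"
    and \<tau>: "0 < \<tau>" and n: "k \<le> n" "real n * \<tau> \<le> T"
  shows "\<bar>bdf_D k \<tau> (\<lambda>m. f 0 (real m * \<tau>)) n - f 1 (real n * \<tau>)\<bar> \<le> 2 * bdf_l1 k * real k ^ Suc k * M * \<tau> ^ k"
proof -
  define t where "t = real n * \<tau>"
  have t: "t \<in> {0..T}" using \<tau> n by (simp add: t_def)
  have M0: "0 \<le> M" using M[OF t] by simp
  define R where "R j = f 0 (t - real j * \<tau>) - (\<Sum>i\<le>k. f i t * (- (real j * \<tau>)) ^ i / fact i)" for j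
  have R: "\<bar>R j\<bar> \<le> M * (real k * \<tau>) ^ Suc k" if j: "j \<le> k" for j
  proof -
    have "real j * \<tau> \<le> real n * \<tau>" using j n \<tau> by (intro mult_right_mono) auto
    moreover have "0 \<le> real j * \<tau>" using \<tau> by simp
    ultimately have s: "t - real j * \<tau> \<in> {0..T}" using t by (auto simp: t_def)
    have "norm (f 0 (t - real j * \<tau>) - (\<Sum>i\<le>k. f i t * (t - real j * \<tau> - t) ^ i / fact i))
        \<le> M * norm (t - real j * \<tau> - t) ^ Suc k / fact k"
      by (rule field_Taylor[where S="{0..T}"]) (use f M t s in auto)
    then have "\<bar>R j\<bar> \<le> M * (real j * \<tau>) ^ Suc k / fact k"
      using \<tau> by (simp add: R_def abs_mult)
    also have "\<dots> \<le> M * (real j * \<tau>) ^ Suc k / 1"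
      using M0 \<tau> by (intro divide_left_mono mult_nonneg_nonneg) (auto simp: fact_ge_1)
    also have "\<dots> \<le> M * (real k * \<tau>) ^ Suc k"
      using M0 \<tau> j by (simp only: div_by_1) (intro mult_left_mono power_mono mult_right_mono mult_nonneg_nonneg, auto)
    finally show ?thesis .
  qed
  have poly: "(\<Sum>j<k. bdf_b k j * ((\<Sum>i\<le>k. f i t * (- (real j * \<tau>)) ^ i / fact i) - (\<Sum>i\<le>k. f i t * (- (real (Suc j) * \<tau>)) ^ i / fact i)))
      = \<tau> * f 1 t"
  proof -
    have "(\<Sum>j<k. bdf_b k j * ((\<Sum>i\<le>k. f i t * (- (real j * \<tau>)) ^ i / fact i) - (\<Sum>i\<le>k. f i t * (- (real (Suc j) * \<tau>)) ^ i / fact i)))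
        = (\<Sum>j<k. \<Sum>i\<le>k. f i t * \<tau> ^ i / fact i * (bdf_b k j * ((- real j) ^ i - (- real (Suc j)) ^ i)))"
    proof (rule sum.cong[OF refl])
      fix j
      have pw: "(- (c * \<tau>)) ^ i = (- c) ^ i * \<tau> ^ i" for c i by (simp flip: power_mult_distrib)
      show "bdf_b k j * ((\<Sum>i\<le>k. f i t * (- (real j * \<tau>)) ^ i / fact i) - (\<Sum>i\<le>k. f i t * (- (real (Suc j) * \<tau>)) ^ i / fact i))
          = (\<Sum>i\<le>k. f i t * \<tau> ^ i / fact i * (bdf_b k j * ((- real j) ^ i - (- real (Suc j)) ^ i)))"
        unfolding sum_subtractf[symmetric] sum_distrib_left
        by (intro sum.cong refl) (simp only: pw right_diff_distrib diff_divide_distrib times_divide_eq_right times_divide_eq_left, simp only: mult_ac)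
    qed
    also have "\<dots> = (\<Sum>i\<le>k. f i t * \<tau> ^ i / fact i * (\<Sum>j<k. bdf_b k j * ((- real j) ^ i - (- real (Suc j)) ^ i)))"
      by (subst sum.swap) (simp only: sum_distrib_left)
    also have "\<dots> = (\<Sum>i\<le>k. f i t * \<tau> ^ i / fact i * of_bool (i = 1))"
      by (intro sum.cong refl arg_cong2[where f="(*)"] bdf_moments[OF k]) simp
    also have "\<dots> = (\<Sum>i\<in>{1}. f i t * \<tau> ^ i / fact i * of_bool (i = 1))"
      using k by (intro sum.mono_neutral_right) auto
    finally show ?thesis by simp
  qed
  have "bdf_D k \<tau> (\<lambda>m. f 0 (real m * \<tau>)) n = 1 / \<tau> * (\<Sum>j<k. bdf_b k j * (f 0 (t - real j * \<tau>) - f 0 (t - real (Suc j) * \<tau>)))"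
  proof -
    have "bdiff (\<lambda>m. f 0 (real m * \<tau>)) (n - j) = f 0 (t - real j * \<tau>) - f 0 (t - real (Suc j) * \<tau>)" if "j < k" for j
    proof -
      have "real (n - j) * \<tau> = t - real j * \<tau>" "real (n - j - 1) * \<tau> = t - real (Suc j) * \<tau>"
        using n that by (simp_all add: t_def of_nat_diff algebra_simps)
      then show ?thesis by (simp only: bdiff_def)
    qed
    then show ?thesis
      unfolding bdf_D_def bdf_sum_eq[OF k n(1)]
      by (intro arg_cong2[where f="(*)"] refl sum.cong) simp
  qed
  also have "(\<Sum>j<k. bdf_b k j * (f 0 (t - real j * \<tau>) - f 0 (t - real (Suc j) * \<tau>))) = \<tau> * f 1 t + (\<Sum>j<k. bdf_b k j * (R j - R (Suc j)))"
    unfolding poly[symmetric] sum.distrib[symmetric] by (rule sum.cong) (simp_all add: R_def algebra_simps)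
  finally have "bdf_D k \<tau> (\<lambda>m. f 0 (real m * \<tau>)) n - f 1 t = 1 / \<tau> * (\<Sum>j<k. bdf_b k j * (R j - R (Suc j)))"
    using \<tau> by (simp add: field_simps)
  moreover have "\<bar>\<Sum>j<k. bdf_b k j * (R j - R (Suc j))\<bar> \<le> (\<Sum>j<k. \<bar>bdf_b k j\<bar> * (2 * (M * (real k * \<tau>) ^ Suc k)))"
  proof (rule order_trans[OF sum_abs sum_mono])
    fix j assume "j \<in> {..<k}"
    then have "\<bar>R j\<bar> \<le> M * (real k * \<tau>) ^ Suc k" "\<bar>R (Suc j)\<bar> \<le> M * (real k * \<tau>) ^ Suc k"
      by (auto intro!: R simp del: power_Suc)
    then have "\<bar>R j - R (Suc j)\<bar> \<le> 2 * (M * (real k * \<tau>) ^ Suc k)" by linarith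
    then show "\<bar>bdf_b k j * (R j - R (Suc j))\<bar> \<le> \<bar>bdf_b k j\<bar> * (2 * (M * (real k * \<tau>) ^ Suc k))"
      unfolding abs_mult by (rule mult_left_mono) simp
  qed
  moreover have "(\<Sum>j<k. \<bar>bdf_b k j\<bar> * (2 * (M * (real k * \<tau>) ^ Suc k))) = \<tau> * (2 * bdf_l1 k * real k ^ Suc k * M * \<tau> ^ k)"
    unfolding sum_distrib_right[symmetric] bdf_l1_def[symmetric] by (simp add: power_mult_distrib mult_ac)
  moreover have "\<bar>1 / \<tau> * S\<bar> \<le> K" if "\<bar>S\<bar> \<le> \<tau> * K" for S K :: real
    using that \<tau> by (simp add: abs_mult field_simps)
  ultimately show ?thesis by (simp only: t_def[symmetric])
qed

lemma time_deriv_works: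
  assumes "C_time (Suc m) T u" "t \<in> {0..T}"
  shows "((\<lambda>t. u t x) has_field_derivative time_deriv T u t x) (at t within {0..T})"
  using assms by (auto simp: has_real_derivative_iff_has_vector_derivative time_deriv_def
      vector_derivative_works[symmetric] differentiable_on_def)

lemma C_time_iterate: "C_time (i + m) T u \<Longrightarrow> C_time m T ((time_deriv T ^^ i) u)"
  by (induction i arbitrary: m u) (auto simp: funpow_Suc_right simp del: funpow.simps)

lemma C_time_continuous: "C_time m T u \<Longrightarrow> continuous_on ({0..T} \<times> UNIV) (\<lambda>(t, x). u t x)"
  by (cases m) auto

context lattice
begin

text \<open>
  A derivative within \<open>[0,T]\<close> depends on the values at times in \<open>[0,T]\<close>, where periodicity is known.
\<close>

lemma periodic_time_deriv:
  assumes u: "C_time (Suc m) T u" and per: "\<And>t. t \<in> {0..T} \<Longrightarrow> periodic p q (u t)" and T: "0 < T" and t: "t \<in> {0..T}"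
  shows "periodic p q (time_deriv T u t)"
proof -
  have "time_deriv T u t y = time_deriv T u t x" if "\<And>s. s \<in> {0..T} \<Longrightarrow> u s y = u s x" for x y
  proof -
    have *: "((\<lambda>s. u s x) has_vector_derivative time_deriv T u t x) (at t within {0..T})"
      using time_deriv_works[OF u t] by (simp add: has_real_derivative_iff_has_vector_derivative)
    have "((\<lambda>s. u s y) has_vector_derivative time_deriv T u t x) (at t within {0..T})"
      by (rule has_vector_derivative_transform[OF t _ *]) (simp add: that)
    then show ?thesis
      unfolding time_deriv_def[of T u t y] by (rule vector_derivative_within_closed_interval[OF T t])
  qed
  note eq = this
  show ?thesis
    unfolding periodic_def
  proof (intro allI conjI)
    fix x
    show "time_deriv T u t (x + p) = time_deriv T u t x" "time_deriv T u t (x + q) = time_deriv T u t x"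
      using per unfolding periodic_def by (intro eq; blast)+
  qed
qed

lemma time_iterate_periodic:
  assumes u: "C_time (i + m) T u" and per: "\<And>t. t \<in> {0..T} \<Longrightarrow> periodic p q (u t)" and T: "0 < T" and t: "t \<in> {0..T}"
  shows "periodic p q ((time_deriv T ^^ i) u t)"
  using u t
proof (induction i arbitrary: m t)
  case 0
  then show ?case using per by simp
next
  case (Suc i)
  have "C_time (i + Suc m) T u" using Suc.prems(1) by simp
  then have "C_time (Suc m) T ((time_deriv T ^^ i) u)" "\<And>t. t \<in> {0..T} \<Longrightarrow> periodic p q ((time_deriv T ^^ i) u t)"
    using C_time_iterate Suc.IH by blast+
  from periodic_time_deriv[OF this T Suc.prems(2)] show ?case by simp
qed

text \<open>
  The bound is uniform in space because the time derivative of order \<open>k + 1\<close> is periodic and continuous, hence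
  bounded on \<open>[0,T]\<close> times the plane.
\<close>

lemma truncation_error:
  assumes k: "k \<in> {3, 4, 5}" and u: "C_time (k + 1) T u" and per: "\<And>t. t \<in> {0..T} \<Longrightarrow> periodic p q (u t)" and T: "0 < T"
  obtains B where "0 \<le> B"
    and "\<And>\<tau> n x. 0 < \<tau> \<Longrightarrow> k \<le> n \<Longrightarrow> real n * \<tau> \<le> T \<Longrightarrow>
      \<bar>bdf_D k \<tau> (\<lambda>m. u (real m * \<tau>) x) n - time_deriv T u (real n * \<tau>) x\<bar> \<le> B * \<tau> ^ k"
proof -
  define U where "U i = (time_deriv T ^^ i) u" for i
  have CU: "C_time (Suc (k - i)) T (U i)" if "i \<le> k" for i
    unfolding U_def using u that by (intro C_time_iterate) simp
  have C: "continuous_on ({0..T} \<times> UNIV) (\<lambda>(t, x). U (Suc k) t x)"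
    unfolding U_def using C_time_continuous[OF C_time_iterate[of "Suc k" 0]] u by simp
  define K where "K = {0..T} \<times> cball (0::real^2) (norm p + norm q)"
  have "compact ((\<lambda>(t, x). U (Suc k) t x) ` K)"
    by (intro compact_continuous_image continuous_on_subset[OF C]) (auto simp: K_def intro!: compact_Times)
  then have "bounded ((\<lambda>(t, x). U (Suc k) t x) ` K)" by (rule compact_imp_bounded)
  then obtain M where "\<forall>y\<in>(\<lambda>(t, x). U (Suc k) t x) ` K. norm y \<le> M" unfolding bounded_iff by blast
  then have M: "\<bar>U (Suc k) t x\<bar> \<le> M" if "(t, x) \<in> K" for t x using that by force
  have M': "\<bar>U (Suc k) t x\<bar> \<le> M" if t: "t \<in> {0..T}" for t x
  proof -
    have "periodic p q (U (Suc k) t)"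
      unfolding U_def by (rule time_iterate_periodic[of _ 0]) (use u per T t in auto)
    then obtain y where "y \<in> cell p q" "U (Suc k) t y = U (Suc k) t x" using periodic_rep[of x] by metis
    then show ?thesis using M[of t y] t cell_subset_cball by (auto simp: K_def)
  qed
  have M0: "0 \<le> M" using M'[of 0 0] T by simp
  show ?thesis
  proof (rule that)
    show "0 \<le> 2 * bdf_l1 k * real k ^ Suc k * M" using M0 bdf_l1_pos[OF k] by simp
    fix \<tau> :: real and n x assume *: "0 < \<tau>" "k \<le> n" "real n * \<tau> \<le> T"
    have "\<bar>bdf_D k \<tau> (\<lambda>m. U 0 (real m * \<tau>) x) n - U 1 (real n * \<tau>) x\<bar> \<le> 2 * bdf_l1 k * real k ^ Suc k * M * \<tau> ^ k"
    proof (rule bdf_consistency[OF k, where f="\<lambda>i t. U i t x" and T=T])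
      show "((\<lambda>t. U i t x) has_field_derivative U (Suc i) t x) (at t within {0..T})" if "i \<le> k" "t \<in> {0..T}" for i t
        using time_deriv_works[OF CU[OF that(1)] that(2)] by (simp add: U_def)
    qed (use M' * in auto)
    then show "\<bar>bdf_D k \<tau> (\<lambda>m. u (real m * \<tau>) x) n - time_deriv T u (real n * \<tau>) x\<bar> \<le> 2 * bdf_l1 k * real k ^ Suc k * M * \<tau> ^ k"
      by (simp add: U_def)
  qed
qed

end

section \<open>Stability of the error equation\<close>

text \<open>
  Dividing the hypothesis at the index where \<open>y\<close> is largest by this largest value linearizes it; the
  last term of the sum is absorbed since \<open>c \<le> 1/2\<close>, which explains the factors \<open>2\<close>.
\<close>

lemma gronwall_quadratic:
  fixes y g :: "nat \<Rightarrow> real"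
  assumes y: "\<And>l. l \<le> Suc M \<Longrightarrow> 0 \<le> y l" and g: "\<And>l. 0 \<le> g l" and c: "0 \<le> c" "c \<le> 1/2"
    and rec: "\<And>m. m \<le> M \<Longrightarrow> (y (Suc m))\<^sup>2 \<le> (y 0)\<^sup>2 + (\<Sum>l\<le>m. y (Suc l) * g l) + c * (\<Sum>l\<le>m. (y (Suc l))\<^sup>2)"
  shows "y (Suc M) \<le> 2 * (y 0 + (\<Sum>l\<le>M. g l)) * exp (2 * c * real (Suc M))"
proof -
  define P where "P = 2 * (y 0 + (\<Sum>l\<le>M. g l))"
  have P0: "0 \<le> P" unfolding P_def using y[of 0] g by (simp add: sum_nonneg)
  have lin: "y (Suc m) \<le> P + 2 * c * (\<Sum>l<m. y (Suc l))" if m: "m \<le> M" for m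
  proof -
    define Y where "Y = Max (y ` {..Suc m})"
    have Yle: "y l \<le> Y" if "l \<le> Suc m" for l unfolding Y_def using that by (intro Max_ge) auto
    have "Y \<in> y ` {..Suc m}" unfolding Y_def by (intro Max_in) auto
    then obtain r where r: "r \<le> Suc m" "Y = y r" by auto
    define Z where "Z = y 0 + (\<Sum>l\<le>M. g l) + c * (\<Sum>l\<le>m. y (Suc l))"
    have nn: "0 \<le> (\<Sum>l\<le>M. g l)" "0 \<le> c * (\<Sum>l\<le>m. y (Suc l))" "0 \<le> y 0"
      using g c y m by (auto intro!: sum_nonneg mult_nonneg_nonneg)
    have "Y \<le> Z"
    proof (cases r)
      case 0
      then show ?thesis using r nn by (simp add: Z_def)
    next
      case (Suc r')
      then have r': "r' \<le> m" using r by simp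
      have Y0: "0 \<le> Y" using r y[of r] m by simp
      have "Y\<^sup>2 \<le> (y 0)\<^sup>2 + (\<Sum>l\<le>r'. y (Suc l) * g l) + c * (\<Sum>l\<le>r'. (y (Suc l))\<^sup>2)"
        using rec[of r'] r' m Suc r by simp
      also have "(y 0)\<^sup>2 \<le> Y * y 0"
        unfolding power2_eq_square using Yle[of 0] nn by (intro mult_right_mono) auto
      also have "(\<Sum>l\<le>r'. y (Suc l) * g l) \<le> (\<Sum>l\<le>r'. Y * g l)"
        using r' Yle g by (intro sum_mono mult_right_mono) auto
      also have "\<dots> \<le> (\<Sum>l\<le>M. Y * g l)"
        using r' m g Y0 by (intro sum_mono2) auto
      also have "(\<Sum>l\<le>r'. (y (Suc l))\<^sup>2) \<le> (\<Sum>l\<le>r'. Y * y (Suc l))"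
        unfolding power2_eq_square using r' m Yle y by (intro sum_mono mult_right_mono) auto
      also have "\<dots> \<le> (\<Sum>l\<le>m. Y * y (Suc l))"
        using r' m y Y0 by (intro sum_mono2) auto
      finally have "Y * Y \<le> Y * Z"
        using c by (simp add: Z_def power2_eq_square sum_distrib_left distrib_left mult_left_mono mult.left_commute)
      then show ?thesis using Y0 nn by (cases "Y = 0") (auto simp: Z_def)
    qed
    then have "y (Suc m) \<le> y 0 + (\<Sum>l\<le>M. g l) + c * (\<Sum>l<m. y (Suc l)) + c * y (Suc m)"
      using Yle[of "Suc m"] by (simp add: Z_def lessThan_Suc_atMost[symmetric] distrib_left)
    moreover have "c * y (Suc m) \<le> 1/2 * y (Suc m)" using c y m by (intro mult_right_mono) auto
    moreover have "a \<le> 2 * b + 2 * d" if "a \<le> b + d + r" "r \<le> 1/2 * a" for a b d r :: real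
      using that by linarith
    ultimately have "y (Suc m) \<le> 2 * (y 0 + (\<Sum>l\<le>M. g l)) + 2 * (c * (\<Sum>l<m. y (Suc l)))" by blast
    then show ?thesis by (simp add: P_def)
  qed
  have pow: "P + 2 * c * (\<Sum>l<m. y (Suc l)) \<le> P * (1 + 2 * c) ^ m" if "m \<le> Suc M" for m
    using that
  proof (induction m)
    case (Suc m)
    have "P + 2 * c * (\<Sum>l<Suc m. y (Suc l)) = (P + 2 * c * (\<Sum>l<m. y (Suc l))) + 2 * c * y (Suc m)"
      by (simp add: distrib_left)
    also have "2 * c * y (Suc m) \<le> 2 * c * (P + 2 * c * (\<Sum>l<m. y (Suc l)))"
      using lin[of m] Suc.prems c by (intro mult_left_mono) auto
    also have "(P + 2 * c * (\<Sum>l<m. y (Suc l))) + \<dots> = (1 + 2 * c) * (P + 2 * c * (\<Sum>l<m. y (Suc l)))"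
      by (simp add: algebra_simps)
    also have "\<dots> \<le> (1 + 2 * c) * (P * (1 + 2 * c) ^ m)"
      using Suc c by (intro mult_left_mono) auto
    finally show ?case by (simp add: mult_ac)
  qed simp
  have "y (Suc M) \<le> P * (1 + 2 * c) ^ M" using lin[of M] pow[of M] by simp
  also have "\<dots> \<le> P * (1 + 2 * c) ^ Suc M" using P0 c by (intro mult_left_mono power_increasing) auto
  also have "\<dots> \<le> P * exp (2 * c) ^ Suc M"
    using P0 c exp_ge_add_one_self[of "2 * c"] by (intro mult_left_mono power_mono) auto
  also have "exp (2 * c) ^ Suc M = exp (2 * c * real (Suc M))"
    by (simp only: exp_of_nat_mult[symmetric] mult.commute)
  finally show ?thesis by (simp add: P_def)
qed

lemma bdf_D_diff: "bdf_D k \<tau> (\<lambda>m. u m - v m) n = bdf_D k \<tau> u n - bdf_D k \<tau> v n"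
proof -
  have "bdiff (\<lambda>m. u m - v m) j = bdiff u j - bdiff v j" for j by (simp add: bdiff_def)
  then show ?thesis by (simp only: bdf_D_def right_diff_distrib sum_subtractf)
qed

text \<open>
  \<open>doc_bdf_initial\<close>, solved for the newest difference.
\<close>

lemma doc_recover_difference:
  assumes k: "k \<in> {3, 4, 5}" and \<tau>: "\<tau> \<noteq> 0"
  shows "bdiff v (k + l) = \<tau> * conv (doc k) (\<lambda>j. bdf_D k \<tau> v (k + j)) l - v_init k v (k + l)"
proof -
  have "(\<Sum>i=1..k + j. bdf_b k (k + j - i) * bdiff v i) = \<tau> * bdf_D k \<tau> v (k + j)" for j
    using \<tau> by (simp add: bdf_D_def)
  then have "conv (doc k) (\<lambda>j. \<tau> * bdf_D k \<tau> v (k + j)) l = bdiff v (k + l) + v_init k v (k + l)"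
    using doc_bdf_initial[OF k, of v l] by (simp only:)
  moreover have "conv (doc k) (\<lambda>j. \<tau> * bdf_D k \<tau> v (k + j)) l = \<tau> * conv (doc k) (\<lambda>j. bdf_D k \<tau> v (k + j)) l"
    by (simp add: conv_def sum_distrib_left mult.left_commute)
  ultimately show ?thesis by simp
qed

context lattice
begin

lemma L2norm_mono:
  assumes "Cper p q 0 f" "Cper p q 0 g" "\<And>x. \<bar>f x\<bar> \<le> g x"
  shows "L2norm p q f \<le> L2norm p q g"
proof (rule power2_le_imp_le)
  have "(f x)\<^sup>2 \<le> (g x)\<^sup>2" for x using assms(3)[of x] by (simp add: abs_le_square_iff[symmetric])
  then show "(L2norm p q f)\<^sup>2 \<le> (L2norm p q g)\<^sup>2"
    unfolding L2norm_sq by (intro cint_mono0 Cper_power assms)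
qed (rule L2norm_nonneg)

lemma L2norm_cmult: "0 \<le> c \<Longrightarrow> L2norm p q (\<lambda>x. c * f x) = c * L2norm p q f"
  by (rule power2_eq_imp_eq) (simp_all add: L2norm_sq power_mult_distrib cint_cmult L2norm_nonneg)

lemma L2norm_abs: "L2norm p q (\<lambda>x. \<bar>f x\<bar>) = L2norm p q f"
  by (simp add: L2norm_def ip_def)

lemma Cper_abs: "Cper p q 0 f \<Longrightarrow> Cper p q 0 (\<lambda>x. \<bar>f x\<bar>)"
  by (auto simp: Cper_def periodic_def intro: continuous_intros)

lemma L2norm_sum:
  assumes "finite A" "\<And>j. j \<in> A \<Longrightarrow> Cper p q 0 (f j)"
  shows "L2norm p q (\<lambda>x. \<Sum>j\<in>A. f j x) \<le> (\<Sum>j\<in>A. L2norm p q (f j))"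
  using assms
proof (induction A rule: finite_induct)
  case empty
  then show ?case by (simp add: L2norm_def ip_def)
next
  case (insert a A)
  have "L2norm p q (\<lambda>x. f a x + (\<Sum>j\<in>A. f j x)) \<le> L2norm p q (f a) + L2norm p q (\<lambda>x. \<Sum>j\<in>A. f j x)"
    using insert.prems by (intro L2norm_triangle Cper_sum) auto
  then show ?case using insert by simp
qed

lemma Cper_conv: "(\<And>j. j \<le> l \<Longrightarrow> Cper p q m (f j)) \<Longrightarrow> Cper p q m (\<lambda>x. conv a (\<lambda>j. f j x) l)"
  unfolding conv_def by (intro Cper_sum Cper_cmult) auto

text \<open>
  In terms of the spectral parameter \<open>s\<close> of \<open>-\<Delta>\<close> this is
  \<open>s (1 - s)\<^sup>2 - 4s\<^sup>2 + 29 = s (s - 4)\<^sup>2 + 2 (s - 15/4)\<^sup>2 + 7/8\<close>. The first two terms correspond to the squared norms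
  of the gradient of \<open>\<Delta>u + 4u\<close> and of \<open>\<Delta>u + 15/4 u\<close>.
\<close>

lemma interpolation:
  assumes u: "Cper p q 6 u"
  shows "0 \<le> (\<Sum>i\<in>UNIV. cint (\<lambda>x. (partial_deriv i (one_plus_laplacian u) x)\<^sup>2))
      - 4 * cint (\<lambda>x. (laplacian u x)\<^sup>2) + 29 * cint (\<lambda>x. (u x)\<^sup>2)"
proof -
  have u2: "Cper p q 2 u" and "Cper p q (Suc (Suc 2)) u" using u by (auto intro: Cper_mono)
  then have Lu: "Cper p q 2 (laplacian u)" by (auto intro: Cper_laplacian)
  then have "Cper p q (Suc (Suc 0)) (laplacian u)" by (simp add: numeral_2_eq_2)
  then have C: "Cper p q 0 u" "Cper p q 0 (laplacian u)" "Cper p q 0 (laplacian (laplacian u))"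
    using u2 Lu by (auto intro: Cper_mono intro!: Cper_laplacian)
  define N0 N1 N2 N3 where "N0 = cint (\<lambda>x. (u x)\<^sup>2)" and "N1 = cint (\<lambda>x. - (laplacian u x * u x))"
    and "N2 = cint (\<lambda>x. (laplacian u x)\<^sup>2)" and "N3 = cint (\<lambda>x. - (laplacian (laplacian u) x * laplacian u x))"
  have sq: "cint (\<lambda>x. (laplacian u x + c * u x)\<^sup>2) = N2 - 2 * c * N1 + c\<^sup>2 * N0" for c
    unfolding N0_def N1_def N2_def by (rule cint_laplacian_shift_sq[OF u2])
  have grad: "(\<Sum>i\<in>UNIV. cint (\<lambda>x. (partial_deriv i (\<lambda>x. laplacian u x + c * u x) x)\<^sup>2)) = N3 - 2 * c * N2 + c\<^sup>2 * N1" for c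
  proof -
    have lap: "laplacian (\<lambda>x. laplacian u x + c * u x) = (\<lambda>x. laplacian (laplacian u) x + c * laplacian u x)"
    proof -
      have "C_space 2 u" "C_space 2 (laplacian u)" using u2 Lu by (simp_all add: Cper_def)
      then show ?thesis by (simp only: laplacian_add C_space_cmult laplacian_cmult)
    qed
    have "(\<Sum>i\<in>UNIV. cint (\<lambda>x. (partial_deriv i (\<lambda>x. laplacian u x + c * u x) x)\<^sup>2))
        = cint (\<lambda>x. - (laplacian (\<lambda>x. laplacian u x + c * u x) x * (laplacian u x + c * u x)))"
      using grad_norm[of "\<lambda>x. laplacian u x + c * u x"] Cper_add[OF Lu Cper_cmult[OF u2]] by (simp only: cint_minus)
    also have "\<dots> = cint (\<lambda>x. 1 * (1 * - (laplacian (laplacian u) x * laplacian u x) + (-c) * (laplacian u x)\<^sup>2)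
        + 1 * ((-c) * (laplacian (laplacian u) x * u x) + c\<^sup>2 * - (laplacian u x * u x)))"
      unfolding lap by (simp add: power2_eq_square algebra_simps)
    also have "\<dots> = 1 * cint (\<lambda>x. 1 * - (laplacian (laplacian u) x * laplacian u x) + (-c) * (laplacian u x)\<^sup>2)
        + 1 * cint (\<lambda>x. (-c) * (laplacian (laplacian u) x * u x) + c\<^sup>2 * - (laplacian u x * u x))"
      by (intro cint_lincomb0 Cper_add Cper_cmult Cper_minus Cper_mult Cper_power C)
    also have "cint (\<lambda>x. 1 * - (laplacian (laplacian u) x * laplacian u x) + (-c) * (laplacian u x)\<^sup>2) = 1 * N3 + (-c) * N2"
      unfolding N3_def N2_def by (intro cint_lincomb0 Cper_minus Cper_mult Cper_power C)
    also have "cint (\<lambda>x. (-c) * (laplacian (laplacian u) x * u x) + c\<^sup>2 * - (laplacian u x * u x))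
        = (-c) * cint (\<lambda>x. laplacian (laplacian u) x * u x) + c\<^sup>2 * N1"
      unfolding N1_def by (intro cint_lincomb0 Cper_minus Cper_mult C)
    also have "cint (\<lambda>x. laplacian (laplacian u) x * u x) = N2"
      using laplacian_symmetric[OF Lu u2] by (simp add: N2_def power2_eq_square)
    finally show ?thesis by simp
  qed
  have "one_plus_laplacian u = (\<lambda>x. laplacian u x + 1 * u x)" by (simp add: one_plus_laplacian_def fun_eq_iff)
  then have L: "(\<Sum>i\<in>UNIV. cint (\<lambda>x. (partial_deriv i (one_plus_laplacian u) x)\<^sup>2)) = N3 - 2 * N2 + N1"
    using grad[of 1] by (simp only:) simp
  have "0 \<le> N3 - 8 * N2 + 16 * N1"
    using grad[of 4] grad_nonneg[of "\<lambda>x. laplacian u x + 4 * u x"] by simp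
  moreover have "0 \<le> N2 - 15/2 * N1 + 225/16 * N0"
    using sq[of "15/4"] cint_sq_nonneg[of "\<lambda>x. laplacian u x + 15/4 * u x"] by (simp add: power2_eq_square)
  moreover have "0 \<le> N0" unfolding N0_def by (rule cint_sq_nonneg)
  ultimately show ?thesis unfolding L N2_def[symmetric] N0_def[symmetric] by linarith
qed

lemma cint_biharmonic:
  assumes u: "Cper p q 6 u" and v: "Cper p q 6 v"
  shows "cint (\<lambda>x. u x * laplacian (one_plus_laplacian (one_plus_laplacian v)) x)
      = - (\<Sum>i\<in>UNIV. cint (\<lambda>x. partial_deriv i (one_plus_laplacian u) x * partial_deriv i (one_plus_laplacian v) x))"
proof -
  let ?L = one_plus_laplacian
  have six: "6 = Suc (Suc (Suc (Suc 2)))" by simp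
  have u2: "Cper p q 2 u" using u by (rule Cper_mono) simp
  have Du: "Cper p q 2 (laplacian u)" "Cper p q 2 (?L u)"
    using Cper_mono[OF u, of "Suc (Suc 2)"] by (auto intro: Cper_laplacian Cper_one_plus_laplacian)
  have "Cper p q (Suc (Suc 2)) (?L v)" using v unfolding six by (rule Cper_one_plus_laplacian)
  then have Lv: "Cper p q 2 (?L v)" "Cper p q 1 (?L v)" "Cper p q 2 (?L (?L v))"
    by (auto intro: Cper_mono Cper_one_plus_laplacian)
  \<comment> \<open>Moving \<open>\<Delta>\<close> and one factor \<open>L\<close> from \<open>v\<close> to \<open>u\<close>, where they commute, leaves one gradient on each side.\<close>
  have comm: "?L (laplacian u) = laplacian (?L u)"
  proof -
    have "C_space 2 u" "C_space 2 (laplacian u)" using u2 Du by (simp_all add: Cper_def)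
    then show ?thesis unfolding one_plus_laplacian_def[abs_def] by (simp only: laplacian_add)
  qed
  have "cint (\<lambda>x. u x * laplacian (?L (?L v)) x) = cint (\<lambda>x. laplacian u x * ?L (?L v) x)"
    by (rule laplacian_symmetric[OF u2 Lv(3), symmetric])
  also have "\<dots> = cint (\<lambda>x. laplacian (?L u) x * ?L v x)"
    unfolding comm[symmetric] by (rule cint_one_plus_laplacian[OF Du(1) Lv(1), symmetric])
  also have "\<dots> = - (\<Sum>i\<in>UNIV. cint (\<lambda>x. partial_deriv i (?L u) x * partial_deriv i (?L v) x))"
    by (rule green[OF Du(2) Lv(2)])
  finally show ?thesis .
qed

lemma cint_conv:
  assumes "Cper p q 0 u" "\<And>j. j \<le> l \<Longrightarrow> Cper p q 0 (f j)"
  shows "cint (\<lambda>x. u x * conv a (\<lambda>j. f j x) l) = conv a (\<lambda>j. cint (\<lambda>x. u x * f j x)) l"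
proof -
  have "cint (\<lambda>x. u x * conv a (\<lambda>j. f j x) l) = cint (\<lambda>x. \<Sum>j\<le>l. a (l - j) * (u x * f j x))"
    by (simp add: conv_def sum_distrib_left mult.left_commute)
  also have "\<dots> = (\<Sum>j\<le>l. cint (\<lambda>x. a (l - j) * (u x * f j x)))"
    using assms by (intro cint_sum0 Cper_cmult Cper_mult) auto
  finally show ?thesis by (simp only: cint_cmult conv_def)
qed

lemma conv_uminus: "conv a (\<lambda>j. - f j) l = - conv a f l"
  by (simp add: conv_def sum_negf)

lemma conv_sum: "conv a (\<lambda>j. \<Sum>i\<in>A. f i j) l = (\<Sum>i\<in>A. conv a (f i) l)"
  unfolding conv_def sum_distrib_left by (rule sum.swap)

text \<open>
  Each convolution is estimated pointwise in space, after the derivatives have been distributed: the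
  linear part becomes the coercive form in \<open>\<partial>\<^sub>iLE\<close>, and in the nonlinear part both derivatives fall on \<open>E\<close>.
\<close>

lemma diffusion_estimate:
  assumes k: "k \<in> {3, 4, 5}" and m2: "(bdf_b k 0)\<^sup>2 \<le> m2"
    and E: "\<And>j. j \<le> m \<Longrightarrow> Cper p q 6 (E j)" and F: "\<And>j. j \<le> m \<Longrightarrow> Cper p q 2 (F j)"
    and FE: "\<And>j x. j \<le> m \<Longrightarrow> \<bar>F j x\<bar> \<le> c3 * \<bar>E j x\<bar>"
  shows "2 * (\<Sum>l\<le>m. cint (\<lambda>x. E l x * conv (doc k) (\<lambda>j. laplacian (\<lambda>x. one_plus_laplacian (one_plus_laplacian (E j)) x + F j x) x) l))
      \<le> const_c4 k m2 c3 * (\<Sum>l\<le>m. cint (\<lambda>x. (E l x)\<^sup>2))"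
proof -
  let ?L = one_plus_laplacian and ?\<theta> = "doc k"
  obtain a where a: "0 < a"
    and coercive: "\<And>f m. a * (\<Sum>l\<le>m. (f l)\<^sup>2) \<le> 2 * (\<Sum>l\<le>m. f l * conv ?\<theta> f l)"
    and young: "\<And>f g m. 2 * (\<Sum>l\<le>m. g l * conv ?\<theta> f l)
           \<le> 2 * m2 * m3_bdf k / (m1_bdf k)\<^sup>2 * (\<Sum>l\<le>m. (f l)\<^sup>2) + 4 * a * (\<Sum>l\<le>m. (g l)\<^sup>2)"
    and a29: "29 * a \<le> 250 * m2\<^sup>2 / m1_bdf k ^ 5"
    by (rule doc_estimates[OF k m2]) (rule that)
  define s where "s = 2 * m2 * m3_bdf k / (m1_bdf k)\<^sup>2"
  have "0 \<le> m2" using m2 zero_le_power2 order_trans by blast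
  then have s: "0 \<le> s" using k by (auto simp: s_def m3_bdf_def rho_bdf_def)
  have six: "6 = Suc (Suc (Suc (Suc 2)))" by simp
  define G where "G i j = partial_deriv i (?L (E j))" for i j
  define H where "H j = laplacian (E j)" for j
  have LE: "Cper p q (Suc (Suc 2)) (?L (E j))" if "j \<le> m" for j
    using E[OF that] unfolding six by (rule Cper_one_plus_laplacian)
  have LLE: "Cper p q 2 (?L (?L (E j)))" if "j \<le> m" for j
    by (rule Cper_one_plus_laplacian[OF LE[OF that]])
  have GC: "Cper p q 0 (G i j)" if "j \<le> m" for i j
    unfolding G_def by (rule Cper_partial_deriv, rule Cper_mono[OF LE[OF that]]) simp
  have E2: "Cper p q 2 (E j)" and EC: "Cper p q 0 (E j)" if "j \<le> m" for j
    using Cper_mono[OF E[OF that]] by simp_all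
  have HC: "Cper p q 0 (H j)" if "j \<le> m" for j
    unfolding H_def by (rule Cper_laplacian, rule Cper_mono[OF E[OF that]]) simp
  have FC: "Cper p q 0 (F j)" if "j \<le> m" for j using Cper_mono[OF F[OF that]] by simp
  define R where "R j = laplacian (\<lambda>x. ?L (?L (E j)) x + F j x)" for j
  have RC: "Cper p q 0 (R j)" if "j \<le> m" for j
    unfolding R_def using LLE[OF that] F[OF that] by (intro Cper_laplacian Cper_add) (simp_all add: numeral_2_eq_2)
  have ER: "cint (\<lambda>x. E l x * R j x) = - (\<Sum>i\<in>UNIV. cint (\<lambda>x. G i l x * G i j x)) + cint (\<lambda>x. H l x * F j x)"
    if l: "l \<le> m" and j: "j \<le> m" for l j
  proof -
    have D1: "Cper p q 0 (laplacian (?L (?L (E j))))" "Cper p q 0 (laplacian (F j))"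
      using LLE[OF j] F[OF j] by (auto intro!: Cper_laplacian simp: numeral_2_eq_2)
    have "R j = (\<lambda>x. laplacian (?L (?L (E j))) x + laplacian (F j) x)"
      unfolding R_def using LLE[OF j] F[OF j] by (intro laplacian_add) (auto simp: Cper_def)
    then have "cint (\<lambda>x. E l x * R j x) = cint (\<lambda>x. E l x * laplacian (?L (?L (E j))) x + E l x * laplacian (F j) x)"
      by (simp add: distrib_left)
    also have "\<dots> = cint (\<lambda>x. E l x * laplacian (?L (?L (E j))) x) + cint (\<lambda>x. E l x * laplacian (F j) x)"
      by (intro cint_add0 Cper_mult EC l D1)
    also have "cint (\<lambda>x. E l x * laplacian (F j) x) = cint (\<lambda>x. H l x * F j x)"
      unfolding H_def by (rule laplacian_symmetric[OF E2[OF l] F[OF j], symmetric])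
    also have "cint (\<lambda>x. E l x * laplacian (?L (?L (E j))) x) = - (\<Sum>i\<in>UNIV. cint (\<lambda>x. G i l x * G i j x))"
      unfolding G_def by (rule cint_biharmonic[OF E[OF l] E[OF j]])
    finally show ?thesis .
  qed
  have term_eq: "cint (\<lambda>x. E l x * conv ?\<theta> (\<lambda>j. R j x) l)
      = - (\<Sum>i\<in>UNIV. cint (\<lambda>x. G i l x * conv ?\<theta> (\<lambda>j. G i j x) l)) + cint (\<lambda>x. H l x * conv ?\<theta> (\<lambda>j. F j x) l)"
    if l: "l \<le> m" for l
  proof -
    have "cint (\<lambda>x. E l x * conv ?\<theta> (\<lambda>j. R j x) l) = conv ?\<theta> (\<lambda>j. cint (\<lambda>x. E l x * R j x)) l"
      using l by (intro cint_conv EC RC) auto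
    also have "\<dots> = conv ?\<theta> (\<lambda>j. - (\<Sum>i\<in>UNIV. cint (\<lambda>x. G i l x * G i j x)) + cint (\<lambda>x. H l x * F j x)) l"
      unfolding conv_def using l by (intro sum.cong refl) (simp add: ER)
    also have "\<dots> = - (\<Sum>i\<in>UNIV. conv ?\<theta> (\<lambda>j. cint (\<lambda>x. G i l x * G i j x)) l) + conv ?\<theta> (\<lambda>j. cint (\<lambda>x. H l x * F j x)) l"
      by (simp only: conv_add conv_uminus conv_sum)
    also have "(\<Sum>i\<in>UNIV. conv ?\<theta> (\<lambda>j. cint (\<lambda>x. G i l x * G i j x)) l) = (\<Sum>i\<in>UNIV. cint (\<lambda>x. G i l x * conv ?\<theta> (\<lambda>j. G i j x) l))"
      using l by (intro sum.cong refl cint_conv[symmetric] GC) auto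
    also have "conv ?\<theta> (\<lambda>j. cint (\<lambda>x. H l x * F j x)) l = cint (\<lambda>x. H l x * conv ?\<theta> (\<lambda>j. F j x) l)"
      using l by (intro cint_conv[symmetric] HC FC) auto
    finally show ?thesis .
  qed
  have sumG: "a * (\<Sum>l\<le>m. cint (\<lambda>x. (G i l x)\<^sup>2)) \<le> 2 * (\<Sum>l\<le>m. cint (\<lambda>x. G i l x * conv ?\<theta> (\<lambda>j. G i j x) l))" for i
  proof -
    have "a * (\<Sum>l\<le>m. cint (\<lambda>x. (G i l x)\<^sup>2)) = cint (\<lambda>x. a * (\<Sum>l\<le>m. (G i l x)\<^sup>2))"
      unfolding cint_cmult by (subst cint_sum0) (auto intro!: Cper_power GC)
    also have "\<dots> \<le> cint (\<lambda>x. 2 * (\<Sum>l\<le>m. G i l x * conv ?\<theta> (\<lambda>j. G i j x) l))"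
      by (rule cint_mono0) (auto intro!: Cper_cmult Cper_sum Cper_power Cper_mult Cper_conv GC coercive)
    also have "\<dots> = 2 * (\<Sum>l\<le>m. cint (\<lambda>x. G i l x * conv ?\<theta> (\<lambda>j. G i j x) l))"
      unfolding cint_cmult by (subst cint_sum0) (auto intro!: Cper_mult Cper_conv GC)
    finally show ?thesis .
  qed
  have sumF: "2 * (\<Sum>l\<le>m. cint (\<lambda>x. H l x * conv ?\<theta> (\<lambda>j. F j x) l))
      \<le> s * c3\<^sup>2 * (\<Sum>l\<le>m. cint (\<lambda>x. (E l x)\<^sup>2)) + 4 * a * (\<Sum>l\<le>m. cint (\<lambda>x. (H l x)\<^sup>2))"
  proof -
    have "2 * (\<Sum>l\<le>m. cint (\<lambda>x. H l x * conv ?\<theta> (\<lambda>j. F j x) l)) = cint (\<lambda>x. 2 * (\<Sum>l\<le>m. H l x * conv ?\<theta> (\<lambda>j. F j x) l))"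
      unfolding cint_cmult by (subst cint_sum0) (auto intro!: Cper_mult Cper_conv HC FC)
    also have "\<dots> \<le> cint (\<lambda>x. s * c3\<^sup>2 * (\<Sum>l\<le>m. (E l x)\<^sup>2) + 4 * a * (\<Sum>l\<le>m. (H l x)\<^sup>2))"
    proof (rule cint_mono0)
      fix x
      have "(\<Sum>l\<le>m. (F l x)\<^sup>2) \<le> (\<Sum>l\<le>m. c3\<^sup>2 * (E l x)\<^sup>2)"
      proof (rule sum_mono)
        fix l assume "l \<in> {..m}"
        then have "\<bar>F l x\<bar> \<le> \<bar>c3 * E l x\<bar>" using FE[of l x] abs_ge_self[of c3] mult_right_mono[of c3 "\<bar>c3\<bar>" "\<bar>E l x\<bar>"]
          by (simp add: abs_mult)
        then show "(F l x)\<^sup>2 \<le> c3\<^sup>2 * (E l x)\<^sup>2"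
          by (simp only: abs_le_square_iff power_mult_distrib)
      qed
      then have "s * (\<Sum>l\<le>m. (F l x)\<^sup>2) \<le> s * c3\<^sup>2 * (\<Sum>l\<le>m. (E l x)\<^sup>2)"
        using s by (simp only: sum_distrib_left[symmetric] mult.assoc mult_left_mono)
      then show "2 * (\<Sum>l\<le>m. H l x * conv ?\<theta> (\<lambda>j. F j x) l) \<le> s * c3\<^sup>2 * (\<Sum>l\<le>m. (E l x)\<^sup>2) + 4 * a * (\<Sum>l\<le>m. (H l x)\<^sup>2)"
        using young[where f="\<lambda>j. F j x" and g="\<lambda>j. H j x" and m=m] unfolding s_def[symmetric] by linarith
    qed (auto intro!: Cper_add Cper_cmult Cper_sum Cper_power Cper_mult Cper_conv HC FC EC)
    also have "\<dots> = s * c3\<^sup>2 * cint (\<lambda>x. \<Sum>l\<le>m. (E l x)\<^sup>2) + 4 * a * cint (\<lambda>x. \<Sum>l\<le>m. (H l x)\<^sup>2)"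
      by (rule cint_lincomb0) (auto intro!: Cper_sum Cper_power EC HC)
    also have "cint (\<lambda>x. \<Sum>l\<le>m. (E l x)\<^sup>2) = (\<Sum>l\<le>m. cint (\<lambda>x. (E l x)\<^sup>2))"
      by (rule cint_sum0) (auto intro!: Cper_power EC)
    also have "cint (\<lambda>x. \<Sum>l\<le>m. (H l x)\<^sup>2) = (\<Sum>l\<le>m. cint (\<lambda>x. (H l x)\<^sup>2))"
      by (rule cint_sum0) (auto intro!: Cper_power HC)
    finally show ?thesis .
  qed
  have "2 * (\<Sum>l\<le>m. cint (\<lambda>x. E l x * conv ?\<theta> (\<lambda>j. R j x) l))
      = - (\<Sum>i\<in>UNIV. 2 * (\<Sum>l\<le>m. cint (\<lambda>x. G i l x * conv ?\<theta> (\<lambda>j. G i j x) l)))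
        + 2 * (\<Sum>l\<le>m. cint (\<lambda>x. H l x * conv ?\<theta> (\<lambda>j. F j x) l))"
  proof -
    have "(\<Sum>l\<le>m. cint (\<lambda>x. E l x * conv ?\<theta> (\<lambda>j. R j x) l))
      = (\<Sum>l\<le>m. - (\<Sum>i\<in>UNIV. cint (\<lambda>x. G i l x * conv ?\<theta> (\<lambda>j. G i j x) l)) + cint (\<lambda>x. H l x * conv ?\<theta> (\<lambda>j. F j x) l))"
      by (intro sum.cong refl term_eq) simp
    also have "\<dots> = - (\<Sum>i\<in>UNIV. \<Sum>l\<le>m. cint (\<lambda>x. G i l x * conv ?\<theta> (\<lambda>j. G i j x) l)) + (\<Sum>l\<le>m. cint (\<lambda>x. H l x * conv ?\<theta> (\<lambda>j. F j x) l))"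
      unfolding sum.distrib sum_negf by (subst sum.swap) (rule refl)
    finally show ?thesis by (simp only: sum_distrib_left[symmetric] distrib_left mult_minus_right)
  qed
  also have "\<dots> \<le> - (\<Sum>i\<in>UNIV. a * (\<Sum>l\<le>m. cint (\<lambda>x. (G i l x)\<^sup>2)))
      + (s * c3\<^sup>2 * (\<Sum>l\<le>m. cint (\<lambda>x. (E l x)\<^sup>2)) + 4 * a * (\<Sum>l\<le>m. cint (\<lambda>x. (H l x)\<^sup>2)))"
    by (intro add_mono sumF le_imp_neg_le sum_mono sumG)
  also have "(\<Sum>i\<in>UNIV. a * (\<Sum>l\<le>m. cint (\<lambda>x. (G i l x)\<^sup>2))) = a * (\<Sum>l\<le>m. \<Sum>i\<in>UNIV. cint (\<lambda>x. (G i l x)\<^sup>2))"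
    unfolding sum_distrib_left[symmetric] by (subst sum.swap) (rule refl)
  finally have 1: "2 * (\<Sum>l\<le>m. cint (\<lambda>x. E l x * conv ?\<theta> (\<lambda>j. R j x) l))
      \<le> - (a * (\<Sum>l\<le>m. \<Sum>i\<in>UNIV. cint (\<lambda>x. (G i l x)\<^sup>2)))
      + (s * c3\<^sup>2 * (\<Sum>l\<le>m. cint (\<lambda>x. (E l x)\<^sup>2)) + 4 * a * (\<Sum>l\<le>m. cint (\<lambda>x. (H l x)\<^sup>2)))" .
  have "(\<Sum>l\<le>m. 4 * cint (\<lambda>x. (H l x)\<^sup>2)) \<le> (\<Sum>l\<le>m. (\<Sum>i\<in>UNIV. cint (\<lambda>x. (G i l x)\<^sup>2)) + 29 * cint (\<lambda>x. (E l x)\<^sup>2))"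
  proof (rule sum_mono)
    fix l assume "l \<in> {..m}"
    then have "l \<le> m" by simp
    from interpolation[OF E[OF this]]
    show "4 * cint (\<lambda>x. (H l x)\<^sup>2) \<le> (\<Sum>i\<in>UNIV. cint (\<lambda>x. (G i l x)\<^sup>2)) + 29 * cint (\<lambda>x. (E l x)\<^sup>2)"
      unfolding G_def H_def by linarith
  qed
  then have "4 * (\<Sum>l\<le>m. cint (\<lambda>x. (H l x)\<^sup>2)) \<le> (\<Sum>l\<le>m. \<Sum>i\<in>UNIV. cint (\<lambda>x. (G i l x)\<^sup>2)) + 29 * (\<Sum>l\<le>m. cint (\<lambda>x. (E l x)\<^sup>2))"
    by (simp only: sum.distrib sum_distrib_left[symmetric])
  then have "a * (4 * (\<Sum>l\<le>m. cint (\<lambda>x. (H l x)\<^sup>2))) \<le> a * ((\<Sum>l\<le>m. \<Sum>i\<in>UNIV. cint (\<lambda>x. (G i l x)\<^sup>2)) + 29 * (\<Sum>l\<le>m. cint (\<lambda>x. (E l x)\<^sup>2)))"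
    using a by (intro mult_left_mono) auto
  with 1 have 2: "2 * (\<Sum>l\<le>m. cint (\<lambda>x. E l x * conv ?\<theta> (\<lambda>j. R j x) l)) \<le> (29 * a + s * c3\<^sup>2) * (\<Sum>l\<le>m. cint (\<lambda>x. (E l x)\<^sup>2))"
    by (simp add: algebra_simps)
  have "29 * a + s * c3\<^sup>2 \<le> const_c4 k m2 c3"
    using a29 by (simp add: const_c4_def s_def mult_ac)
  then have "(29 * a + s * c3\<^sup>2) * (\<Sum>l\<le>m. cint (\<lambda>x. (E l x)\<^sup>2)) \<le> const_c4 k m2 c3 * (\<Sum>l\<le>m. cint (\<lambda>x. (E l x)\<^sup>2))"
    by (intro mult_right_mono sum_nonneg cint_sq_nonneg)
  with 2 show ?thesis unfolding R_def by linarith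
qed

end

section \<open>Convergence\<close>

lemma sum_geometric_le:
  fixes r :: real
  assumes "0 \<le> r" "r < 1"
  shows "(\<Sum>l\<le>m. r ^ l) \<le> 1 / (1 - r)"
  using sum_le_suminf[OF summable_geometric, of r "{..m}"] assms by (simp add: suminf_geometric)

lemma const_c4_pos:
  assumes k: "k \<in> {3, 4, 5}" and m2: "0 < m2"
  shows "0 < const_c4 k m2 c3"
proof -
  have "0 < m1_bdf k" "0 < m3_bdf k" using k by (auto simp: m1_bdf_def m3_bdf_def rho_bdf_def)
  then show ?thesis using m2 by (auto simp: const_c4_def intro!: add_pos_nonneg)
qed

context lattice
begin

text \<open>
  The geometric series in \<open>k/7\<close> leaves half of the available factor \<open>7\<rho>\<^sub>k/(7-k)\<close> times \<open>c\<^sub>I\<close> in front of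
  \<open>\<Sum> \<parallel>\<nabla>e\<^sup>i\<parallel>\<close>. Since the last error enters only one of the differences, this sum is at most twice the sum of
  the errors minus \<open>\<parallel>e\<^sup>k\<^sup>-\<^sup>1\<parallel>\<close>, and what is saved there pays for \<open>2\<parallel>e\<^sup>k\<^sup>-\<^sup>1\<parallel>\<close>.
\<close>

lemma initial_term_bound:
  assumes k: "k \<in> {3, 4, 5}" and cI: "const_cI k cI"
    and e: "\<And>m. m < k \<Longrightarrow> Cper p q 0 (e m)"
  shows "2 * L2norm p q (e (k - 1)) + 4 * (\<Sum>l\<le>m. L2norm p q (\<lambda>x. v_init k (\<lambda>i. e i x) (k + l)))
      \<le> 7 * rho_bdf k / (7 - real k) * (cI * (\<Sum>l=0..k-1. L2norm p q (e l)))"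
proof -
  let ?a = "\<lambda>l. L2norm p q (e l)" and ?d = "\<lambda>i x. bdiff (\<lambda>i. e i x) i"
  define r where "r = real k / 7"
  define S where "S = (\<Sum>l=0..k-1. ?a l)"
  define D where "D = (\<Sum>i=1..k-1. L2norm p q (?d i))"
  have r: "0 \<le> r" "r < 1" using k by (auto simp: r_def)
  have cI1: "1 < cI" and cIb: "\<And>v j. k \<le> j \<Longrightarrow> \<bar>v_init k v j\<bar> \<le> cI * rho_bdf k / 8 * r ^ (j - k) * (\<Sum>l=1..k-1. \<bar>bdiff v l\<bar>)"
    using cI unfolding const_cI_def r_def by blast+
  have rho: "0 < rho_bdf k" by (simp add: rho_bdf_def)
  have dC: "Cper p q 0 (?d i)" if "i \<in> {1..k-1}" for i
    unfolding bdiff_def using that k by (intro Cper_diff e) auto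
  have vC: "Cper p q 0 (\<lambda>x. v_init k (\<lambda>i. e i x) j)" for j
    unfolding v_init_def by (intro Cper_sum Cper_mult Cper_const dC)
  have I: "L2norm p q (\<lambda>x. v_init k (\<lambda>i. e i x) (k + l)) \<le> cI * rho_bdf k / 8 * r ^ l * D" for l
  proof -
    have c: "0 \<le> cI * rho_bdf k / 8 * r ^ l" using cI1 rho r by simp
    have aC: "Cper p q 0 (\<lambda>x. \<bar>?d i x\<bar>)" if "i \<in> {1..k-1}" for i by (rule Cper_abs[OF dC[OF that]])
    have "L2norm p q (\<lambda>x. v_init k (\<lambda>i. e i x) (k + l)) \<le> L2norm p q (\<lambda>x. cI * rho_bdf k / 8 * r ^ l * (\<Sum>i=1..k-1. \<bar>?d i x\<bar>))"
    proof (rule L2norm_mono[OF vC])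
      show "Cper p q 0 (\<lambda>x. cI * rho_bdf k / 8 * r ^ l * (\<Sum>i=1..k-1. \<bar>?d i x\<bar>))"
        by (intro Cper_cmult Cper_sum aC)
      show "\<bar>v_init k (\<lambda>i. e i x) (k + l)\<bar> \<le> cI * rho_bdf k / 8 * r ^ l * (\<Sum>i=1..k-1. \<bar>?d i x\<bar>)" for x
        using cIb[of "k + l" "\<lambda>i. e i x"] by simp
    qed
    also have "\<dots> = cI * rho_bdf k / 8 * r ^ l * L2norm p q (\<lambda>x. \<Sum>i=1..k-1. \<bar>?d i x\<bar>)"
      by (rule L2norm_cmult[OF c])
    also have "\<dots> \<le> cI * rho_bdf k / 8 * r ^ l * (\<Sum>i=1..k-1. L2norm p q (\<lambda>x. \<bar>?d i x\<bar>))"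
      by (intro mult_left_mono c L2norm_sum aC) auto
    finally show ?thesis by (simp only: L2norm_abs D_def)
  qed
  have "(\<Sum>l\<le>m. L2norm p q (\<lambda>x. v_init k (\<lambda>i. e i x) (k + l))) \<le> (\<Sum>l\<le>m. cI * rho_bdf k / 8 * r ^ l * D)"
    by (rule sum_mono[OF I])
  also have "\<dots> = cI * rho_bdf k / 8 * D * (\<Sum>l\<le>m. r ^ l)"
    by (simp add: sum_distrib_left mult_ac)
  also have "\<dots> \<le> cI * rho_bdf k / 8 * D * (1 / (1 - r))"
    using cI1 rho by (intro mult_left_mono sum_geometric_le r) (auto simp: D_def intro!: mult_nonneg_nonneg sum_nonneg L2norm_nonneg)
  also have "1 / (1 - r) = 7 / (7 - real k)" using k by (auto simp: r_def)
  finally have "(\<Sum>l\<le>m. L2norm p q (\<lambda>x. v_init k (\<lambda>i. e i x) (k + l))) \<le> cI * rho_bdf k / 8 * D * (7 / (7 - real k))" .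
  moreover have "4 * (cI * rho_bdf k / 8 * D * (7 / d)) = 7 * rho_bdf k / d * cI * (D / 2)" for d by (simp add: mult_ac)
  ultimately have 1: "4 * (\<Sum>l\<le>m. L2norm p q (\<lambda>x. v_init k (\<lambda>i. e i x) (k + l))) \<le> 7 * rho_bdf k / (7 - real k) * cI * (D / 2)"
    by (smt (verit))
  have D: "D \<le> 2 * S - ?a (k - 1)"
  proof -
    have tri: "L2norm p q (?d i) \<le> ?a i + ?a (i - 1)" if "i \<in> {1..k-1}" for i
    proof -
      have C: "Cper p q 0 (e i)" "Cper p q 0 (e (i - 1))" using that k by (auto intro!: e)
      have "L2norm p q (\<lambda>x. e i x + (- e (i - 1) x)) \<le> ?a i + L2norm p q (\<lambda>x. - e (i - 1) x)"
        by (intro L2norm_triangle Cper_minus C)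
      then show ?thesis by (simp add: bdiff_def L2norm_def ip_def)
    qed
    have "D \<le> (\<Sum>i=1..k-1. ?a i + ?a (i - 1))" unfolding D_def by (rule sum_mono[OF tri])
    also have "\<dots> = (\<Sum>i=1..k-1. ?a i) + (\<Sum>i=1..k-1. ?a (i - 1))" by (rule sum.distrib)
    also have "(\<Sum>i=1..k-1. ?a i) = S - ?a 0"
      unfolding S_def by (subst sum.atLeast_Suc_atMost[of 0]) simp_all
    also have "(\<Sum>i=1..k-1. ?a (i - 1)) = (\<Sum>i=0..<k-1. ?a i)"
      by (rule sum.reindex_bij_witness[of _ Suc "\<lambda>i. i - 1"]) auto
    also have "(\<Sum>i=0..<k-1. ?a i) = S - ?a (k - 1)"
    proof -
      have "{0..k-1} = insert (k - 1) {0..<k-1}" using k by auto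
      then show ?thesis unfolding S_def by simp
    qed
    finally show ?thesis using L2norm_nonneg[of "e 0"] by linarith
  qed
  \<comment> \<open>\<open>X \<ge> 4\<close> because \<open>c\<^sub>I > 1\<close>; hence half of \<open>X \<parallel>e\<^sup>k\<^sup>-\<^sup>1\<parallel>\<close> covers \<open>2 \<parallel>e\<^sup>k\<^sup>-\<^sup>1\<parallel>\<close>.\<close>
  define X where "X = 7 * rho_bdf k / (7 - real k) * cI"
  have X: "4 \<le> X"
  proof -
    have "4 \<le> 7 * rho_bdf k / (7 - real k)" using k by (auto simp: rho_bdf_def)
    then have "4 * 1 \<le> 7 * rho_bdf k / (7 - real k) * cI" using cI1 by (intro mult_mono) auto
    then show ?thesis by (simp add: X_def)
  qed
  have "X * (D / 2) \<le> X * ((2 * S - ?a (k - 1)) / 2)" using X D by (intro mult_left_mono) auto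
  moreover have "4 * ?a (k - 1) \<le> X * ?a (k - 1)" using X by (intro mult_right_mono L2norm_nonneg)
  ultimately have "2 * ?a (k - 1) + X * (D / 2) \<le> X * S" by (simp add: algebra_simps)
  with 1 show ?thesis unfolding X_def[symmetric] S_def[symmetric] mult.assoc[symmetric] by linarith
qed

text \<open>
  A bound for the sum of squares, from \<open>doc_bounded\<close>, becomes one for the sum by the Cauchy-Schwarz
  inequality; both steps contribute a square root of the number of terms.
\<close>

lemma truncation_term_bound:
  assumes k: "k \<in> {3, 4, 5}" and \<xi>: "\<And>j. j \<le> m \<Longrightarrow> Cper p q 0 (\<xi> j)" "\<And>j x. j \<le> m \<Longrightarrow> \<bar>\<xi> j x\<bar> \<le> \<delta>" and \<delta>: "0 \<le> \<delta>"
  shows "(\<Sum>l\<le>m. L2norm p q (\<lambda>x. conv (doc k) (\<lambda>j. \<xi> j x) l)) \<le> 2 * sqrt area / sigma_L k * \<delta> * real (Suc m)"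
proof (rule power2_le_imp_le)
  let ?X = "\<lambda>l x. conv (doc k) (\<lambda>j. \<xi> j x) l"
  have XC: "Cper p q 0 (?X l)" if "l \<le> m" for l using that by (intro Cper_conv \<xi>) auto
  have "(\<Sum>l\<le>m. L2norm p q (?X l))\<^sup>2 \<le> (\<Sum>l\<le>m. (L2norm p q (?X l))\<^sup>2) * real (card {..m})"
    by (rule sum_squared_le_sum_of_squares)
  then have S1: "(\<Sum>l\<le>m. L2norm p q (?X l))\<^sup>2 \<le> (\<Sum>l\<le>m. (L2norm p q (?X l))\<^sup>2) * real (Suc m)"
    by (simp only: card_atMost)
  have "(\<Sum>l\<le>m. (L2norm p q (?X l))\<^sup>2) = cint (\<lambda>x. \<Sum>l\<le>m. (?X l x)\<^sup>2)"
    unfolding L2norm_sq by (rule cint_sum0[symmetric]) (auto intro!: Cper_power XC)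
  also have "\<dots> \<le> cint (\<lambda>x. 4 / (sigma_L k)\<^sup>2 * (real (Suc m) * \<delta>\<^sup>2))"
  proof (rule cint_mono0)
    fix x
    have "(\<Sum>l\<le>m. (\<xi> l x)\<^sup>2) \<le> (\<Sum>l\<le>m. \<delta>\<^sup>2)"
      using \<xi>(2) \<delta> by (intro sum_mono) (auto simp: abs_le_square_iff[symmetric])
    then have "(\<Sum>l\<le>m. (\<xi> l x)\<^sup>2) \<le> real (Suc m) * \<delta>\<^sup>2" by simp
    then have "4 / (sigma_L k)\<^sup>2 * (\<Sum>l\<le>m. (\<xi> l x)\<^sup>2) \<le> 4 / (sigma_L k)\<^sup>2 * (real (Suc m) * \<delta>\<^sup>2)"
      by (intro mult_left_mono) auto
    with doc_bounded[OF k, of "\<lambda>j. \<xi> j x" m]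
    show "(\<Sum>l\<le>m. (?X l x)\<^sup>2) \<le> 4 / (sigma_L k)\<^sup>2 * (real (Suc m) * \<delta>\<^sup>2)" by linarith
  qed (auto intro!: Cper_sum Cper_power XC Cper_const)
  also have "\<dots> = 4 / (sigma_L k)\<^sup>2 * (real (Suc m) * \<delta>\<^sup>2) * area" by (rule cint_const)
  finally have "(\<Sum>l\<le>m. (L2norm p q (?X l))\<^sup>2) * real (Suc m) \<le> 4 / (sigma_L k)\<^sup>2 * (real (Suc m) * \<delta>\<^sup>2) * area * real (Suc m)"
    by (intro mult_right_mono) auto
  with S1 have "(\<Sum>l\<le>m. L2norm p q (?X l))\<^sup>2 \<le> 4 / (sigma_L k)\<^sup>2 * (real (Suc m) * \<delta>\<^sup>2) * area * real (Suc m)"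
    by (rule order_trans)
  moreover have "4 / (sigma_L k)\<^sup>2 * (M * \<delta>\<^sup>2) * area * M = (2 * sqrt area / sigma_L k * \<delta> * M)\<^sup>2" for M
    using area_pos by (simp add: power_mult_distrib power_divide) (simp add: power2_eq_square)
  ultimately show "(\<Sum>l\<le>m. L2norm p q (?X l))\<^sup>2 \<le> (2 * sqrt area / sigma_L k * \<delta> * real (Suc m))\<^sup>2"
    by (simp only:)
  show "0 \<le> 2 * sqrt area / sigma_L k * \<delta> * real (Suc m)"
    using area_pos \<delta> sigma_L_pos[of k] by simp
qed

text \<open>
  The abstract error equation: \<open>F\<close> stands for the difference of the nonlinear terms, and \<open>\<delta>\<close> bounds the
  truncation error.
\<close>

lemma convergence_core:
  assumes k: "k \<in> {3, 4, 5}" and \<tau>: "0 < \<tau>" and m2: "(bdf_b k 0)\<^sup>2 \<le> m2" "0 < m2" and cI: "const_cI k cI"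
    and e: "\<And>m. m \<le> N \<Longrightarrow> Cper p q 0 (e m)" "\<And>m. k \<le> m \<Longrightarrow> m \<le> N \<Longrightarrow> Cper p q 6 (e m)"
    and F: "\<And>m. k \<le> m \<Longrightarrow> m \<le> N \<Longrightarrow> Cper p q 2 (F m)"
      "\<And>m x. k \<le> m \<Longrightarrow> m \<le> N \<Longrightarrow> \<bar>F m x\<bar> \<le> c3 * \<bar>e m x\<bar>"
    and \<xi>: "\<And>m x. k \<le> m \<Longrightarrow> m \<le> N \<Longrightarrow>
      \<bar>bdf_D k \<tau> (\<lambda>i. e i x) m - laplacian (\<lambda>x. one_plus_laplacian (one_plus_laplacian (e m)) x + F m x) x\<bar> \<le> \<delta>"
    and \<delta>: "0 \<le> \<delta>"
    and c4: "c4 = const_c4 k m2 c3" and step: "\<tau> \<le> 1 / (2 * c4)"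
    and n: "k \<le> n" "n \<le> N"
  shows "L2norm p q (e n) \<le> exp (2 * c4 * (real (n - k + 1) * \<tau>)) *
      (7 * rho_bdf k / (7 - real k) * (cI * (\<Sum>l=0..k-1. L2norm p q (e l)))
        + 8 * sqrt area / sigma_L k * \<delta> * (real (n - k + 1) * \<tau>))"
proof -
  let ?L = one_plus_laplacian and ?\<theta> = "doc k"
  define M where "M = n - k"
  have nM: "n = k + M" using n by (simp add: M_def)
  define R where "R j = laplacian (\<lambda>x. ?L (?L (e (k + j))) x + F (k + j) x)" for j
  define z where "z j x = bdf_D k \<tau> (\<lambda>i. e i x) (k + j) - R j x" for j x
  define V where "V l x = v_init k (\<lambda>i. e i x) (k + l)" for l x
  define X where "X l x = conv ?\<theta> (\<lambda>j. z j x) l" for l x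
  \<comment> \<open>\<open>V\<close>, \<open>X\<close> and \<open>Y\<close> are the contributions of the starting errors, of the truncation errors and
    of the equation to the difference of the errors; \<open>y 0\<close> belongs to time \<open>k - 1\<close>.\<close>
  define Y where "Y l x = conv ?\<theta> (\<lambda>j. R j x) l" for l x
  define y where "y l = L2norm p q (e (k - 1 + l))" for l
  define g where "g l = 2 * L2norm p q (V l) + 2 * \<tau> * L2norm p q (X l)" for l
  have le: "k + j \<le> N" if "j \<le> M" for j using that n nM by simp
  have eC: "Cper p q 0 (e (k + j))" if "j \<le> M" for j using e(1)[OF le[OF that]] .
  have dC: "Cper p q 0 (\<lambda>x. bdiff (\<lambda>i. e i x) i)" if "i \<le> N" for i
    unfolding bdiff_def by (intro Cper_diff e(1)) (use that in auto)
  have six: "6 = Suc (Suc (Suc (Suc 2)))" by simp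
  have RC: "Cper p q 0 (R j)" if "j \<le> M" for j
  proof -
    have "Cper p q 6 (e (k + j))" "Cper p q (Suc (Suc 0)) (F (k + j))" using e(2) F(1) le[OF that] by (auto simp: numeral_2_eq_2)
    then show ?thesis unfolding R_def six numeral_2_eq_2
      by (intro Cper_laplacian Cper_add Cper_one_plus_laplacian) auto
  qed
  have zC: "Cper p q 0 (z j)" if "j \<le> M" for j
    unfolding z_def[abs_def] bdf_D_def using le[OF that] by (intro Cper_diff Cper_cmult Cper_sum RC dC that) auto
  have VC: "Cper p q 0 (V l)" for l
    unfolding V_def[abs_def] v_init_def using n by (intro Cper_sum Cper_mult Cper_const dC) auto
  have XC: "Cper p q 0 (X l)" and YC: "Cper p q 0 (Y l)" if "l \<le> M" for l
    unfolding X_def[abs_def] Y_def[abs_def] using that by (auto intro!: Cper_conv zC RC)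
  have split: "bdiff (\<lambda>i. e i x) (k + l) = \<tau> * Y l x + \<tau> * X l x - V l x" for l x
  proof -
    have "bdiff (\<lambda>i. e i x) (k + l) = \<tau> * conv ?\<theta> (\<lambda>j. R j x + z j x) l - V l x"
      using doc_recover_difference[OF k, of \<tau> "\<lambda>i. e i x" l] \<tau> by (simp add: z_def V_def)
    then show ?thesis by (simp add: conv_add X_def Y_def distrib_left)
  qed
  have stepl: "(y (Suc l))\<^sup>2 \<le> (y l)\<^sup>2 + y (Suc l) * g l + 2 * \<tau> * cint (\<lambda>x. e (k + l) x * Y l x)" if l: "l \<le> M" for l
  proof -
    have E: "Cper p q 0 (e (k + l))" and E': "Cper p q 0 (e (k - 1 + l))"
      using eC[OF l] e(1)[of "k - 1 + l"] le[OF l] by auto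
    have idx: "k - 1 + Suc l = k + l" "k + l - 1 = k - 1 + l" using k by auto
    have "(y (Suc l))\<^sup>2 - (y l)\<^sup>2 = cint (\<lambda>x. (e (k + l) x)\<^sup>2 - (e (k - 1 + l) x)\<^sup>2)"
      unfolding y_def idx L2norm_sq by (rule cint_diff0[symmetric]) (intro Cper_power E E')+
    also have "\<dots> \<le> cint (\<lambda>x. (2 * \<tau>) * (e (k + l) x * Y l x) + 1 * ((2 * \<tau>) * (e (k + l) x * X l x) + (-2) * (e (k + l) x * V l x)))"
    proof (rule cint_mono0)
      fix x
      have d: "e (k + l) x - e (k - 1 + l) x = \<tau> * Y l x + \<tau> * X l x - V l x"
        using split[of x l] by (simp only: bdiff_def idx)
      have "(e (k + l) x)\<^sup>2 - (e (k - 1 + l) x)\<^sup>2 = 2 * e (k + l) x * (e (k + l) x - e (k - 1 + l) x) - (e (k + l) x - e (k - 1 + l) x)\<^sup>2"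
        by (simp add: power2_eq_square algebra_simps)
      also have "\<dots> \<le> 2 * e (k + l) x * (e (k + l) x - e (k - 1 + l) x)" by simp
      also have "\<dots> = (2 * \<tau>) * (e (k + l) x * Y l x) + 1 * ((2 * \<tau>) * (e (k + l) x * X l x) + (-2) * (e (k + l) x * V l x))"
        unfolding d by (simp add: algebra_simps)
      finally show "(e (k + l) x)\<^sup>2 - (e (k - 1 + l) x)\<^sup>2 \<le> (2 * \<tau>) * (e (k + l) x * Y l x) + 1 * ((2 * \<tau>) * (e (k + l) x * X l x) + (-2) * (e (k + l) x * V l x))" .
    qed (intro Cper_add Cper_diff Cper_cmult Cper_mult Cper_power E E' XC YC VC l)+
    also have "\<dots> = (2 * \<tau>) * cint (\<lambda>x. e (k + l) x * Y l x) + 1 * cint (\<lambda>x. (2 * \<tau>) * (e (k + l) x * X l x) + (-2) * (e (k + l) x * V l x))"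
      by (rule cint_lincomb0) (intro Cper_add Cper_cmult Cper_mult E XC YC VC l)+
    also have "cint (\<lambda>x. (2 * \<tau>) * (e (k + l) x * X l x) + (-2) * (e (k + l) x * V l x))
        = (2 * \<tau>) * cint (\<lambda>x. e (k + l) x * X l x) + (-2) * cint (\<lambda>x. e (k + l) x * V l x)"
      by (rule cint_lincomb0) (intro Cper_mult E XC VC l)+
    finally have A: "(y (Suc l))\<^sup>2 - (y l)\<^sup>2 \<le> (2 * \<tau>) * cint (\<lambda>x. e (k + l) x * Y l x)
        + 1 * ((2 * \<tau>) * cint (\<lambda>x. e (k + l) x * X l x) + (-2) * cint (\<lambda>x. e (k + l) x * V l x))" .
    have "cint (\<lambda>x. e (k + l) x * X l x) \<le> y (Suc l) * L2norm p q (X l)"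
      using cauchy_schwarz[OF E XC[OF l]] unfolding y_def idx by linarith
    then have "(2 * \<tau>) * cint (\<lambda>x. e (k + l) x * X l x) \<le> (2 * \<tau>) * (y (Suc l) * L2norm p q (X l))"
      using \<tau> by (intro mult_left_mono) auto
    moreover have "(-2) * cint (\<lambda>x. e (k + l) x * V l x) \<le> 2 * (y (Suc l) * L2norm p q (V l))"
      using cauchy_schwarz[OF E VC, of l] unfolding y_def idx by linarith
    moreover have "y (Suc l) * g l = 2 * (y (Suc l) * L2norm p q (V l)) + (2 * \<tau>) * (y (Suc l) * L2norm p q (X l))"
      by (simp add: g_def algebra_simps)
    moreover have "a \<le> b + r + t" if "a - b \<le> t + 1 * (u + v)" "u \<le> u'" "v \<le> v'" "r = v' + u'"
      for a b r t u v u' v' :: real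
      using that by (smt (verit))
    ultimately show ?thesis using A by blast
  qed
  have c4p: "0 < c4" unfolding c4 by (rule const_c4_pos[OF k m2(2)])
  have rec: "(y (Suc m))\<^sup>2 \<le> (y 0)\<^sup>2 + (\<Sum>l\<le>m. y (Suc l) * g l) + (\<tau> * c4) * (\<Sum>l\<le>m. (y (Suc l))\<^sup>2)" if m: "m \<le> M" for m
  proof -
    have "(y (Suc m))\<^sup>2 \<le> (y 0)\<^sup>2 + (\<Sum>l\<le>m. y (Suc l) * g l) + (\<Sum>l\<le>m. 2 * \<tau> * cint (\<lambda>x. e (k + l) x * Y l x))"
      using m
    proof (induction m)
      case 0
      then show ?case using stepl[of 0] by simp
    next
      case (Suc m)
      then show ?case using stepl[of "Suc m"] by simp
    qed
    also have "(\<Sum>l\<le>m. 2 * \<tau> * cint (\<lambda>x. e (k + l) x * Y l x)) = \<tau> * (2 * (\<Sum>l\<le>m. cint (\<lambda>x. e (k + l) x * Y l x)))"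
      by (simp add: sum_distrib_left mult_ac)
    also have "2 * (\<Sum>l\<le>m. cint (\<lambda>x. e (k + l) x * Y l x)) \<le> c4 * (\<Sum>l\<le>m. cint (\<lambda>x. (e (k + l) x)\<^sup>2))"
      unfolding Y_def R_def c4
      by (rule diffusion_estimate[OF k m2(1)]) (use e(2) F le m in auto)
    also have "(\<Sum>l\<le>m. cint (\<lambda>x. (e (k + l) x)\<^sup>2)) = (\<Sum>l\<le>m. (y (Suc l))\<^sup>2)"
    proof -
      have "k - 1 + Suc l = k + l" for l using k by auto
      then show ?thesis by (simp only: y_def L2norm_sq)
    qed
    finally show ?thesis using \<tau> by (simp add: mult_left_mono mult.assoc)
  qed
  have half: "\<tau> * c4 \<le> 1/2"
    using step c4p by (simp add: field_simps)
  have y0: "0 \<le> y l" for l by (simp add: y_def L2norm_nonneg)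
  have g0: "0 \<le> g l" for l using \<tau> by (simp add: g_def L2norm_nonneg)
  have c0: "0 \<le> \<tau> * c4" using \<tau> c4p by simp
  have "y (Suc M) \<le> 2 * (y 0 + (\<Sum>l\<le>M. g l)) * exp (2 * (\<tau> * c4) * real (Suc M))"
    by (rule gronwall_quadratic[OF y0 g0 c0 half rec])
  also have "2 * (y 0 + (\<Sum>l\<le>M. g l)) = (2 * y 0 + 4 * (\<Sum>l\<le>M. L2norm p q (V l))) + 4 * \<tau> * (\<Sum>l\<le>M. L2norm p q (X l))"
    by (simp add: g_def sum.distrib sum_distrib_left[symmetric] algebra_simps)
  also have "\<dots> \<le> 7 * rho_bdf k / (7 - real k) * (cI * (\<Sum>l=0..k-1. L2norm p q (e l)))
        + 8 * sqrt area / sigma_L k * \<delta> * (real (n - k + 1) * \<tau>)"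
  proof (rule add_mono)
    show "2 * y 0 + 4 * (\<Sum>l\<le>M. L2norm p q (V l)) \<le> 7 * rho_bdf k / (7 - real k) * (cI * (\<Sum>l=0..k-1. L2norm p q (e l)))"
      using initial_term_bound[OF k cI, of e M] e(1) n by (simp add: y_def V_def[abs_def])
    have "(\<Sum>l\<le>M. L2norm p q (X l)) \<le> 2 * sqrt area / sigma_L k * \<delta> * real (Suc M)"
      unfolding X_def[abs_def]
    proof (rule truncation_term_bound[OF k zC _ \<delta>])
      show "\<bar>z j x\<bar> \<le> \<delta>" if "j \<le> M" for j x
        using \<xi>[of "k + j" x] le[OF that] by (simp add: z_def R_def)
    qed
    then have "4 * \<tau> * (\<Sum>l\<le>M. L2norm p q (X l)) \<le> 4 * \<tau> * (2 * sqrt area / sigma_L k * \<delta> * real (Suc M))"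
      using \<tau> by (intro mult_left_mono) auto
    also have "\<dots> = 8 * sqrt area / sigma_L k * \<delta> * (real (n - k + 1) * \<tau>)" by (simp add: nM mult_ac)
    finally show "4 * \<tau> * (\<Sum>l\<le>M. L2norm p q (X l)) \<le> 8 * sqrt area / sigma_L k * \<delta> * (real (n - k + 1) * \<tau>)" .
  qed
  also have "y (Suc M) = L2norm p q (e n)"
  proof -
    have "k - 1 + Suc M = n" using k by (auto simp: nM)
    then show ?thesis by (simp add: y_def)
  qed
  also have "exp (2 * (\<tau> * c4) * real (Suc M)) = exp (2 * c4 * (real (n - k + 1) * \<tau>))"
    by (simp add: nM mult_ac)
  finally show ?thesis by (simp add: mult.commute)
qed

end

theorem theorem4p1:
  fixes p q :: "real^2" and k :: nat
    and \<epsilon> T c0 c\<Omega> c2 cI m2 c4 :: real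
    and \<Phi> :: "real \<Rightarrow> real^2 \<Rightarrow> real"
  assumes "k \<in> {3, 4, 5}" and "0 < \<epsilon>" and "\<epsilon> < 1" and "0 < T"
    and "p \<noteq> q" and "independent {p, q}"
    and "const_m2 k m2" and "const_cI k cI" and "const_cOmega p q c\<Omega>"
    and "c4 = const_c4 k m2 (const_c3 \<epsilon> (const_c1 p q \<epsilon> c\<Omega> c0) c2)"
    and "pfc_solution p q \<epsilon> T \<Phi>" and "C_time (k + 1) T \<Phi>"
  shows "\<exists>C\<phi>>0. \<forall>N>0. \<forall>\<tau> \<phi>.
      \<tau> = T / real N \<longrightarrow>
      (\<forall>n\<in>{1..N}. Linfnorm p q (\<Phi> (real n * \<tau>)) \<le> c2) \<longrightarrow>
      bdf_scheme p q \<epsilon> k \<tau> N \<phi> \<longrightarrow>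
      (\<forall>l\<in>{1..k-1}. ip p q (\<phi> l) (\<lambda>_. 1) = ip p q (\<phi> 0) (\<lambda>_. 1)) \<longrightarrow>
      \<tau> \<le> 2 / (3 * \<epsilon>) * min (bdf_b k 0) (sigma_L k) \<longrightarrow>
      discrete_energy p q \<epsilon> k \<tau> \<phi> (k - 1) \<le> c0 \<longrightarrow>
      \<tau> \<le> 1 / (2 * c4) \<longrightarrow>
      (\<forall>n\<in>{k..N}.
         L2norm p q (\<lambda>x. \<Phi> (real n * \<tau>) x - \<phi> n x)
         \<le> 7 * rho_bdf k / (7 - real k) * exp (2 * c4 * (real (n - k + 1) * \<tau>)) *
            (cI * (\<Sum>l=0..k-1. L2norm p q (\<lambda>x. \<Phi> (real l * \<tau>) x - \<phi> l x))
             + C\<phi> * (real (n - k + 1) * \<tau>) * \<tau> ^ k))"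
proof -
  note k = assms(1) and eps = assms(2,3) and T = assms(4) and sol = assms(11) and Ct = assms(12)
  obtain P Q where "lattice p q P Q" using lattice_exists[OF assms(5,6)] .
  then interpret lattice p q P Q .
  have per: "periodic p q (\<Phi> t)" if "t \<in> {0..T}" for t using sol that by (simp add: pfc_solution_def)
  obtain B where B0: "0 \<le> B" and B: "\<And>\<tau> n x. 0 < \<tau> \<Longrightarrow> k \<le> n \<Longrightarrow> real n * \<tau> \<le> T \<Longrightarrow>
      \<bar>bdf_D k \<tau> (\<lambda>m. \<Phi> (real m * \<tau>) x) n - time_deriv T \<Phi> (real n * \<tau>) x\<bar> \<le> B * \<tau> ^ k"
    using truncation_error[OF k Ct per T] by blast
  \<comment> \<open>The constant \<open>B\<close> depends on the exact solution alone, so \<open>C\<phi> = K + 1\<close> may be fixed before the step size;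
    adding \<open>1\<close> makes it positive.\<close>
  define K where "K = 8 * sqrt area / sigma_L k * B"
  define \<rho> where "\<rho> = 7 * rho_bdf k / (7 - real k)"
  have K0: "0 \<le> K" using B0 area_pos sigma_L_pos[of k] by (simp add: K_def)
  have \<rho>1: "1 \<le> \<rho>" using k by (auto simp: \<rho>_def rho_bdf_def)
  have m2: "(bdf_b k 0)\<^sup>2 \<le> m2" "0 < m2" using const_m2_lower assms(7) by (auto simp: const_m2_def)
  show ?thesis
  proof (intro exI[of _ "K + 1"] conjI allI impI ballI)
    show "0 < K + 1" using K0 by simp
    fix N :: nat and \<tau> :: real and \<phi> n
    assume N: "0 < N" and \<tau>: "\<tau> = T / real N" and c2: "\<forall>n\<in>{1..N}. Linfnorm p q (\<Phi> (real n * \<tau>)) \<le> c2"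
      and s: "bdf_scheme p q \<epsilon> k \<tau> N \<phi>"
      and vol: "\<forall>l\<in>{1..k-1}. ip p q (\<phi> l) (\<lambda>_. 1) = ip p q (\<phi> 0) (\<lambda>_. 1)"
      and step1: "\<tau> \<le> 2 / (3 * \<epsilon>) * min (bdf_b k 0) (sigma_L k)"
      and c0: "discrete_energy p q \<epsilon> k \<tau> \<phi> (k - 1) \<le> c0" and step2: "\<tau> \<le> 1 / (2 * c4)" and n: "n \<in> {k..N}"
    have \<tau>0: "0 < \<tau>" using \<tau> N T by simp
    have tT: "real m * \<tau> \<in> {0..T}" if "m \<le> N" for m
      using that N T by (auto simp: \<tau> field_simps)
    have vol': "cint (\<phi> l) = cint (\<phi> 0)" if "l < k" for l
      using vol that by (cases "l = 0") (auto simp: ip_eq_cell_integral)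
    have step1': "\<tau> \<le> 2 / (3 * \<epsilon>) * sigma_L k"
    proof -
      have "2 / (3 * \<epsilon>) * min (bdf_b k 0) (sigma_L k) \<le> 2 / (3 * \<epsilon>) * sigma_L k"
        using eps by (intro mult_left_mono) auto
      then show ?thesis using step1 by linarith
    qed
    define c1 where "c1 = const_c1 p q \<epsilon> c\<Omega> c0"
    define c3 where "c3 = const_c3 \<epsilon> c1 c2"
    define e where "e m x = \<Phi> (real m * \<tau>) x - \<phi> m x" for m x
    define u where "u m = \<Phi> (real m * \<tau>)" for m
    define F where "F m x = ((u m x) ^ 3 - \<epsilon> * u m x) - ((\<phi> m x) ^ 3 - \<epsilon> * \<phi> m x)" for m x
    have u0: "Cper p q 0 (u m)" if "m \<le> N" for m
    proof -
      have "continuous_on UNIV (\<lambda>x. (\<lambda>(t, x). \<Phi> t x) (real m * \<tau>, x))"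
        by (rule continuous_on_compose2[OF C_time_continuous[OF Ct]]) (use tT[OF that] in \<open>auto intro!: continuous_intros\<close>)
      then show ?thesis using per[OF tT[OF that]] by (simp add: Cper_def u_def)
    qed
    have pos: "real m * \<tau> \<in> {0<..T}" if "1 \<le> m" "m \<le> N" for m using tT[OF that(2)] that(1) \<tau>0 by auto
    have u6: "Cper p q 6 (u m)" if "1 \<le> m" "m \<le> N" for m
      using sol pos[OF that] per[OF tT[OF that(2)]] unfolding pfc_solution_def u_def Cper_def by blast
    have ueq: "time_deriv T \<Phi> (real m * \<tau>) x = laplacian (chem_pot \<epsilon> (u m)) x" if "1 \<le> m" "m \<le> N" for m x
      using sol pos[OF that] unfolding pfc_solution_def u_def by blast
    have k1: "1 \<le> m" if "k \<le> m" for m using that k by auto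
    have \<phi>6: "Cper p q 6 (\<phi> m)" if "k \<le> m" "m \<le> N" for m using scheme_Cper(2)[OF s that(2,1)] .
    have e6: "Cper p q 6 (e m)" if "k \<le> m" "m \<le> N" for m
      using Cper_diff[OF u6[OF k1[OF that(1)] that(2)] \<phi>6[OF that]] by (simp add: e_def[abs_def] u_def)
    have "L2norm p q (e n) \<le> exp (2 * c4 * (real (n - k + 1) * \<tau>)) *
      (7 * rho_bdf k / (7 - real k) * (cI * (\<Sum>l=0..k-1. L2norm p q (e l)))
        + 8 * sqrt area / sigma_L k * (B * \<tau> ^ k) * (real (n - k + 1) * \<tau>))"
    proof (rule convergence_core[OF k \<tau>0 m2 assms(8)])
      show "Cper p q 0 (e m)" if "m \<le> N" for m
        using Cper_diff[OF u0[OF that] Cper_mono[OF scheme_Cper(1)[OF s that]]] by (simp add: e_def[abs_def] u_def)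
      show "Cper p q 6 (e m)" if "k \<le> m" "m \<le> N" for m using e6[OF that] .
      show "Cper p q 2 (F m)" if "k \<le> m" "m \<le> N" for m
        unfolding F_def[abs_def] using Cper_mono[OF u6[OF k1[OF that(1)] that(2)], of 2] Cper_mono[OF \<phi>6[OF that], of 2]
        by (intro Cper_diff Cper_power Cper_cmult) auto
      show "\<bar>F m x\<bar> \<le> c3 * \<bar>e m x\<bar>" if "k \<le> m" "m \<le> N" for m x
      proof -
        have U: "\<bar>u m x\<bar> \<le> c2"
        proof -
          have "Linfnorm p q (u m) \<le> c2" unfolding u_def using k1[OF that(1)] that(2) by (intro bspec[OF c2]) simp
          then show ?thesis using Linfnorm_bound[OF u0[OF that(2)], of x] by linarith
        qed
        have V: "\<bar>\<phi> m x\<bar> \<le> c1"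
          unfolding c1_def by (rule scheme_bound[OF k s \<tau>0 vol' eps step1' c0 assms(9) that])
        have "F m x = ((u m x)\<^sup>2 + u m x * \<phi> m x + (\<phi> m x)\<^sup>2 - \<epsilon>) * e m x"
          by (simp add: F_def e_def u_def power2_eq_square power3_eq_cube algebra_simps)
        moreover have "\<bar>(u m x)\<^sup>2 + u m x * \<phi> m x + (\<phi> m x)\<^sup>2 - \<epsilon>\<bar> \<le> c3"
        proof -
          have "(u m x)\<^sup>2 \<le> c2\<^sup>2" "(\<phi> m x)\<^sup>2 \<le> c1\<^sup>2" using U V by (auto simp: abs_le_square_iff[symmetric])
          moreover have "\<bar>u m x * \<phi> m x\<bar> \<le> c1 * c2"
            unfolding abs_mult mult.commute[of "\<bar>u m x\<bar>"] using U V by (intro mult_mono) auto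
          ultimately have "\<bar>(u m x)\<^sup>2 + u m x * \<phi> m x + (\<phi> m x)\<^sup>2 - \<epsilon>\<bar> \<le> c2\<^sup>2 + c1 * c2 + c1\<^sup>2 + \<epsilon>"
            using eps zero_le_power2[of "u m x"] zero_le_power2[of "\<phi> m x"] by linarith
          then show ?thesis by (simp only: c3_def const_c3_def)
        qed
        ultimately show ?thesis by (simp add: abs_mult mult_right_mono)
      qed
      show "\<bar>bdf_D k \<tau> (\<lambda>i. e i x) m - laplacian (\<lambda>x. one_plus_laplacian (one_plus_laplacian (e m)) x + F m x) x\<bar> \<le> B * \<tau> ^ k"
        if m: "k \<le> m" "m \<le> N" for m x
      proof -
        have uC: "Cper p q 6 (u m)" using u6[OF k1[OF m(1)] m(2)] .
        have L: "one_plus_laplacian (\<lambda>x. f x - g x) = (\<lambda>x. one_plus_laplacian f x - one_plus_laplacian g x)"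
          if "Cper p q 2 f" "Cper p q 2 g" for f g
          using that unfolding one_plus_laplacian_def[abs_def] by (simp add: laplacian_diff Cper_def fun_eq_iff)
        have six: "6 = Suc (Suc (Suc (Suc 2)))" by simp
        have "Cper p q (Suc (Suc 2)) (one_plus_laplacian (u m))" "Cper p q (Suc (Suc 2)) (one_plus_laplacian (\<phi> m))"
          using uC \<phi>6[OF m] unfolding six by (auto intro: Cper_one_plus_laplacian)
        then have L2: "Cper p q 2 (one_plus_laplacian (u m))" "Cper p q 2 (one_plus_laplacian (\<phi> m))"
          by (auto intro: Cper_mono)
        have em: "e m = (\<lambda>x. u m x - \<phi> m x)" by (simp add: e_def u_def fun_eq_iff)
        have "one_plus_laplacian (one_plus_laplacian (e m)) =
            (\<lambda>x. one_plus_laplacian (one_plus_laplacian (u m)) x - one_plus_laplacian (one_plus_laplacian (\<phi> m)) x)"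
          unfolding em using L[OF Cper_mono[OF uC] Cper_mono[OF \<phi>6[OF m]]] L[OF L2] by simp
        then have "(\<lambda>x. one_plus_laplacian (one_plus_laplacian (e m)) x + F m x) = (\<lambda>x. chem_pot \<epsilon> (u m) x - chem_pot \<epsilon> (\<phi> m) x)"
          by (simp add: F_def chem_pot_def fun_eq_iff)
        moreover have "laplacian (\<lambda>x. chem_pot \<epsilon> (u m) x - chem_pot \<epsilon> (\<phi> m) x) = (\<lambda>x. laplacian (chem_pot \<epsilon> (u m)) x - laplacian (chem_pot \<epsilon> (\<phi> m)) x)"
          using Cper_chem_pot[OF uC] Cper_chem_pot[OF \<phi>6[OF m]] by (intro laplacian_diff) (auto simp: Cper_def)
        moreover have "bdf_D k \<tau> (\<lambda>i. e i x) m = bdf_D k \<tau> (\<lambda>i. \<Phi> (real i * \<tau>) x) m - bdf_D k \<tau> (\<lambda>i. \<phi> i x) m"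
          unfolding e_def by (rule bdf_D_diff)
        moreover have "bdf_D k \<tau> (\<lambda>i. \<phi> i x) m = laplacian (chem_pot \<epsilon> (\<phi> m)) x"
          using s m by (auto simp: bdf_scheme_def)
        moreover have "real m * \<tau> \<le> T" using tT[OF m(2)] by simp
        ultimately show ?thesis using B[OF \<tau>0 m(1), of x] ueq[OF k1[OF m(1)] m(2), of x] by simp
      qed
      show "0 \<le> B * \<tau> ^ k" using B0 \<tau>0 by simp
      show "c4 = const_c4 k m2 c3" using assms(10) by (simp add: c3_def c1_def)
    qed (use step2 n in auto)
    also have "8 * sqrt area / sigma_L k * (B * \<tau> ^ k) * (real (n - k + 1) * \<tau>) = K * (real (n - k + 1) * \<tau>) * \<tau> ^ k"
      by (simp add: K_def)
    also have "exp (2 * c4 * (real (n - k + 1) * \<tau>)) * (7 * rho_bdf k / (7 - real k) * (cI * (\<Sum>l=0..k-1. L2norm p q (e l))) + K * (real (n - k + 1) * \<tau>) * \<tau> ^ k)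
        \<le> exp (2 * c4 * (real (n - k + 1) * \<tau>)) * (\<rho> * (cI * (\<Sum>l=0..k-1. L2norm p q (e l)) + (K + 1) * (real (n - k + 1) * \<tau>) * \<tau> ^ k))"
    proof (rule mult_left_mono)
      define x where "x = real (n - k + 1) * \<tau> * \<tau> ^ k"
      have x: "0 \<le> x" using \<tau>0 by (simp add: x_def)
      have "1 * (K * x) \<le> \<rho> * ((K + 1) * x)" using \<rho>1 K0 x by (intro mult_mono mult_right_mono) auto
      then show "7 * rho_bdf k / (7 - real k) * (cI * (\<Sum>l=0..k-1. L2norm p q (e l))) + K * (real (n - k + 1) * \<tau>) * \<tau> ^ k
          \<le> \<rho> * (cI * (\<Sum>l=0..k-1. L2norm p q (e l)) + (K + 1) * (real (n - k + 1) * \<tau>) * \<tau> ^ k)"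
        unfolding \<rho>_def[symmetric] by (simp add: x_def distrib_left mult.assoc)
    qed simp
    finally show "L2norm p q (\<lambda>x. \<Phi> (real n * \<tau>) x - \<phi> n x)
         \<le> 7 * rho_bdf k / (7 - real k) * exp (2 * c4 * (real (n - k + 1) * \<tau>)) *
            (cI * (\<Sum>l=0..k-1. L2norm p q (\<lambda>x. \<Phi> (real l * \<tau>) x - \<phi> l x))
             + (K + 1) * (real (n - k + 1) * \<tau>) * \<tau> ^ k)"
      unfolding e_def[abs_def] \<rho>_def by (simp only: mult_ac)
  qed
qed

end
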